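(* Let $\Omega\subset\mathbb{C}$ be a bounded domain whose boundary consists of a finite number of disjoint Jordan curves. Let $\{z_1,\ldots,z_N\}$ be a set containing exactly one point from every bounded component of $\mathbb{C}\setminus\overline{\Omega}$. Let $f\in A(\Omega)$ and $\varepsilon>0$. Then there exist Dirichlet polynomials $P_0,P_1,\ldots,P_N$ so that the "rational Dirichlet" function $$R(s)=P_0(s)+P_1\left(\frac{1}{s-z_1}\right)+\ldots+P_N\left(\frac{1}{s-z_N}\right)$$ satisfies $$\|f-R\|_{C(\overline{\Omega})}<\varepsilon.$$
   Context: $A(\Omega)$ denotes the set of functions $\overline{\Omega}\to\mathbb{C}$ that are continuous on $\overline{\Omega}$ and holomorphic on $\Omega$. $\|\cdot\|_{C(\overline{\Omega})}$ is the supremum norm on $\overline{\Omega}$. A Dirichlet polynomial is a function of the form $P(s)=\sum_{n=1}^{M}a_n\frac{1}{n^s}$ with $M\in\mathbb{N}$ and $a_n\in\mathbb{C}$. *)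

theory Defs
  imports "HOL-Complex_Analysis.Complex_Analysis"
begin

definition jordan_curve :: "complex set \<Rightarrow> bool" where
  "jordan_curve J \<longleftrightarrow>
     (\<exists>\<gamma>. simple_path \<gamma> \<and> pathfinish \<gamma> = pathstart \<gamma> \<and> path_image \<gamma> = J)"

definition bounded_complement_components :: "complex set \<Rightarrow> complex set set" where
  "bounded_complement_components \<Omega> = {C \<in> components (- closure \<Omega>). bounded C}"

text \<open>The elements are total functions; only their values on \<open>closure \<Omega>\<close> are constrained.\<close>
definition A_space :: "complex set \<Rightarrow> (complex \<Rightarrow> complex) set" where
  "A_space \<Omega> = {f. continuous_on (closure \<Omega>) f \<and> f holomorphic_on \<Omega>}"

definition dirichlet_polynomial :: "(complex \<Rightarrow> complex) \<Rightarrow> bool" where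
  "dirichlet_polynomial P \<longleftrightarrow>
     (\<exists>(M::nat) (a::nat \<Rightarrow> complex). P = (\<lambda>s. \<Sum>n=1..M. a n * (1 / of_nat n powr s)))"

text \<open>The supremum is the usual one only for nonempty \<open>K\<close> and \<open>g\<close> bounded on \<open>K\<close>,
  e.g. for \<open>K\<close> compact and \<open>g\<close> continuous on \<open>K\<close>.\<close>
definition sup_norm_on :: "complex set \<Rightarrow> (complex \<Rightarrow> complex) \<Rightarrow> real" where
  "sup_norm_on K g = (SUP s\<in>K. norm (g s))"

end

theory Submission
  imports Defs "HOL-Real_Asymp.Real_Asymp"
begin

text \<open>The proof has three ingredients: Mergelyan's theorem for \<open>K = closure \<Omega>\<close>, partial fractions, and
  the approximation of monomials by Dirichlet polynomials on discs.

  Dirichlet polynomials approximate monomials because the frequencies \<open>ln n\<close> are dense enough. If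
  one interpolates the entire function \<open>\<mu> \<mapsto> exp (\<mu> s)\<close> at the nodes \<open>- ln 1, \<dots>, - ln n\<close>, Cauchy's
  formula on a circle of radius \<open>5 ln n\<close> bounds the error by \<open>exp (O(ln n)) / 2\<^sup>n\<close>, uniformly for
  bounded \<open>s\<close> (\<open>exp_approx_by_node_exponentials\<close>). So every \<open>exp (\<mu> s)\<close> is a uniform limit of Dirichlet
  polynomials, and differentiating in \<open>\<mu>\<close> gives the monomials. A polynomial in \<open>1 / (s - z\<^sub>j)\<close> is then
  approximated by a Dirichlet polynomial in \<open>1 / (s - z\<^sub>j)\<close>, since \<open>1 / (s - z\<^sub>j)\<close> is bounded on \<open>K\<close>.

  Hence it suffices to approximate \<open>f\<close> on \<open>K\<close> by rational functions whose poles are among the \<open>z\<^sub>j\<close>. By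
  partial fractions such a function is a sum of polynomials in \<open>s\<close> and in the \<open>1 / (s - z\<^sub>j)\<close>, and a
  pole can be moved, by geometric series, inside its component of the complement of \<open>K\<close>
  (\<open>rational_closure_pole_shift\<close>), or to infinity if the component is unbounded. What remains is
  Mergelyan's theorem (\<open>mergelyan\<close>): if the components of the complement of \<open>K\<close> are not arbitrarily
  small, every function that is continuous on \<open>K\<close> and holomorphic in its interior is a uniform limit
  of rational functions with poles off \<open>K\<close>. The Jordan curves guarantee that the interior of
  \<open>closure \<Omega>\<close> is \<open>\<Omega>\<close> itself (\<open>jordan_domain_regular\<close>); the points \<open>z\<^sub>j\<close> show that the complement has only
  finitely many bounded components, which gives the lower bound on their size.

  Mergelyan's theorem is proved by Vitushkin's localization. After rescaling, \<open>f\<close> extends to a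
  compactly supported function that oscillates by at most a small \<open>\<omega>\<close> over distances up to 2. With a
  \<open>C\<^sup>1\<close> partition of unity over the Gaussian integers, a smoothing of \<open>f\<close> is the sum of local parts \<open>G\<^sub>j\<close>,
  one for each lattice point \<open>j\<close>. The part \<open>G\<^sub>j\<close> is bounded by a multiple of \<open>\<omega>\<close>, vanishes if \<open>f\<close> is
  holomorphic around the support of its cell, and is always holomorphic away from the cell.
  Replacing the kernel \<open>1 / z\<close> by a \<open>C\<^sup>1\<close> kernel that agrees with it for \<open>\<bar>z\<bar> \<ge> 1\<close> keeps all integrands
  continuous with compact support, and the only integral identity needed is that the integral of a
  derivative vanishes, a consequence of translation invariance.

  If the cell of \<open>j\<close> is not contained in the interior of \<open>K\<close>, there is a path of diameter about 1 near
  \<open>j\<close> in the complement of \<open>K\<close>, from \<open>a\<close> to \<open>b\<close> say. On \<open>K\<close> the function \<open>(z - a) / (z - b)\<close> has a square root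
  \<open>s\<close> in the closure of the rational functions, namely a product of principal square roots of
  \<open>(z - a\<^sub>i) / (z - a\<^sub>i\<^sub>+\<^sub>1)\<close> along a fine chain of points on the path. Normalized by \<open>s \<rightarrow> 1\<close> at infinity,
  \<open>1 / (1 + s)\<close> is bounded on \<open>K\<close>; this is an elementary form of the one-quarter theorem. A linear
  function \<open>q\<close> of it behaves like \<open>1 / z\<close> at infinity, so \<open>\<alpha> q + \<beta> q\<^sup>2\<close> can be made to match the first
  two Laurent coefficients of \<open>G\<^sub>j\<close>. The error is \<open>O(\<omega> / (1 + \<bar>z - j\<bar>)\<^sup>3)\<close>, which is summable over the
  lattice, so the total error is \<open>O(\<omega>)\<close>.\<close>

section \<open>Uniform closures\<close>

definition uniform_closure_on :: "complex set \<Rightarrow> (complex \<Rightarrow> complex) set \<Rightarrow> (complex \<Rightarrow> complex) set"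
  where "uniform_closure_on K S = {f. \<forall>e>0. \<exists>g\<in>S. \<forall>z\<in>K. norm (f z - g z) < e}"

lemma uniform_closure_onI:
  assumes "\<And>e. e > 0 \<Longrightarrow> \<exists>g\<in>S. \<forall>z\<in>K. norm (f z - g z) < e"
  shows "f \<in> uniform_closure_on K S"
  using assms by (simp add: uniform_closure_on_def)

lemma uniform_closure_onD:
  assumes "f \<in> uniform_closure_on K S" "e > 0"
  obtains g where "g \<in> S" "\<And>z. z \<in> K \<Longrightarrow> norm (f z - g z) < e"
  using assms by (auto simp: uniform_closure_on_def)

lemma uniform_closure_on_superset: "S \<subseteq> uniform_closure_on K S"
  by (force simp: uniform_closure_on_def)

lemma uniform_closure_on_mono:
  assumes "S \<subseteq> T" shows "uniform_closure_on K S \<subseteq> uniform_closure_on K T"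
proof
  fix f assume f: "f \<in> uniform_closure_on K S"
  show "f \<in> uniform_closure_on K T"
  proof (rule uniform_closure_onI)
    fix e :: real assume "e > 0"
    then obtain g where "g \<in> S" "\<And>z. z \<in> K \<Longrightarrow> norm (f z - g z) < e"
      using uniform_closure_onD[OF f] by metis
    then show "\<exists>g\<in>T. \<forall>z\<in>K. norm (f z - g z) < e"
      using assms by (intro bexI[of _ g]) auto
  qed
qed

lemma uniform_closure_on_idem:
  "uniform_closure_on K (uniform_closure_on K S) = uniform_closure_on K S"
proof (intro equalityI subsetI)
  fix f assume f: "f \<in> uniform_closure_on K (uniform_closure_on K S)"
  show "f \<in> uniform_closure_on K S"
  proof (rule uniform_closure_onI)
    fix e :: real assume "e > 0"
    then have e: "e/2 > 0" by simp
    obtain g where g: "g \<in> uniform_closure_on K S" "\<And>z. z \<in> K \<Longrightarrow> norm (f z - g z) < e/2"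
      using uniform_closure_onD[OF f e] by metis
    obtain h where h: "h \<in> S" "\<And>z. z \<in> K \<Longrightarrow> norm (g z - h z) < e/2"
      using uniform_closure_onD[OF g(1) e] by metis
    have "norm (f z - h z) < e" if "z \<in> K" for z
      using norm_triangle_lt[of "f z - g z" "g z - h z" e] g(2)[OF that] h(2)[OF that] by simp
    then show "\<exists>g\<in>S. \<forall>z\<in>K. norm (f z - g z) < e" using h(1) by blast
  qed
qed (use uniform_closure_on_superset in blast)

lemma uniform_closure_on_cong:
  assumes "g \<in> uniform_closure_on K S" "\<And>z. z \<in> K \<Longrightarrow> f z = g z"
  shows "f \<in> uniform_closure_on K S"
  using assms by (simp add: uniform_closure_on_def)

lemma uniform_closure_on_add:
  assumes S: "\<And>f g. f \<in> S \<Longrightarrow> g \<in> S \<Longrightarrow> (\<lambda>z. f z + g z) \<in> S"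
    and f: "f \<in> uniform_closure_on K S" and g: "g \<in> uniform_closure_on K S"
  shows "(\<lambda>z. f z + g z) \<in> uniform_closure_on K S"
proof (rule uniform_closure_onI)
  fix e :: real assume "e > 0"
  then have e: "e/2 > 0" by simp
  obtain f' where f': "f' \<in> S" "\<And>z. z \<in> K \<Longrightarrow> norm (f z - f' z) < e/2"
    using uniform_closure_onD[OF f e] by metis
  obtain g' where g': "g' \<in> S" "\<And>z. z \<in> K \<Longrightarrow> norm (g z - g' z) < e/2"
    using uniform_closure_onD[OF g e] by metis
  have "norm (f z + g z - (f' z + g' z)) < e" if "z \<in> K" for z
    using norm_triangle_lt[of "f z - f' z" "g z - g' z" e] f'(2)[OF that] g'(2)[OF that]
    by (simp add: algebra_simps)
  then show "\<exists>h\<in>S. \<forall>z\<in>K. norm (f z + g z - h z) < e"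
    by (intro bexI[OF _ S[OF f'(1) g'(1)]] ballI)
qed

lemma uniform_closure_on_cmult:
  assumes S: "\<And>f. f \<in> S \<Longrightarrow> (\<lambda>z. c * f z) \<in> S" and f: "f \<in> uniform_closure_on K S"
  shows "(\<lambda>z. c * f z) \<in> uniform_closure_on K S"
proof (rule uniform_closure_onI)
  fix e :: real assume "e > 0"
  have pos: "norm c + 1 > 0" using norm_ge_zero[of c] by linarith
  then have e: "e / (norm c + 1) > 0" using \<open>e > 0\<close> by simp
  obtain f' where f': "f' \<in> S" "\<And>z. z \<in> K \<Longrightarrow> norm (f z - f' z) < e / (norm c + 1)"
    using uniform_closure_onD[OF f e] by metis
  have "norm (c * f z - c * f' z) < e" if "z \<in> K" for z
  proof -
    have "norm (c * f z - c * f' z) = norm c * norm (f z - f' z)"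
      by (simp add: norm_mult flip: right_diff_distrib)
    also have "\<dots> \<le> (norm c + 1) * norm (f z - f' z)" by (simp add: mult_right_mono)
    also have "\<dots> < e" using f'(2)[OF that] pos by (simp add: field_simps)
    finally show ?thesis .
  qed
  then show "\<exists>h\<in>S. \<forall>z\<in>K. norm (c * f z - h z) < e"
    by (intro bexI[OF _ S[OF f'(1)]] ballI)
qed

section \<open>Dirichlet polynomials approximate polynomials\<close>

lemma dirichlet_polynomial_add:
  assumes "dirichlet_polynomial P" "dirichlet_polynomial Q"
  shows "dirichlet_polynomial (\<lambda>s. P s + Q s)"
proof -
  obtain M a where P: "P = (\<lambda>s. \<Sum>n=1..M. a n * (1 / of_nat n powr s))"
    using assms(1) unfolding dirichlet_polynomial_def by blast
  obtain L b where Q: "Q = (\<lambda>s. \<Sum>n=1..L. b n * (1 / of_nat n powr s))"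
    using assms(2) unfolding dirichlet_polynomial_def by blast
  have pad: "(\<Sum>n=1..k. c n * (1 / of_nat n powr s)) =
      (\<Sum>n=1..k+l. (if n \<le> k then c n else 0) * (1 / of_nat n powr s))"
    for k l and c :: "nat \<Rightarrow> complex" and s :: complex
    by (rule sum.mono_neutral_cong_left) auto
  have "(\<lambda>s. P s + Q s) = (\<lambda>s. \<Sum>n=1..M+L.
      ((if n \<le> M then a n else 0) + (if n \<le> L then b n else 0)) * (1 / of_nat n powr s))"
  proof
    fix s show "P s + Q s = (\<Sum>n=1..M+L.
        ((if n \<le> M then a n else 0) + (if n \<le> L then b n else 0)) * (1 / of_nat n powr s))"
      using pad[where c = a and k = M and l = L and s = s] pad[where c = b and k = L and l = M and s = s]
      by (simp only: P Q distrib_right sum.distrib add.commute[of L M])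
  qed
  then show ?thesis unfolding dirichlet_polynomial_def by (intro exI)
qed

lemma dirichlet_polynomial_cmult:
  assumes "dirichlet_polynomial P" shows "dirichlet_polynomial (\<lambda>s. c * P s)"
proof -
  obtain M a where P: "P = (\<lambda>s. \<Sum>n=1..M. a n * (1 / of_nat n powr s))"
    using assms unfolding dirichlet_polynomial_def by blast
  have "(\<lambda>s. c * P s) = (\<lambda>s. \<Sum>n=1..M. (c * a n) * (1 / of_nat n powr s))"
    unfolding P by (simp add: sum_distrib_left mult.assoc)
  then show ?thesis unfolding dirichlet_polynomial_def by (intro exI)
qed

lemma dirichlet_polynomial_0: "dirichlet_polynomial (\<lambda>s. 0)"
  unfolding dirichlet_polynomial_def by (intro exI[of _ 0]) auto

lemma dirichlet_polynomial_sum_exp: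
  "dirichlet_polynomial (\<lambda>s. \<Sum>n=1..M. a n * exp (- of_real (ln (real n)) * s))"
proof -
  have "1 / of_nat n powr s = exp (- of_real (ln (real n)) * s)" if "n \<in> {1..M}"
    for n and s :: complex
  proof -
    have "Ln (of_nat n) = complex_of_real (ln (real n))"
      using that Ln_of_real[of "real n"] by simp
    then have "of_nat n powr s = exp (s * of_real (ln (real n)))" using that by (simp add: powr_def)
    then show ?thesis by (simp add: exp_minus inverse_eq_divide mult.commute)
  qed
  then have "(\<lambda>s. \<Sum>n=1..M. a n * exp (- of_real (ln (real n)) * s)) =
      (\<lambda>s. \<Sum>n=1..M. a n * (1 / of_nat n powr s))"
    by (intro ext sum.cong refl) simp
  then show ?thesis unfolding dirichlet_polynomial_def by (intro exI)
qed

text \<open>Lagrange interpolation, at the nodes \<open>l 1, \<dots>, l n\<close>, of the Cauchy kernel as a function of \<open>\<mu>\<close>, with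
  the remainder in product form. Each new node multiplies the remainder by \<open>(\<mu> - l) / (x - l)\<close>, and
  \<open>1 / (x - \<mu>) * (\<mu> - l) / (x - l)\<close> splits as \<open>1 / (x - \<mu>) - 1 / (x - l)\<close>. What matters later is that
  the coefficients do not depend on \<open>x\<close>.\<close>
lemma cauchy_kernel_interpolation:
  fixes l :: "nat \<Rightarrow> complex"
  assumes "inj_on l {1..n}"
  shows "\<exists>c. \<forall>x. x \<noteq> \<mu> \<longrightarrow> x \<notin> l ` {1..n} \<longrightarrow>
     1 / (x - \<mu>) * (\<Prod>j=1..n. (\<mu> - l j) / (x - l j)) = 1 / (x - \<mu>) - (\<Sum>j=1..n. c j / (x - l j))"
  using assms
proof (induction n)
  case (Suc n)
  then have "inj_on l {1..n}" by (auto simp: inj_on_def)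
  with Suc obtain c where c: "\<And>x. x \<noteq> \<mu> \<Longrightarrow> x \<notin> l ` {1..n} \<Longrightarrow>
     1 / (x - \<mu>) * (\<Prod>j=1..n. (\<mu> - l j) / (x - l j)) = 1 / (x - \<mu>) - (\<Sum>j=1..n. c j / (x - l j))"
    by blast
  let ?L = "l (Suc n)"
  have ne: "l j \<noteq> ?L" if "j \<in> {1..n}" for j using Suc.prems that by (force simp: inj_on_def)
  define d where "d j = (if j = Suc n then 1 + (\<Sum>i=1..n. c i * (\<mu> - ?L) / (?L - l i))
      else c j * (\<mu> - ?L) / (l j - ?L))" for j
  have "1 / (x - \<mu>) * (\<Prod>j=1..Suc n. (\<mu> - l j) / (x - l j)) = 1 / (x - \<mu>) - (\<Sum>j=1..Suc n. d j / (x - l j))"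
    if x: "x \<noteq> \<mu>" "x \<notin> l ` {1..Suc n}" for x
  proof -
    have x': "x \<notin> l ` {1..n}" "x \<noteq> ?L" using x(2) by auto
    have "1 / (x - \<mu>) * (\<Prod>j=1..Suc n. (\<mu> - l j) / (x - l j)) =
        (1 / (x - \<mu>) - (\<Sum>j=1..n. c j / (x - l j))) * ((\<mu> - ?L) / (x - ?L))"
      unfolding c[OF x(1) x'(1), symmetric] by simp
    also have "\<dots> = 1 / (x - \<mu>) * ((\<mu> - ?L) / (x - ?L)) - (\<Sum>j=1..n. c j / (x - l j) * ((\<mu> - ?L) / (x - ?L)))"
      by (simp only: left_diff_distrib sum_distrib_right)
    also have "1 / (x - \<mu>) * ((\<mu> - ?L) / (x - ?L)) = 1 / (x - \<mu>) - 1 / (x - ?L)"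
      using x x' by (simp add: field_simps)
    also have "(\<Sum>j=1..n. c j / (x - l j) * ((\<mu> - ?L) / (x - ?L))) =
        (\<Sum>j=1..n. d j / (x - l j) + c j * (\<mu> - ?L) / (?L - l j) / (x - ?L))"
    proof (rule sum.cong[OF refl])
      fix j assume j: "j \<in> {1..n}"
      then have *: "x - l j \<noteq> 0" "l j - ?L \<noteq> 0" "x - ?L \<noteq> 0" "?L - l j \<noteq> 0" using x' ne[OF j] by auto
      then have "1 / (x - l j) * (1 / (x - ?L)) = 1 / (l j - ?L) / (x - l j) + 1 / (?L - l j) / (x - ?L)"
        by (simp add: divide_simps) (simp add: algebra_simps)
      then have "c j * (\<mu> - ?L) * (1 / (x - l j) * (1 / (x - ?L))) =
        c j * (\<mu> - ?L) * (1 / (l j - ?L) / (x - l j) + 1 / (?L - l j) / (x - ?L))" by simp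
      moreover have "d j = c j * (\<mu> - ?L) / (l j - ?L)" using j by (simp add: d_def)
      ultimately show "c j / (x - l j) * ((\<mu> - ?L) / (x - ?L)) = d j / (x - l j) + c j * (\<mu> - ?L) / (?L - l j) / (x - ?L)"
        by (simp add: distrib_left)
    qed
    also have "\<dots> = (\<Sum>j=1..n. d j / (x - l j)) + (\<Sum>j=1..n. c j * (\<mu> - ?L) / (?L - l j)) / (x - ?L)"
      by (simp add: sum.distrib sum_divide_distrib)
    finally have "1 / (x - \<mu>) * (\<Prod>j=1..Suc n. (\<mu> - l j) / (x - l j)) = 1 / (x - \<mu>) - 1 / (x - ?L) -
        ((\<Sum>j=1..n. d j / (x - l j)) + (\<Sum>j=1..n. c j * (\<mu> - ?L) / (?L - l j)) / (x - ?L))" .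
    moreover have "(\<Sum>j=1..Suc n. d j / (x - l j)) = (\<Sum>j=1..n. d j / (x - l j)) + d (Suc n) / (x - ?L)"
      by simp
    moreover have "d (Suc n) = 1 + (\<Sum>j=1..n. c j * (\<mu> - ?L) / (?L - l j))"
      by (simp add: d_def)
    ultimately show ?thesis by (simp only: add_divide_distrib diff_diff_eq add.assoc add.commute add.left_commute)
  qed
  then show ?case by blast
qed auto

text \<open>Integrate \<open>exp (x * s)\<close> against the interpolated kernel over the circle \<open>\<bar>x\<bar> = 5 L\<close>: the kernels
  with simple poles give exponentials, and the remainder is small because on that circle the
  distance to each node is at least \<open>4 L\<close>, twice the largest possible distance from \<open>\<mu>\<close> to a node. The
  coefficients work for all \<open>s\<close> at once.\<close>
lemma exp_approx_by_node_exponentials: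
  fixes \<mu> :: complex and L r :: real
  assumes L: "L > 0" "norm \<mu> \<le> L" and l: "inj_on l {1..n}" "\<And>j. j \<in> {1..n} \<Longrightarrow> norm (l j) \<le> L"
  shows "\<exists>c. \<forall>s. norm s \<le> r \<longrightarrow>
    norm (exp (\<mu> * s) - (\<Sum>j=1..n. c j * exp (l j * s))) \<le> 5 / 4 * exp (5 * L * r) * (1 / 2) ^ n"
proof -
  obtain c where c: "\<And>x. x \<noteq> \<mu> \<Longrightarrow> x \<notin> l ` {1..n} \<Longrightarrow>
     1 / (x - \<mu>) * (\<Prod>j=1..n. (\<mu> - l j) / (x - l j)) = 1 / (x - \<mu>) - (\<Sum>j=1..n. c j / (x - l j))"
    using cauchy_kernel_interpolation[OF l(1)] by blast
  have "norm (exp (\<mu> * s) - (\<Sum>j=1..n. c j * exp (l j * s))) \<le> 5 / 4 * exp (5 * L * r) * (1 / 2) ^ n"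
    if s: "norm s \<le> r" for s
  proof -
    let ?g = "circlepath 0 (5 * L)"
    have cauchy: "((\<lambda>x. exp (x * s) / (x - w)) has_contour_integral 2 * of_real pi * \<i> * exp (w * s)) ?g"
      if "norm w \<le> L" for w
      by (rule Cauchy_integral_circlepath_simple) (use that L in \<open>auto intro!: holomorphic_intros\<close>)
    have "((\<lambda>x. exp (x * s) / (x - \<mu>) - (\<Sum>j=1..n. c j * (exp (x * s) / (x - l j)))) has_contour_integral
        2 * of_real pi * \<i> * exp (\<mu> * s) - (\<Sum>j=1..n. c j * (2 * of_real pi * \<i> * exp (l j * s)))) ?g"
      by (intro has_contour_integral_diff has_contour_integral_sum has_contour_integral_lmul cauchy)
        (use l L in auto)
    also have "2 * of_real pi * \<i> * exp (\<mu> * s) - (\<Sum>j=1..n. c j * (2 * of_real pi * \<i> * exp (l j * s))) =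
        2 * of_real pi * \<i> * (exp (\<mu> * s) - (\<Sum>j=1..n. c j * exp (l j * s)))" (is "_ = ?I")
      by (simp add: right_diff_distrib sum_distrib_left mult_ac)
    finally have I: "((\<lambda>x. exp (x * s) / (x - \<mu>) - (\<Sum>j=1..n. c j * (exp (x * s) / (x - l j)))) has_contour_integral ?I) ?g" .
    have "norm ?I \<le> (exp (5 * L * r) * (1 / (4 * L)) * (1 / 2) ^ n) * (2 * pi * (5 * L))"
    proof (rule has_contour_integral_bound_circlepath[OF I])
      show "0 \<le> exp (5 * L * r) * (1 / (4 * L)) * (1 / 2) ^ n" "0 < 5 * L" using L by auto
      fix x :: complex assume "norm (x - 0) = 5 * L"
      then have x: "norm x = 5 * L" by simp
      have far: "norm (x - w) \<ge> 4 * L" if "norm w \<le> L" for w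
        using norm_triangle_ineq2[of x w] x that by simp
      have ne: "x \<noteq> \<mu>" "x \<notin> l ` {1..n}" using far[of \<mu>] far L l by fastforce+
      have "exp (x * s) / (x - \<mu>) - (\<Sum>j=1..n. c j * (exp (x * s) / (x - l j))) =
          exp (x * s) * (1 / (x - \<mu>) - (\<Sum>j=1..n. c j / (x - l j)))"
        by (simp add: right_diff_distrib sum_distrib_left mult_ac)
      also have "\<dots> = exp (x * s) * (1 / (x - \<mu>) * (\<Prod>j=1..n. (\<mu> - l j) / (x - l j)))"
        using c[OF ne] by simp
      also have "norm \<dots> = norm (exp (x * s)) * (1 / norm (x - \<mu>)) * (\<Prod>j=1..n. norm (\<mu> - l j) / norm (x - l j))"
        by (simp add: norm_mult norm_divide prod_norm[symmetric])
      also have "\<dots> \<le> exp (5 * L * r) * (1 / (4 * L)) * (\<Prod>j=1..n. 1 / 2)"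
      proof (intro mult_mono prod_mono conjI)
        have "norm (exp (x * s)) \<le> exp (norm (x * s))" by (rule norm_exp)
        also have "\<dots> \<le> exp (5 * L * r)" using s x L by (simp add: norm_mult mult_left_mono)
        finally show "norm (exp (x * s)) \<le> exp (5 * L * r)" .
        show "1 / norm (x - \<mu>) \<le> 1 / (4 * L)" using far[OF L(2)] L
          by (intro divide_left_mono mult_pos_pos) auto
        fix j assume j: "j \<in> {1..n}"
        have "norm (\<mu> - l j) \<le> 2 * L" using norm_triangle_ineq4[of \<mu> "l j"] L l(2)[OF j] by linarith
        moreover have "norm (x - l j) \<ge> 4 * L" using far l(2)[OF j] by blast
        ultimately show "norm (\<mu> - l j) / norm (x - l j) \<le> 1 / 2"
        using L by (simp add: divide_le_eq)
      qed (use L in \<open>auto intro!: prod_nonneg\<close>)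
      finally show "norm (exp (x * s) / (x - \<mu>) - (\<Sum>j=1..n. c j * (exp (x * s) / (x - l j)))) \<le>
          exp (5 * L * r) * (1 / (4 * L)) * (1 / 2) ^ n" by simp
    qed
    also have "norm ?I = 2 * pi * norm (exp (\<mu> * s) - (\<Sum>j=1..n. c j * exp (l j * s)))"
      by (simp add: norm_mult)
    finally show ?thesis using L by (simp add: field_simps)
  qed
  then show ?thesis by blast
qed

text \<open>With the nodes \<open>- ln 1, \<dots>, - ln n\<close> one may take \<open>L = ln n\<close>; then \<open>exp (5 * L * r)\<close> is only a power of
  \<open>n\<close> and loses against \<open>2\<^sup>n\<close>.\<close>
lemma exp_in_dirichlet_closure:
  "(\<lambda>s. exp (\<mu> * s)) \<in> uniform_closure_on (cball 0 r) {P. dirichlet_polynomial P}"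
proof (rule uniform_closure_onI)
  fix e :: real assume e: "e > 0"
  have "((\<lambda>n::nat. 5 / 4 * exp (5 * ln (real n) * r) * (1 / 2) ^ n) \<longlongrightarrow> 0) at_top"
    by real_asymp
  then have "\<forall>\<^sub>F n in sequentially. 5 / 4 * exp (5 * ln (real n) * r) * (1 / 2) ^ n < e"
    using e by (simp add: order_tendsto_iff)
  moreover have "\<forall>\<^sub>F n in sequentially. ln (real n) > norm \<mu>"
  proof -
    have "filterlim (\<lambda>n::nat. ln (real n)) at_top sequentially" by real_asymp
    then show ?thesis by (simp add: filterlim_at_top_dense)
  qed
  ultimately have "\<forall>\<^sub>F n in sequentially. 5 / 4 * exp (5 * ln (real n) * r) * (1 / 2) ^ n < e
      \<and> ln (real n) > norm \<mu>" by (rule eventually_conj)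
  then obtain n where n: "5 / 4 * exp (5 * ln (real n) * r) * (1 / 2) ^ n < e" "ln (real n) > norm \<mu>"
    using eventually_happens by force
  let ?l = "\<lambda>j. - complex_of_real (ln (real j))"
  have "\<exists>c. \<forall>s. norm s \<le> r \<longrightarrow> norm (exp (\<mu> * s) - (\<Sum>j=1..n. c j * exp (?l j * s)))
      \<le> 5 / 4 * exp (5 * ln (real n) * r) * (1 / 2) ^ n"
  proof (rule exp_approx_by_node_exponentials)
    show "inj_on ?l {1..n}" by (auto simp: inj_on_def)
    show "ln (real n) > 0" "norm \<mu> \<le> ln (real n)" using n(2) norm_ge_zero[of \<mu>] by linarith+
    show "norm (?l j) \<le> ln (real n)" if "j \<in> {1..n}" for j using that by simp
  qed
  then obtain c where "\<And>s. norm s \<le> r \<Longrightarrow> norm (exp (\<mu> * s) - (\<Sum>j=1..n. c j * exp (?l j * s)))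
      \<le> 5 / 4 * exp (5 * ln (real n) * r) * (1 / 2) ^ n" by blast
  with n(1) show "\<exists>g\<in>{P. dirichlet_polynomial P}. \<forall>z\<in>cball 0 r. norm (exp (\<mu> * z) - g z) < e"
    by (intro bexI[of _ "\<lambda>s. \<Sum>j=1..n. c j * exp (?l j * s)"])
      (use dirichlet_polynomial_sum_exp in \<open>force+\<close>)
qed

lemma exp_second_order_bound:
  fixes w :: complex assumes "norm w \<le> 1"
  shows "norm (exp w - 1 - w) \<le> 3 * norm w ^ 2"
proof -
  have "norm (exp w - 1 - w) \<le> exp (norm w) * norm w ^ 2"
    using Taylor_exp_field[of w 1] by (simp add: diff_diff_eq power2_eq_square)
  also have "exp (norm w) \<le> exp 1" using assms by simp
  also have "exp 1 \<le> (3 :: real)" by (rule exp_le)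
  finally show ?thesis by (simp add: mult_right_mono)
qed

text \<open>Difference quotients in \<open>\<mu>\<close> raise the exponent \<open>k\<close> by one. The factor \<open>exp (\<mu> * s)\<close> is carried along
  because the induction hypothesis is needed at \<open>\<mu>\<close> and at \<open>\<mu> + h\<close>.\<close>
lemma monomial_exp_in_dirichlet_closure:
  assumes "r > 0"
  shows "(\<lambda>s. s ^ k * exp (\<mu> * s)) \<in> uniform_closure_on (cball 0 r) {P. dirichlet_polynomial P}"
proof (induction k arbitrary: \<mu>)
  case 0
  then show ?case using exp_in_dirichlet_closure by simp
next
  case (Suc k)
  let ?D = "uniform_closure_on (cball 0 r) {P. dirichlet_polynomial P}"
  have "(\<lambda>s. s ^ Suc k * exp (\<mu> * s)) \<in> uniform_closure_on (cball 0 r) ?D"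
  proof (rule uniform_closure_onI)
    fix e :: real assume e: "e > 0"
    define C where "C = 3 * r ^ k * exp (norm \<mu> * r) * r ^ 2"
    \<comment> \<open>The first bound makes \<open>\<bar>h s\<bar> \<le> 1\<close>; the second makes the error, at most \<open>C * h\<close>, less than \<open>e\<close>.\<close>
    define h where "h = min (1 / r) (e / (C + 1))"
    have C: "C \<ge> 0" using assms by (simp add: C_def)
    have h: "h > 0" "h * r \<le> 1" using assms e C by (auto simp: h_def field_simps min_def)
    have hC: "C * h < e"
    proof -
      have "C * h \<le> C * (e / (C + 1))" using C by (intro mult_left_mono) (auto simp: h_def)
      also have "\<dots> < e" using C e by (simp add: field_simps)
      finally show ?thesis .
    qed
    define g where "g s = (1 / of_real h) * (s ^ k * exp ((\<mu> + of_real h) * s) + (-1) * (s ^ k * exp (\<mu> * s)))" for s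
    have "g \<in> ?D" unfolding g_def
      by (intro uniform_closure_on_cmult uniform_closure_on_add Suc CollectI
          dirichlet_polynomial_add dirichlet_polynomial_cmult) (simp_all only: mem_Collect_eq)
    moreover have "norm (s ^ Suc k * exp (\<mu> * s) - g s) < e" if s: "s \<in> cball 0 r" for s
    proof -
      have ns: "norm s \<le> r" using s by simp
      have "norm (of_real h * s) \<le> 1" using h ns by (simp add: norm_mult) (meson h(1) less_eq_real_def mult_left_mono order_trans)
      then have b: "norm (exp (of_real h * s) - 1 - of_real h * s) \<le> 3 * norm (of_real h * s) ^ 2"
        by (rule exp_second_order_bound)
      have "s ^ Suc k * exp (\<mu> * s) - g s =
          - (1 / of_real h) * s ^ k * exp (\<mu> * s) * (exp (of_real h * s) - 1 - of_real h * s)"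
        using h by (simp add: g_def field_simps exp_add)
      also have "norm \<dots> = (1 / h) * norm s ^ k * norm (exp (\<mu> * s)) * norm (exp (of_real h * s) - 1 - of_real h * s)"
        using h by (simp add: norm_mult norm_divide norm_power)
      also have "\<dots> \<le> (1 / h) * r ^ k * exp (norm \<mu> * r) * (3 * (h * r) ^ 2)"
      proof (intro mult_mono)
        have "norm (exp (\<mu> * s)) \<le> exp (norm (\<mu> * s))" by (rule norm_exp)
        also have "\<dots> \<le> exp (norm \<mu> * r)" using ns by (simp add: norm_mult mult_left_mono)
        finally show "norm (exp (\<mu> * s)) \<le> exp (norm \<mu> * r)" .
        have "norm (of_real h * s) \<le> h * r" using h ns by (simp add: norm_mult)
        then have "norm (of_real h * s) ^ 2 \<le> (h * r) ^ 2" by (intro power_mono) auto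
        then show "norm (exp (of_real h * s) - 1 - of_real h * s) \<le> 3 * (h * r) ^ 2" using b by linarith
      qed (use h ns assms in \<open>auto intro!: power_mono\<close>)
      also have "\<dots> = C * h" using h by (simp add: C_def power2_eq_square)
      finally show ?thesis using hC by linarith
    qed
    ultimately show "\<exists>g\<in>?D. \<forall>z\<in>cball 0 r. norm (z ^ Suc k * exp (\<mu> * z) - g z) < e" by blast
  qed
  then show ?case by (simp add: uniform_closure_on_idem)
qed

lemma monomial_approx_by_dirichlet:
  assumes "r > 0" "e > 0"
  obtains P where "dirichlet_polynomial P" "\<And>s. norm s \<le> r \<Longrightarrow> norm (s ^ k - P s) < e"
  using uniform_closure_onD[OF monomial_exp_in_dirichlet_closure[of r k 0, OF assms(1)] assms(2)]
  by (auto simp: dist_norm)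


section \<open>Rational functions with prescribed poles\<close>

inductive_set rational_with_poles :: "complex set \<Rightarrow> (complex \<Rightarrow> complex) set"
  for W :: "complex set"
where
  const: "(\<lambda>z. c) \<in> rational_with_poles W"
| ident: "(\<lambda>z. z) \<in> rational_with_poles W"
| pole: "w \<in> W \<Longrightarrow> (\<lambda>z. 1 / (z - w)) \<in> rational_with_poles W"
| add: "f \<in> rational_with_poles W \<Longrightarrow> g \<in> rational_with_poles W \<Longrightarrow> (\<lambda>z. f z + g z) \<in> rational_with_poles W"
| mult: "f \<in> rational_with_poles W \<Longrightarrow> g \<in> rational_with_poles W \<Longrightarrow> (\<lambda>z. f z * g z) \<in> rational_with_poles W"

definition rational_closure :: "complex set \<Rightarrow> complex set \<Rightarrow> (complex \<Rightarrow> complex) set"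
  where "rational_closure K W = uniform_closure_on K (rational_with_poles W)"

lemma rational_with_poles_continuous_on:
  assumes "f \<in> rational_with_poles W" "W \<inter> K = {}" shows "continuous_on K f"
  using assms by induction (auto intro!: continuous_intros)

lemma rational_closure_superset: "rational_with_poles W \<subseteq> rational_closure K W"
  unfolding rational_closure_def by (rule uniform_closure_on_superset)

lemma rational_closure_const: "(\<lambda>z. c) \<in> rational_closure K W"
  and rational_closure_ident: "(\<lambda>z. z) \<in> rational_closure K W"
  and rational_closure_pole: "w \<in> W \<Longrightarrow> (\<lambda>z. 1 / (z - w)) \<in> rational_closure K W"
  using rational_closure_superset[of W K] rational_with_poles.intros by (blast+)

lemma rational_closure_add:
  "f \<in> rational_closure K W \<Longrightarrow> g \<in> rational_closure K W \<Longrightarrow> (\<lambda>z. f z + g z) \<in> rational_closure K W"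
  unfolding rational_closure_def by (rule uniform_closure_on_add) (rule rational_with_poles.add)

lemma rational_closure_cmult:
  "f \<in> rational_closure K W \<Longrightarrow> (\<lambda>z. c * f z) \<in> rational_closure K W"
  unfolding rational_closure_def
  by (rule uniform_closure_on_cmult) (intro rational_with_poles.mult rational_with_poles.const)

lemma rational_closure_bounded:
  assumes "compact K" "W \<inter> K = {}" "f \<in> rational_closure K W"
  obtains B where "B > 0" "\<And>z. z \<in> K \<Longrightarrow> norm (f z) \<le> B"
proof -
  obtain g where g: "g \<in> rational_with_poles W" "\<And>z. z \<in> K \<Longrightarrow> norm (f z - g z) < 1"
    using uniform_closure_onD[OF assms(3)[unfolded rational_closure_def] zero_less_one] by metis
  have "bounded (g ` K)"
    using assms rational_with_poles_continuous_on[OF g(1)] compact_continuous_image compact_imp_bounded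
    by blast
  then obtain B where B: "B > 0" "\<And>z. z \<in> K \<Longrightarrow> norm (g z) \<le> B"
    unfolding bounded_pos by auto
  have "norm (f z) \<le> B + 1" if "z \<in> K" for z
    using norm_triangle_ineq2[of "f z" "g z"] g(2)[OF that] B(2)[OF that] by linarith
  then show ?thesis using that[of "B + 1"] B(1) by auto
qed

lemma rational_closure_mult:
  assumes K: "compact K" "W \<inter> K = {}"
    and f: "f \<in> rational_closure K W" and g: "g \<in> rational_closure K W"
  shows "(\<lambda>z. f z * g z) \<in> rational_closure K W"
proof -
  obtain A where A: "A > 0" "\<And>z. z \<in> K \<Longrightarrow> norm (f z) \<le> A"
    using rational_closure_bounded[OF K f] by blast
  obtain B where B: "B > 0" "\<And>z. z \<in> K \<Longrightarrow> norm (g z) \<le> B"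
    using rational_closure_bounded[OF K g] by blast
  show ?thesis unfolding rational_closure_def
  proof (rule uniform_closure_onI)
    fix e :: real assume e: "e > 0"
    \<comment> \<open>The error of the product is less than \<open>d * B + A * d + d\<^sup>2\<close>.\<close>
    define d where "d = min 1 (e / (A + B + 1))"
    have d: "d > 0" "d \<le> 1" using A B e by (auto simp: d_def)
    have "d \<le> e / (A + B + 1)" by (simp add: d_def)
    then have d3: "d * (A + B + 1) \<le> e" using A B by (simp add: pos_le_divide_eq)
    obtain f' where f': "f' \<in> rational_with_poles W" "\<And>z. z \<in> K \<Longrightarrow> norm (f z - f' z) < d"
      using uniform_closure_onD[OF f[unfolded rational_closure_def] d(1)] by metis
    obtain g' where g': "g' \<in> rational_with_poles W" "\<And>z. z \<in> K \<Longrightarrow> norm (g z - g' z) < d"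
      using uniform_closure_onD[OF g[unfolded rational_closure_def] d(1)] by metis
    have "norm (f z * g z - f' z * g' z) < e" if z: "z \<in> K" for z
    proof -
      have eq: "f z * g z - f' z * g' z = (f z - f' z) * g z + f z * (g z - g' z) - (f z - f' z) * (g z - g' z)"
        by (simp add: algebra_simps)
      have "norm (f z - f' z) * norm (g z) \<le> d * B"
        using A B(2)[OF z] d f'(2)[OF z] by (intro mult_mono) auto
      moreover have "norm (f z) * norm (g z - g' z) \<le> A * d"
        using A(1) A(2)[OF z] g'(2)[OF z] by (intro mult_mono) auto
      moreover have "norm (f z - f' z) * norm (g z - g' z) < d * 1"
        using d f'(2)[OF z] g'(2)[OF z] by (intro mult_strict_mono') auto
      moreover have "norm (f z * g z - f' z * g' z) \<le>
          norm (f z - f' z) * norm (g z) + norm (f z) * norm (g z - g' z) + norm (f z - f' z) * norm (g z - g' z)"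
        unfolding eq norm_mult[symmetric]
        by (rule order_trans[OF norm_triangle_ineq4]) (intro add_right_mono norm_triangle_ineq)
      moreover have "d * B + A * d + d * 1 = d * (A + B + 1)" by (simp add: algebra_simps)
      ultimately show ?thesis using d3 by linarith
    qed
    then show "\<exists>h\<in>rational_with_poles W. \<forall>z\<in>K. norm (f z * g z - h z) < e"
      by (intro bexI[OF _ rational_with_poles.mult[OF f'(1) g'(1)]] ballI)
  qed
qed

lemma rational_closure_sum:
  assumes "\<And>i. i \<in> I \<Longrightarrow> f i \<in> rational_closure K W"
  shows "(\<lambda>z. \<Sum>i\<in>I. f i z) \<in> rational_closure K W"
  using assms
  by (induction I rule: infinite_finite_induct)
    (auto intro: rational_closure_const rational_closure_add)

lemma rational_closure_prod:
  assumes "compact K" "W \<inter> K = {}" "\<And>i. i \<in> I \<Longrightarrow> f i \<in> rational_closure K W"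
  shows "(\<lambda>z. \<Prod>i\<in>I. f i z) \<in> rational_closure K W"
  using assms
  by (induction I rule: infinite_finite_induct)
    (auto intro: rational_closure_const rational_closure_mult)

lemma rational_closure_power:
  assumes "compact K" "W \<inter> K = {}" "f \<in> rational_closure K W"
  shows "(\<lambda>z. f z ^ n) \<in> rational_closure K W"
  using assms by (induction n) (auto intro: rational_closure_const rational_closure_mult)

lemma rational_closure_cong:
  "g \<in> rational_closure K W \<Longrightarrow> (\<And>z. z \<in> K \<Longrightarrow> f z = g z) \<Longrightarrow> f \<in> rational_closure K W"
  unfolding rational_closure_def by (rule uniform_closure_on_cong)

lemma rational_closure_uniform_limit:
  assumes "\<And>e. e > 0 \<Longrightarrow> \<exists>g\<in>rational_closure K W. \<forall>z\<in>K. norm (f z - g z) < e"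
  shows "f \<in> rational_closure K W"
proof -
  have "f \<in> uniform_closure_on K (rational_closure K W)"
    using assms by (rule uniform_closure_onI)
  then show ?thesis unfolding rational_closure_def by (simp add: uniform_closure_on_idem)
qed

text \<open>The Taylor polynomials of \<open>F\<close> converge uniformly on the disc of radius \<open>q\<close>, which contains the
  values of \<open>v\<close>.\<close>
lemma rational_closure_compose_holomorphic:
  assumes K: "compact K" "W \<inter> K = {}" and v: "v \<in> rational_closure K W"
    and q: "q < 1" "\<And>z. z \<in> K \<Longrightarrow> norm (v z) \<le> q" and F: "F holomorphic_on ball 0 1"
  shows "(\<lambda>z. F (v z)) \<in> rational_closure K W"
proof (rule rational_closure_uniform_limit)
  fix e :: real assume e: "e > 0"
  define a where "a n = (deriv ^^ n) F 0 / fact n" for n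
  have sums: "(\<lambda>n. a n * w ^ n) sums F w" if "norm w < 1" for w
    using holomorphic_power_series[OF F, of w] that by (simp add: a_def)
  have "conv_radius a \<ge> 1"
  proof (rule conv_radius_geI_ex)
    fix r :: real assume r: "0 < r" "ereal r < 1"
    show "\<exists>z. norm z = r \<and> summable (\<lambda>n. a n * z ^ n)"
      using r sums[of "of_real r"] by (intro exI[of _ "of_real r"]) (auto simp: sums_iff)
  qed
  then have "ereal q < conv_radius a" using q(1) by (metis ereal_less_le less_ereal.simps(1) one_ereal_def order_less_le_trans)
  then have "uniform_limit (cball 0 q) (\<lambda>n x. \<Sum>i<n. a i * (x - 0) ^ i) (\<lambda>x. \<Sum>i. a i * (x - 0) ^ i) sequentially"
    by (rule powser_uniform_limit)
  then have "\<forall>\<^sub>F n in sequentially. \<forall>x\<in>cball 0 q. dist (\<Sum>i<n. a i * (x - 0) ^ i) (\<Sum>i. a i * (x - 0) ^ i) < e"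
    using e by (rule uniform_limitD)
  then obtain n where n: "\<And>x. x \<in> cball 0 q \<Longrightarrow> dist (\<Sum>i<n. a i * x ^ i) (\<Sum>i. a i * x ^ i) < e"
    using eventually_happens by fastforce
  have "norm (F (v z) - (\<Sum>i<n. a i * v z ^ i)) < e" if z: "z \<in> K" for z
  proof -
    have "(\<Sum>i. a i * v z ^ i) = F (v z)" using sums[of "v z"] q(1) q(2)[OF z] by (auto simp: sums_iff)
    then show ?thesis using n[of "v z"] q(2)[OF z] by (simp add: dist_norm norm_minus_commute)
  qed
  moreover have "(\<lambda>z. \<Sum>i<n. a i * v z ^ i) \<in> rational_closure K W"
    by (intro rational_closure_sum rational_closure_cmult rational_closure_power K v)
  ultimately show "\<exists>g\<in>rational_closure K W. \<forall>z\<in>K. norm (F (v z) - g z) < e"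
    by (intro bexI[of _ "\<lambda>z. \<Sum>i<n. a i * v z ^ i"] ballI)
qed

text \<open>The geometric series for \<open>1 / (z - w') = 1 / (z - w) * 1 / (1 - (w' - w) / (z - w))\<close> moves a pole
  over any distance smaller than its distance from \<open>K\<close>.\<close>
lemma pole_in_rational_closure_near:
  assumes K: "compact K" "W \<inter> K = {}" and w: "(\<lambda>z. 1 / (z - w)) \<in> rational_closure K W"
    and d: "\<And>z. z \<in> K \<Longrightarrow> norm (z - w) \<ge> d" "norm (w' - w) < d"
  shows "(\<lambda>z. 1 / (z - w')) \<in> rational_closure K W"
proof -
  have d0: "d > 0" using d(2) norm_ge_zero[of "w' - w"] by linarith
  have "(\<lambda>z. 1 / (1 - (w' - w) * (1 / (z - w)))) \<in> rational_closure K W"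
  proof (rule rational_closure_compose_holomorphic[OF K rational_closure_cmult[OF w]])
    show "norm (w' - w) / d < 1" using d(2) d0 by simp
    show "norm ((w' - w) * (1 / (z - w))) \<le> norm (w' - w) / d" if "z \<in> K" for z
      using d(1)[OF that] d0 by (simp add: norm_mult norm_divide frac_le)
    show "(\<lambda>u. 1 / (1 - u)) holomorphic_on ball 0 (1::real)"
      by (intro holomorphic_intros) auto
  qed
  from rational_closure_mult[OF K w this] show ?thesis
  proof (rule rational_closure_cong)
    fix z assume "z \<in> K"
    then have "norm (z - w) \<ge> d" by (rule d(1))
    then have "z \<noteq> w" "z \<noteq> w'" using d0 d(2) by (auto simp: norm_minus_commute)
    then show "1 / (z - w') = 1 / (z - w) * (1 / (1 - (w' - w) * (1 / (z - w))))"
      by (simp add: divide_simps)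
  qed
qed

text \<open>The set of admissible poles is open and closed in the complement of \<open>K\<close>, because a pole can be
  moved in both directions between nearby points.\<close>
lemma pole_in_rational_closure_component:
  assumes K: "compact K" "W \<inter> K = {}" and w: "(\<lambda>z. 1 / (z - w)) \<in> rational_closure K W"
    and conn: "connected_component (- K) w w'"
  shows "(\<lambda>z. 1 / (z - w')) \<in> rational_closure K W"
proof -
  define C where "C = connected_component_set (- K) w"
  define G where "G = {x. (\<lambda>z. 1 / (z - x)) \<in> rational_closure K W}"
  have "open (- K)" using K(1) compact_imp_closed by auto
  then have C: "open C" "connected C" "C \<subseteq> - K"
    unfolding C_def by (auto intro: open_connected_component simp: connected_component_subset)
  have dist: "\<exists>d>0. \<forall>y. norm (y - x) < d \<longrightarrow> y \<in> C \<and> (x \<in> G \<longleftrightarrow> y \<in> G)" if x: "x \<in> C" for x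
  proof -
    obtain d where d: "d > 0" "ball x d \<subseteq> C" using C(1) x open_contains_ball by blast
    have far: "norm (z - x) \<ge> d" if "z \<in> K" for z
    proof (rule ccontr)
      assume "\<not> norm (z - x) \<ge> d"
      then have "z \<in> ball x d" by (simp add: dist_norm norm_minus_commute)
      then show False using d C that by blast
    qed
    have "y \<in> C \<and> (x \<in> G \<longleftrightarrow> y \<in> G)" if y: "norm (y - x) < d / 2" for y
    proof -
      have "y \<in> ball x d" using y d by (simp add: dist_norm norm_minus_commute)
      moreover have "y \<in> G" if "x \<in> G"
        using pole_in_rational_closure_near[OF K _ far, of y] that y d by (simp add: G_def)
      moreover have "x \<in> G" if "y \<in> G"
      proof -
        have "norm (z - y) \<ge> d / 2" if "z \<in> K" for z
          using norm_triangle_ineq[of "z - y" "y - x"] far[OF that] y by simp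
        then show ?thesis
          using pole_in_rational_closure_near[OF K _, of y "d / 2" x] that y by (simp add: G_def norm_minus_commute)
      qed
      ultimately show ?thesis using d by blast
    qed
    then show ?thesis using d(1) by (intro exI[of _ "d / 2"]) auto
  qed
  have "open (C \<inter> G)" "open (C - G)"
    unfolding open_dist using dist by (fastforce simp: dist_norm)+
  then have "C \<inter> G = {} \<or> C - G = {}"
    using connectedD[OF C(2), of "C \<inter> G" "C - G"] by blast
  moreover have "w \<in> C" using conn connected_component_in[OF conn] unfolding C_def by auto
  moreover have "w \<in> G" using w by (simp add: G_def)
  moreover have "w' \<in> C" using conn by (simp add: C_def)
  ultimately show ?thesis unfolding G_def by blast
qed

text \<open>For \<open>y\<close> far away the geometric series of \<open>1 / (z - y)\<close> in powers of \<open>z\<close> converges uniformly on \<open>K\<close>; the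
  pole can then be moved from \<open>y\<close> to \<open>w\<close>.\<close>
lemma pole_in_rational_closure_unbounded:
  assumes K: "compact K" "W \<inter> K = {}" and unb: "\<not> bounded (connected_component_set (- K) w)"
  shows "(\<lambda>z. 1 / (z - w)) \<in> rational_closure K W"
proof -
  obtain B where B: "B > 0" "\<And>z. z \<in> K \<Longrightarrow> norm z \<le> B"
    using K(1) compact_imp_bounded bounded_pos by metis
  obtain y where y: "connected_component (- K) w y" "norm y > 2 * B"
    using unb unfolding bounded_iff by (meson linorder_not_le mem_Collect_eq)
  have y0: "norm y > 0" using y(2) B(1) by linarith
  have "(\<lambda>z. -1 / y * (1 / (1 - 1 / y * z))) \<in> rational_closure K W"
  proof (intro rational_closure_cmult rational_closure_compose_holomorphic[OF K rational_closure_cmult])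
    show "(\<lambda>z. z) \<in> rational_closure K W" by (rule rational_closure_ident)
    show "1 / 2 < (1 :: real)" by simp
    show "norm (1 / y * z) \<le> 1 / 2" if "z \<in> K" for z
      using B(2)[OF that] y(2) y0 by (simp add: norm_divide divide_simps)
    show "(\<lambda>u. 1 / (1 - u)) holomorphic_on ball 0 (1::real)"
      by (intro holomorphic_intros) auto
  qed
  then have "(\<lambda>z. 1 / (z - y)) \<in> rational_closure K W"
  proof (rule rational_closure_cong)
    fix z assume "z \<in> K"
    then have "norm z \<le> B" by (rule B(2))
    then have "z \<noteq> y" "y \<noteq> 0" using y(2) B(1) by auto
    then show "1 / (z - y) = -1 / y * (1 / (1 - 1 / y * z))" by (simp add: divide_simps)
  qed
  then show ?thesis
    using pole_in_rational_closure_component[OF K] y(1) by (metis connected_component_sym)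
qed

text \<open>Runge's observation that one pole in each bounded component of the complement is enough.\<close>
lemma rational_closure_pole_shift:
  assumes K: "compact K" "W \<inter> K = {}"
    and W: "\<And>w. w \<notin> K \<Longrightarrow> bounded (connected_component_set (- K) w) \<Longrightarrow>
        \<exists>w'\<in>W. connected_component (- K) w w'"
  shows "rational_closure K (- K) = rational_closure K W"
proof
  have pole: "(\<lambda>z. 1 / (z - w)) \<in> rational_closure K W" if w: "w \<in> - K" for w
  proof (cases "bounded (connected_component_set (- K) w)")
    case True
    then obtain w' where "w' \<in> W" "connected_component (- K) w w'" using W[of w] w by auto
    then show ?thesis
      using pole_in_rational_closure_component[OF K rational_closure_pole[of w' W]]
      by (meson connected_component_sym)
  qed (rule pole_in_rational_closure_unbounded[OF K])
  have "f \<in> rational_closure K W" if "f \<in> rational_with_poles (- K)" for f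
    using that
  proof induction
    case (mult f g)
    then show ?case by (intro rational_closure_mult K)
  qed (auto intro: rational_closure_const rational_closure_ident pole[unfolded Compl_iff]
        rational_closure_add)
  then show "rational_closure K (- K) \<subseteq> rational_closure K W"
    unfolding rational_closure_def
    by (metis uniform_closure_on_mono uniform_closure_on_idem subsetI)
  have "f \<in> rational_with_poles (- K)" if "f \<in> rational_with_poles W" for f
    using that
  proof induction
    case (pole w)
    then show ?case using K(2) by (intro rational_with_poles.pole) auto
  qed (auto intro: rational_with_poles.intros)
  then show "rational_closure K W \<subseteq> rational_closure K (- K)"
    unfolding rational_closure_def by (intro uniform_closure_on_mono subsetI)
qed

section \<open>Partial fractions\<close>

inductive_set partial_fractions :: "complex set \<Rightarrow> (complex \<Rightarrow> complex) set"
  for W :: "complex set"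
where
  zero: "(\<lambda>z. 0) \<in> partial_fractions W"
| monom: "f \<in> partial_fractions W \<Longrightarrow> (\<lambda>z. c * z ^ k + f z) \<in> partial_fractions W"
| pole_power: "f \<in> partial_fractions W \<Longrightarrow> w \<in> W \<Longrightarrow>
    (\<lambda>z. c * (1 / (z - w)) ^ k + f z) \<in> partial_fractions W"

lemma partial_fractions_add:
  assumes "f \<in> partial_fractions W" "g \<in> partial_fractions W"
  shows "(\<lambda>z. f z + g z) \<in> partial_fractions W"
  using assms by induction (auto simp: add.assoc intro: partial_fractions.intros)

lemma partial_fractions_cmult:
  assumes "f \<in> partial_fractions W" shows "(\<lambda>z. a * f z) \<in> partial_fractions W"
  using assms
proof induction
  case zero then show ?case using partial_fractions.zero by simp
next
  case (monom f c k)
  then show ?case using partial_fractions.monom[of _ W "a * c" k] by (simp add: distrib_left mult.assoc)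
next
  case (pole_power f w c k)
  then show ?case using partial_fractions.pole_power[of _ W w "a * c" k] by (simp add: distrib_left mult.assoc)
qed

lemma partial_fractions_monom: "(\<lambda>z. z ^ k) \<in> partial_fractions W"
  using partial_fractions.monom[OF partial_fractions.zero, of 1 k] by simp

lemma partial_fractions_pole_power: "w \<in> W \<Longrightarrow> (\<lambda>z. (1 / (z - w)) ^ k) \<in> partial_fractions W"
  using partial_fractions.pole_power[OF partial_fractions.zero, of w W 1 k] by simp

text \<open>Equality only off the poles: products of fractions are rewritten by identities that fail where a
  denominator is \<open>0\<close>.\<close>
definition partial_fractions_off :: "complex set \<Rightarrow> (complex \<Rightarrow> complex) set"
  where "partial_fractions_off W = {f. \<exists>g\<in>partial_fractions W. \<forall>z. z \<notin> W \<longrightarrow> f z = g z}"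

lemma partial_fractions_offI:
  "g \<in> partial_fractions W \<Longrightarrow> (\<And>z. z \<notin> W \<Longrightarrow> f z = g z) \<Longrightarrow> f \<in> partial_fractions_off W"
  unfolding partial_fractions_off_def by blast

lemma partial_fractions_off_cong:
  "g \<in> partial_fractions_off W \<Longrightarrow> (\<And>z. z \<notin> W \<Longrightarrow> f z = g z) \<Longrightarrow> f \<in> partial_fractions_off W"
  unfolding partial_fractions_off_def by auto

lemma partial_fractions_off_add:
  assumes "f \<in> partial_fractions_off W" "g \<in> partial_fractions_off W"
  shows "(\<lambda>z. f z + g z) \<in> partial_fractions_off W"
  using assms unfolding partial_fractions_off_def by (force intro: partial_fractions_add)

lemma partial_fractions_off_cmult:
  assumes "f \<in> partial_fractions_off W"
  shows "(\<lambda>z. a * f z) \<in> partial_fractions_off W"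
  using assms unfolding partial_fractions_off_def by (force intro: partial_fractions_cmult)

text \<open>By linearity it suffices to multiply monomials and pole powers by \<open>h\<close>.\<close>
lemma partial_fractions_off_mult_gen:
  assumes f: "f \<in> partial_fractions_off W"
    and m: "\<And>k. (\<lambda>z. h z * z ^ k) \<in> partial_fractions_off W"
    and p: "\<And>w k. w \<in> W \<Longrightarrow> (\<lambda>z. h z * (1 / (z - w)) ^ k) \<in> partial_fractions_off W"
  shows "(\<lambda>z. h z * f z) \<in> partial_fractions_off W"
proof -
  have *: "(\<lambda>z. h z * g z) \<in> partial_fractions_off W" if "g \<in> partial_fractions W" for g
    using that
  proof induction
    case zero
    then show ?case by (auto intro: partial_fractions_offI partial_fractions.zero)
  next
    case (monom f c k)
    from partial_fractions_off_add[OF partial_fractions_off_cmult[OF m[of k], of c] monom.IH]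
    show ?case by (rule partial_fractions_off_cong) (simp add: algebra_simps)
  next
    case (pole_power f w c k)
    from partial_fractions_off_add[OF partial_fractions_off_cmult[OF p[OF pole_power.hyps(2), of k], of c] pole_power.IH]
    show ?case by (rule partial_fractions_off_cong) (simp only: distrib_left mult.left_commute)
  qed
  obtain g where g: "g \<in> partial_fractions W" "\<And>z. z \<notin> W \<Longrightarrow> f z = g z"
    using f unfolding partial_fractions_off_def by blast
  show ?thesis by (rule partial_fractions_off_cong[OF *[OF g(1)]]) (simp add: g(2))
qed

lemma partial_fractions_off_mult_ident:
  assumes "f \<in> partial_fractions_off W" shows "(\<lambda>z. z * f z) \<in> partial_fractions_off W"
proof (rule partial_fractions_off_mult_gen[OF assms])
  show "(\<lambda>z. z * z ^ k) \<in> partial_fractions_off W" for k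
    using partial_fractions_monom[of "Suc k"] by (auto intro: partial_fractions_offI)
  fix w k assume w: "w \<in> W"
  show "(\<lambda>z. z * (1 / (z - w)) ^ k) \<in> partial_fractions_off W"
  proof (cases k)
    case 0
    then show ?thesis using partial_fractions_monom[of 1] by (auto intro: partial_fractions_offI)
  next
    case (Suc n)
    show ?thesis
    proof (rule partial_fractions_offI)
      show "(\<lambda>z. (1 / (z - w)) ^ n + w * (1 / (z - w)) ^ k) \<in> partial_fractions W"
        by (intro partial_fractions_add partial_fractions_cmult partial_fractions_pole_power w)
      fix z assume "z \<notin> W"
      then have "z - w \<noteq> 0" using w by auto
      then have "z * (1 / (z - w)) = 1 + w * (1 / (z - w))" by (simp add: divide_simps)
      then show "z * (1 / (z - w)) ^ k = (1 / (z - w)) ^ n + w * (1 / (z - w)) ^ k"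
        unfolding Suc power_Suc by (metis (no_types, lifting) distrib_right mult.assoc mult_1)
    qed
  qed
qed

lemma partial_fractions_off_mult_pole:
  assumes "f \<in> partial_fractions_off W" and v: "v \<in> W"
  shows "(\<lambda>z. 1 / (z - v) * f z) \<in> partial_fractions_off W"
proof (rule partial_fractions_off_mult_gen[OF assms(1)])
  have pv: "(\<lambda>z. (1 / (z - v)) ^ k) \<in> partial_fractions_off W" for k
    using partial_fractions_pole_power[OF v] by (auto intro: partial_fractions_offI)
  show "(\<lambda>z. 1 / (z - v) * z ^ k) \<in> partial_fractions_off W" for k
  proof (induction k)
    case 0
    then show ?case using pv[of 1] by simp
  next
    case (Suc k)
    from partial_fractions_off_mult_ident[OF this]
    show ?case by (rule partial_fractions_off_cong) simp
  qed
  fix w k assume w: "w \<in> W"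
  show "(\<lambda>z. 1 / (z - v) * (1 / (z - w)) ^ k) \<in> partial_fractions_off W"
  proof (cases "v = w")
    case True
    then show ?thesis using pv[of "Suc k"] by simp
  next
    case False
    show ?thesis
    proof (induction k)
      case 0
      then show ?case using pv[of 1] by simp
    next
      case (Suc k)
      have "(\<lambda>z. 1 / (v - w) * (1 / (z - v) * (1 / (z - w)) ^ k + (-1) * (1 / (z - w)) ^ Suc k)) \<in> partial_fractions_off W"
        by (intro partial_fractions_off_cmult partial_fractions_off_add Suc
            partial_fractions_offI[OF partial_fractions_pole_power[OF w, of "Suc k"]]) auto
      then show ?case
      proof (rule partial_fractions_off_cong)
        fix z assume "z \<notin> W"
        then have "z - w \<noteq> 0" "z - v \<noteq> 0" "v - w \<noteq> 0" using w v False by auto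
        then have *: "1 / (z - v) * (1 / (z - w)) = 1 / (v - w) * (1 / (z - v) - 1 / (z - w))"
          by (simp add: divide_simps)
        have "1 / (z - v) * (1 / (z - w)) ^ Suc k = (1 / (z - v) * (1 / (z - w))) * (1 / (z - w)) ^ k"
          by simp
        also have "\<dots> = 1 / (v - w) * (1 / (z - v) * (1 / (z - w)) ^ k + (-1) * (1 / (z - w)) ^ Suc k)"
          unfolding * by (simp add: algebra_simps)
        finally show "1 / (z - v) * (1 / (z - w)) ^ Suc k =
            1 / (v - w) * (1 / (z - v) * (1 / (z - w)) ^ k + (-1) * (1 / (z - w)) ^ Suc k)" .
      qed
    qed
  qed
qed

lemma rational_with_poles_partial_fractions:
  assumes "f \<in> rational_with_poles W" shows "f \<in> partial_fractions_off W"
proof -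
  have "(\<lambda>z. f z * g z) \<in> partial_fractions_off W" if "g \<in> partial_fractions_off W" for g
    using assms that
  proof (induction arbitrary: g)
    case (add f1 f2)
    from partial_fractions_off_add[OF add.IH(1)[OF add.prems] add.IH(2)[OF add.prems]]
    show ?case by (simp add: distrib_right)
  next
    case (mult f1 f2)
    from mult.IH(1)[OF mult.IH(2)[OF mult.prems]] show ?case by (simp add: mult.assoc)
  qed (auto intro: partial_fractions_off_cmult partial_fractions_off_mult_ident dest: partial_fractions_off_mult_pole)
  from this[of "\<lambda>z. 1"] show ?thesis
    using partial_fractions_monom[of 0] by (auto intro: partial_fractions_offI)
qed


section \<open>Functions with prescribed first Laurent coefficients\<close>

lemma csqrt_one_plus_holomorphic: "(\<lambda>w. csqrt (1 + w)) holomorphic_on ball 0 1"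
proof (rule holomorphic_on_csqrt')
  show "(\<lambda>w. 1 + w) holomorphic_on ball 0 1" by (intro holomorphic_intros)
  fix w :: complex assume "w \<in> ball 0 1"
  then have "Re (1 + w) > 0" using abs_Re_le_cmod[of w] by simp
  then show "1 + w \<notin> \<real>\<^sub>\<le>\<^sub>0" by (auto simp: complex_nonpos_Reals_iff)
qed

text \<open>If the path is cut into short steps, \<open>(z - a) / (z - b)\<close> is a product of factors
  \<open>(z - a\<^sub>i) / (z - a\<^sub>i\<^sub>+\<^sub>1) = 1 + v\<close> with \<open>\<bar>v\<bar> \<le> 1/2\<close> on \<open>K\<close>, and each has a principal square root given by
  a power series in \<open>v\<close>. The product \<open>s\<close> of these roots is also continuous on \<open>\<bar>z - b\<bar> \<ge> 2\<close>, where its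
  square is close to 1, so that \<open>Re s\<close> has no zero there. As this region is connected, one global
  sign makes \<open>Re s\<close> positive on it.\<close>
lemma square_root_along_path:
  assumes K: "compact K" and g: "path g" "pathstart g = a" "pathfinish g = b"
    and im: "path_image g \<inter> K = {}" "path_image g \<subseteq> cball b 1" and ab: "norm (b - a) = 1"
  shows "\<exists>s\<in>rational_closure K (- K). \<forall>z\<in>K. s z ^ 2 = 1 + (b - a) / (z - b) \<and>
    (norm (z - b) \<ge> 2 \<longrightarrow> Re (s z) > 0)"
proof -
  have cg: "compact (path_image g)" using g(1) by (rule compact_path_image)
  \<comment> \<open>The cap \<open>1/2\<close> keeps the points with \<open>\<bar>z - b\<bar> \<ge> 2\<close> farther than \<open>h\<close> from the path.\<close>
  obtain h where h: "h > 0" "h \<le> 1/2" "\<And>z p. z \<in> K \<Longrightarrow> p \<in> path_image g \<Longrightarrow> norm (z - p) \<ge> 2 * h"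
  proof -
    obtain d where d: "d > 0" "\<And>p z. p \<in> path_image g \<Longrightarrow> z \<in> K \<Longrightarrow> dist p z \<ge> d"
      using separate_compact_closed[OF cg compact_imp_closed[OF K] im(1)] by (metis dist_commute)
    show ?thesis
    proof (rule that[of "min (1/2) (d/2)"])
      show "norm (z - p) \<ge> 2 * min (1/2) (d/2)" if "z \<in> K" "p \<in> path_image g" for z p
        using d(2)[OF that(2,1)] by (simp add: dist_norm norm_minus_commute)
    qed (use d(1) in auto)
  qed
  have "uniformly_continuous_on {0..1} g"
    using g(1) by (intro compact_uniformly_continuous) (auto simp: path_def)
  then obtain \<delta> where \<delta>: "\<delta> > 0" "\<And>x y. x \<in> {0..1} \<Longrightarrow> y \<in> {0..1} \<Longrightarrow> dist y x < \<delta> \<Longrightarrow> dist (g y) (g x) < h"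
    using h(1) unfolding uniformly_continuous_on_def by metis
  obtain m :: nat where "m > 1 / \<delta>" using reals_Archimedean2 by blast
  define n where "n = Suc m"
  have n0: "n > 0" by (simp add: n_def)
  have "1 / \<delta> < real n" using \<open>m > 1 / \<delta>\<close> by (simp add: n_def)
  then have "1 / real n < \<delta>" using \<delta>(1) n0 by (simp add: divide_less_eq mult.commute)
  note n = n0 this
  define c where "c i = g (real i / real n)" for i
  have c0: "c 0 = a" and cn: "c n = b" using g n by (auto simp: c_def pathstart_def pathfinish_def)
  have c_im: "c i \<in> path_image g" if "i \<le> n" for i
    using that n by (auto simp: c_def path_image_def)
  have step: "norm (c (Suc i) - c i) < h" if "i < n" for i
  proof -
    have "dist (real (Suc i) / real n) (real i / real n) < \<delta>"
      using n by (simp add: dist_real_def diff_divide_distrib[symmetric])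
    then show ?thesis using \<delta>(2)[of "real i / real n" "real (Suc i) / real n"] that n
      by (simp add: c_def dist_norm)
  qed
  define v where "v i z = (c (Suc i) - c i) * (1 / (z - c (Suc i)))" for i z
  define s where "s z = (\<Prod>i<n. csqrt (1 + v i z))" for z
  \<comment> \<open>The region off the chain on which no factor meets the branch cut.\<close>
  define T where "T = {z. \<forall>i\<le>n. norm (z - c i) \<ge> h}"
  have v_T: "norm (v i z) < 1" if "z \<in> T" "i < n" for i z
  proof -
    have "norm (z - c (Suc i)) \<ge> h" using that by (auto simp: T_def)
    then show ?thesis using step[OF that(2)] h(1) by (simp add: v_def norm_mult norm_divide divide_simps)
  qed
  have ne_T: "z \<noteq> c i" if "z \<in> T" "i \<le> n" for i z
  proof -
    have "norm (z - c i) \<ge> h" using that by (simp add: T_def)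
    then show ?thesis using h(1) by auto
  qed
  have sq: "s z ^ 2 = 1 + (b - a) / (z - b)" if z: "z \<in> T" for z
  proof -
    have "s z ^ 2 = (\<Prod>i<n. 1 + v i z)" by (simp add: s_def prod_power_distrib)
    also have "\<dots> = (\<Prod>i<n. (z - c i) / (z - c (Suc i)))"
      using ne_T[OF z] by (intro prod.cong refl) (simp add: v_def divide_simps)
    also have "\<dots> = (z - c 0) / (z - c n)"
    proof -
      have "(\<Prod>i<k. (z - c i) / (z - c (Suc i))) = (z - c 0) / (z - c k)" if "k \<le> n" for k
        using that ne_T[OF z] by (induction k) auto
      then show ?thesis by blast
    qed
    also have "\<dots> = 1 + (b - a) / (z - b)" using ne_T[OF z, of n] by (simp add: c0 cn divide_simps)
    finally show ?thesis .
  qed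
  have K_T: "K \<subseteq> T"
  proof
    fix z assume z: "z \<in> K"
    have "norm (z - c i) \<ge> h" if "i \<le> n" for i
      using h(3)[OF z c_im[OF that]] h(1) by linarith
    then show "z \<in> T" by (simp add: T_def)
  qed
  have s_cl: "s \<in> rational_closure K (- K)"
    unfolding s_def
  proof (intro rational_closure_prod rational_closure_compose_holomorphic[OF _ _ _ _ _ csqrt_one_plus_holomorphic])
    fix i assume i: "i \<in> {..<n}"
    then have ci: "c (Suc i) \<in> path_image g" by (intro c_im) auto
    show "v i \<in> rational_closure K (- K)" unfolding v_def
      using ci im(1) by (intro rational_closure_cmult rational_closure_pole) auto
    show "norm (v i z) \<le> 1 / 2" if "z \<in> K" for z
      using h(3)[OF that ci] step[of i] i h(1) by (simp add: v_def norm_mult norm_divide divide_simps)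
  qed (use K in auto)
  let ?X = "- ball b 2"
  have X_T: "?X \<subseteq> T"
  proof
    fix z assume "z \<in> ?X"
    then have z: "norm (z - b) \<ge> 2" by (simp add: dist_norm norm_minus_commute)
    have "norm (z - c i) \<ge> h" if "i \<le> n" for i
    proof -
      have "c i \<in> cball b 1" using c_im[OF that] im(2) by blast
      then have "norm (c i - b) \<le> 1" by (simp add: dist_norm norm_minus_commute)
      then show ?thesis using norm_triangle_ineq[of "z - c i" "c i - b"] z h(2) by simp
    qed
    then show "z \<in> T" by (simp add: T_def)
  qed
  have "continuous_on T s"
    unfolding s_def
  proof (intro continuous_on_prod)
    fix i assume i: "i \<in> {..<n}"
    have "continuous_on T (v i)" unfolding v_def
      using ne_T[of _ "Suc i"] i by (intro continuous_intros) auto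
    then show "continuous_on T (\<lambda>z. csqrt (1 + v i z))"
      by (rule continuous_on_compose2[OF holomorphic_on_imp_continuous_on[OF csqrt_one_plus_holomorphic]]) (use v_T[OF _ i[unfolded lessThan_iff]] in auto)
  qed
  then have "continuous_on ?X (\<lambda>z. Re (s z))"
    using X_T continuous_on_subset by (intro continuous_intros) blast
  moreover have "connected ?X" by (rule connected_complement_bounded_convex) auto
  ultimately have conn: "connected ((\<lambda>z. Re (s z)) ` ?X)" by (rule connected_continuous_image)
  have Re_ne: "Re (s z) \<noteq> 0" if "z \<in> ?X" for z
  proof
    assume 0: "Re (s z) = 0"
    have z: "norm (z - b) \<ge> 2" using that by (simp add: dist_norm norm_minus_commute)
    then have "norm ((b - a) / (z - b)) < 1" using ab by (auto simp: norm_divide divide_simps)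
    then have "Re (1 + (b - a) / (z - b)) > 0"
      using abs_Re_le_cmod[of "(b - a) / (z - b)"] by simp
    moreover have "Re (s z ^ 2) \<le> 0" using 0 by (simp add: power2_eq_square)
    ultimately show False using sq[of z] that X_T by auto
  qed
  have "(\<forall>z\<in>?X. Re (s z) > 0) \<or> (\<forall>z\<in>?X. Re (s z) < 0)"
  proof (rule ccontr)
    assume "\<not> ?thesis"
    then obtain x y where "x \<in> ?X" "Re (s x) < 0" "y \<in> ?X" "Re (s y) > 0"
      using Re_ne by (metis linorder_neqE_linordered_idom)
    then have "0 \<in> (\<lambda>z. Re (s z)) ` ?X"
      using connectedD_interval[OF conn, of "Re (s x)" "Re (s y)" 0] by auto
    then show False using Re_ne by auto
  qed
  then obtain \<sigma> :: complex where \<sigma>: "\<sigma> ^ 2 = 1" "\<And>z. z \<in> ?X \<Longrightarrow> Re (\<sigma> * s z) > 0"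
  proof
    assume "\<forall>z\<in>?X. Re (s z) > 0" then show ?thesis using that[of 1] by simp
  next
    assume "\<forall>z\<in>?X. Re (s z) < 0" then show ?thesis using that[of "- 1"] by simp
  qed
  show ?thesis
  proof (intro bexI[of _ "\<lambda>z. \<sigma> * s z"] ballI conjI impI)
    show "(\<lambda>z. \<sigma> * s z) \<in> rational_closure K (- K)" by (rule rational_closure_cmult[OF s_cl])
    fix z assume z: "z \<in> K"
    then show "(\<sigma> * s z) ^ 2 = 1 + (b - a) / (z - b)" using sq[of z] K_T \<sigma>(1)
      by (auto simp: power_mult_distrib)
    assume "norm (z - b) \<ge> 2"
    then show "Re (\<sigma> * s z) > 0" by (intro \<sigma>(2)) (simp add: dist_norm norm_minus_commute)
  qed
qed

text \<open>The relation reads \<open>p = 1/2 - u p\<^sup>2 / 2\<close>; inserting it into itself twice gives the expansion. The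
  bound on \<open>p\<close> makes the estimate valid for all \<open>u\<close>, not only for small ones.\<close>
lemma quadratic_root_expansion:
  fixes p u :: complex
  assumes "u * p ^ 2 = 1 - 2 * p" "norm p \<le> 6"
  shows "norm (p - (1 / 2 - u / 8 + u ^ 2 / 16)) \<le> 200 * norm u ^ 3"
proof -
  have e1: "p - 1 / 2 = - (u / 2) * p ^ 2" using assms(1) by (simp add: field_simps)
  have e2: "p ^ 2 - 1 / 4 = (p - 1 / 2) * (p + 1 / 2)" by (simp add: algebra_simps power2_eq_square)
  have e3: "p ^ 2 * (p + 1 / 2) - 1 / 4 = (p - 1 / 2) * (p ^ 2 + p + 1 / 2)"
    by (simp add: algebra_simps power2_eq_square)
  have "p - (1 / 2 - u / 8 + u ^ 2 / 16) = (p - 1 / 2) + u / 8 - u ^ 2 / 16" by simp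
  also have "\<dots> = - (u / 2) * (p ^ 2 - 1 / 4) - u ^ 2 / 16"
    unfolding e1 by (simp add: algebra_simps)
  also have "\<dots> = u ^ 2 / 4 * (p ^ 2 * (p + 1 / 2) - 1 / 4)"
    unfolding e2 e1 by (simp add: field_simps power2_eq_square)
  also have "\<dots> = - (u ^ 3 / 8) * (p ^ 2 * (p ^ 2 + p + 1 / 2))"
    unfolding e3 e1 by (simp add: algebra_simps power2_eq_square power3_eq_cube)
  finally have eq: "p - (1 / 2 - u / 8 + u ^ 2 / 16) = - (u ^ 3 / 8) * (p ^ 2 * (p ^ 2 + p + 1 / 2))" .
  have p2: "norm (p ^ 2) \<le> 36" using power_mono[OF assms(2), of 2] by (simp add: norm_power)
  have "norm (p ^ 2 + p + 1 / 2) \<le> norm (p ^ 2) + norm p + norm (1 / 2 :: complex)"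
    by (rule order_trans[OF norm_triangle_ineq]) (intro add_right_mono norm_triangle_ineq)
  also have "\<dots> \<le> 43" using p2 assms(2) by simp
  finally have "norm (p ^ 2 + p + 1 / 2) \<le> 43" .
  then have "norm (p ^ 2 * (p ^ 2 + p + 1 / 2)) \<le> 36 * 43"
    unfolding norm_mult using p2 by (intro mult_mono) auto
  then have "norm u ^ 3 / 8 * norm (p ^ 2 * (p ^ 2 + p + 1 / 2)) \<le> norm u ^ 3 / 8 * (36 * 43)"
    by (intro mult_left_mono) auto
  also have "\<dots> \<le> 200 * norm u ^ 3" by simp
  finally show ?thesis unfolding eq by (simp add: norm_mult norm_divide norm_power)
qed

text \<open>With the root \<open>s\<close> of \<open>1 + u\<close>, \<open>u = (b - a) / (z - b)\<close>, put \<open>p = 1 / (1 + s) = (s - 1) / u\<close>; the second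
  form shows that \<open>p\<close> lies in the closure. The denominator satisfies \<open>\<bar>1 + s\<bar> \<ge> 1/6\<close>: far from \<open>b\<close>
  because \<open>Re s > 0\<close>, and near \<open>b\<close> because \<open>(1 + s) (s - 1) = u\<close> is not small there. This gives \<open>\<bar>p\<bar> \<le> 6\<close>,
  whence \<open>\<bar>q\<bar> \<le> 8 (1/2 + 6) = 52\<close> for \<open>q = 8 / (b - a) (1/2 - p)\<close>. Since \<open>p\<close> is a root of
  \<open>u p\<^sup>2 + 2 p = 1\<close>, its expansion in \<open>u\<close> is explicit; the factor \<open>8 / (b - a)\<close> makes the leading term of
  \<open>q\<close> equal to \<open>1 / (z - b)\<close>.\<close>
lemma arc_avoiding_functions:
  assumes K: "compact K" and g: "path g" "pathstart g = a" "pathfinish g = b"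
    and im: "path_image g \<inter> K = {}" "path_image g \<subseteq> cball b 1" and ab: "norm (b - a) = 1"
  shows "\<exists>q\<in>rational_closure K (- K). \<forall>z\<in>K. norm (q z) \<le> 52 \<and>
    norm (q z - (1 / (z - b) - (b - a) / 2 * (1 / (z - b)) ^ 2)) \<le> 1600 * (1 / norm (z - b)) ^ 3"
proof -
  obtain s where s: "s \<in> rational_closure K (- K)"
    and sq: "\<And>z. z \<in> K \<Longrightarrow> s z ^ 2 = 1 + (b - a) / (z - b)"
    and Re_s: "\<And>z. z \<in> K \<Longrightarrow> norm (z - b) \<ge> 2 \<Longrightarrow> Re (s z) > 0"
    using square_root_along_path[OF assms] by blast
  have b: "b \<notin> K" using g im(1) pathfinish_in_path_image[of g] by auto
  define p where "p z = 1 / (b - a) * ((s z + -1) * (z + - b))" for z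
  have "p \<in> rational_closure K (- K)" unfolding p_def using K s
    by (intro rational_closure_cmult rational_closure_mult rational_closure_add
        rational_closure_const rational_closure_ident) auto
  then have "(\<lambda>z. 8 / (b - a) * (1 / 2 + (-1) * p z)) \<in> rational_closure K (- K)"
    by (intro rational_closure_cmult rational_closure_add rational_closure_const)
  moreover have "norm (8 / (b - a) * (1 / 2 + (-1) * p z)) \<le> 52 \<and>
    norm (8 / (b - a) * (1 / 2 + (-1) * p z) - (1 / (z - b) - (b - a) / 2 * (1 / (z - b)) ^ 2))
      \<le> 1600 * (1 / norm (z - b)) ^ 3" if z: "z \<in> K" for z
  proof -
    define u where "u = (b - a) / (z - b)"
    have ne: "z - b \<noteq> 0" "b - a \<noteq> 0" using z b ab by auto
    have nu: "norm u = 1 / norm (z - b)" using ab by (simp add: u_def norm_divide)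
    have s2: "s z ^ 2 = 1 + u" using sq[OF z] by (simp add: u_def)
    have pu: "u * p z = s z - 1" using ne by (simp add: p_def u_def)
    have u0: "u \<noteq> 0" using ne by (simp add: u_def)
    have "u * (p z * (1 + s z)) = (s z - 1) * (1 + s z)"
      by (simp only: pu flip: mult.assoc)
    also have "\<dots> = u * 1" using s2 by (simp add: algebra_simps power2_eq_square)
    finally have "u * (p z * (1 + s z)) = u * 1" .
    then have ps: "p z * (1 + s z) = 1" using u0 by (metis mult_left_cancel)
    have up: "u * p z ^ 2 = 1 - 2 * p z"
      using ps by (simp add: power2_eq_square mult.assoc[symmetric] pu) (simp add: algebra_simps)
    have "norm (1 + s z) \<ge> 1 / 6"
    proof (cases "norm (z - b) \<ge> 2")
      case True
      then have "Re (1 + s z) > 1" using Re_s[OF z] by simp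
      then show ?thesis using complex_Re_le_cmod[of "1 + s z"] by linarith
    next
      case False
      then have "1 / norm (z - b) > 1 / 2" using ne by (simp add: divide_simps)
      then have u2: "norm u > 1 / 2" using nu by simp
      show ?thesis
      proof (rule ccontr)
        assume n: "\<not> norm (1 + s z) \<ge> 1 / 6"
        have "norm (s z - 1) \<le> norm (1 + s z) + norm (2 :: complex)"
          using norm_triangle_ineq4[of "1 + s z" 2] by (simp add: algebra_simps)
        then have "norm (s z - 1) \<le> 3" using n by simp
        moreover have "u = (1 + s z) * (s z - 1)" using s2 by (simp add: algebra_simps power2_eq_square)
        ultimately have "norm u \<le> 1 / 6 * 3" unfolding norm_mult using n
          by (simp only: norm_mult) (intro mult_mono, auto)
        then show False using u2 by simp
      qed
    qed
    moreover have "norm (p z) * norm (1 + s z) = 1" using ps by (metis norm_mult norm_one)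
    ultimately have "norm (p z) * (1 / 6) \<le> 1" by (metis mult_left_mono norm_ge_zero)
    then have p6: "norm (p z) \<le> 6" by simp
    have n8: "norm (8 / (b - a)) = 8" using ab by (simp add: norm_divide)
    have "norm (1 / 2 + (-1) * p z) \<le> 1 / 2 + 6"
      using norm_triangle_ineq[of "1 / 2" "(-1) * p z"] p6 by simp
    then have "norm (8 / (b - a) * (1 / 2 + (-1) * p z)) \<le> 8 * (1 / 2 + 6)"
      unfolding norm_mult n8 by (intro mult_left_mono) auto
    then have "norm (8 / (b - a) * (1 / 2 + (-1) * p z)) \<le> 52" by simp
    moreover have "norm (8 / (b - a) * (1 / 2 + (-1) * p z) - (1 / (z - b) - (b - a) / 2 * (1 / (z - b)) ^ 2))
      \<le> 1600 * (1 / norm (z - b)) ^ 3"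
    proof -
      have c1: "8 / (b - a) * (u / 8) = 1 / (z - b)"
      proof -
        have "8 / c * (c / d / 8) = 1 / d" if "c \<noteq> 0" for c d :: complex using that by simp
        then show ?thesis using ne(2) unfolding u_def by blast
      qed
      have c2: "8 / (b - a) * (u ^ 2 / 16) = (b - a) / 2 * (1 / (z - b)) ^ 2"
      proof -
        have "8 / c * ((c / d) ^ 2 / 16) = c / 2 * (1 / d) ^ 2" if "c \<noteq> 0" for c d :: complex
          using that by (simp add: power2_eq_square)
        then show ?thesis using ne(2) unfolding u_def by blast
      qed
      have "8 / (b - a) * (1 / 2 + (-1) * p z) - (1 / (z - b) - (b - a) / 2 * (1 / (z - b)) ^ 2)
          = - (8 / (b - a) * (p z - (1 / 2 - u / 8 + u ^ 2 / 16)))"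
        unfolding c2[symmetric] unfolding c1[symmetric]
      proof -
        have "e * (1 / 2 + (-1) * P) - (e * U - e * V) = - (e * (P - (1 / 2 - U + V)))" for e P U V :: complex
          by (simp add: algebra_simps)
        then show "8 / (b - a) * (1 / 2 + (-1) * p z) - (8 / (b - a) * (u / 8) - 8 / (b - a) * (u ^ 2 / 16))
          = - (8 / (b - a) * (p z - (1 / 2 - u / 8 + u ^ 2 / 16)))" .
      qed
      then have "norm (8 / (b - a) * (1 / 2 + (-1) * p z) - (1 / (z - b) - (b - a) / 2 * (1 / (z - b)) ^ 2))
          = norm (8 / (b - a)) * norm (p z - (1 / 2 - u / 8 + u ^ 2 / 16))"
        by (simp only: norm_minus_cancel norm_mult)
      also have "\<dots> \<le> 8 * (200 * (1 / norm (z - b)) ^ 3)"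
        unfolding n8 using quadratic_root_expansion[OF up p6] nu by (intro mult_left_mono) auto
      finally show ?thesis by simp
    qed
    ultimately show ?thesis by (rule conjI)
  qed
  ultimately show ?thesis
    by (intro bexI[of _ "\<lambda>z. 8 / (b - a) * (1 / 2 + (-1) * p z)"] ballI)
qed

text \<open>Follow a path in the component from \<open>b\<close> towards a point at distance at least 1 and stop when it
  leaves the unit disc.\<close>
lemma unit_arc_in_component:
  assumes K: "compact K" and b: "b \<notin> K"
    and d: "connected_component (- K) b d" "dist b d \<ge> 1"
  obtains g where "path g" "pathfinish g = b" "path_image g \<inter> K = {}" "path_image g \<subseteq> cball b 1"
    "norm (b - pathstart g) = 1"
proof -
  have op: "open (- K)" using K compact_imp_closed by auto
  have "path_connected (connected_component_set (- K) b)"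
    using op by (intro connected_open_path_connected open_connected_component) auto
  moreover have "b \<in> connected_component_set (- K) b" "d \<in> connected_component_set (- K) b"
    using b d(1) by (auto intro: connected_component_refl)
  ultimately obtain f where "path f" "path_image f \<subseteq> connected_component_set (- K) b" "pathstart f = b" "pathfinish f = d"
    unfolding path_connected_def by blast
  then have f: "path f" "path_image f \<subseteq> - K" "pathstart f = b" "pathfinish f = d"
    using connected_component_subset[of "- K" b] by blast+
  have "pathfinish f \<notin> ball b 1" using f d(2) by simp
  moreover have "pathstart f \<in> closure (ball b 1)" using f(3) by simp
  ultimately obtain h where h: "path h" "pathstart h = pathstart f" "path_image h \<subseteq> path_image f"
      "path_image h - {pathfinish h} \<subseteq> interior (ball b 1)" "pathfinish h \<in> frontier (ball b 1)"
    using exists_path_subpath_to_frontier[OF f(1)] by metis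
  have fin: "norm (b - pathfinish h) = 1" using h(5) by (simp add: frontier_ball dist_norm)
  have "path_image h \<subseteq> cball b 1"
  proof
    fix x assume "x \<in> path_image h"
    then show "x \<in> cball b 1" using h(4) fin by (cases "x = pathfinish h") (auto simp: dist_norm)
  qed
  then show ?thesis using that[of "reversepath h"] h f fin by auto
qed


section \<open>A smooth partition of unity and a smoothed Cauchy kernel\<close>

text \<open>The simplest \<open>C\<^sup>1\<close> function that vanishes on a half line but not identically.\<close>
definition pos_sq :: "real \<Rightarrow> real" where "pos_sq t = (max 0 t)\<^sup>2"

lemma pos_sq_has_derivative: "(pos_sq has_real_derivative 2 * max 0 t) (at t)"
proof -
  consider "t < 0" | "t > 0" | "t = 0" by linarith
  then show ?thesis
  proof cases
    case 1
    have "((\<lambda>t. 0) has_real_derivative 2 * max 0 t) (at t)" using 1 by simp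
    then show ?thesis
      by (rule has_field_derivative_transform_within_open[of _ _ _ "{..<0}"])
        (use 1 in \<open>auto simp: pos_sq_def\<close>)
  next
    case 2
    have "((\<lambda>t. t\<^sup>2) has_real_derivative 2 * max 0 t) (at t)"
      using 2 by (auto intro!: derivative_eq_intros)
    then show ?thesis
      by (rule has_field_derivative_transform_within_open[of _ _ _ "{0<..}"])
        (use 2 in \<open>auto simp: pos_sq_def\<close>)
  next
    case 3
    have "(\<lambda>h. (pos_sq (0 + h) - pos_sq 0) / h) \<midarrow>0\<rightarrow> 0"
    proof (rule Lim_null_comparison)
      show "\<forall>\<^sub>F h in at 0. norm ((pos_sq (0 + h) - pos_sq 0) / h) \<le> \<bar>h\<bar>"
        by (auto simp: pos_sq_def max_def power2_eq_square intro!: always_eventually)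
      show "(\<lambda>h. \<bar>h\<bar>) \<midarrow>0\<rightarrow> (0::real)" by real_asymp
    qed
    then show ?thesis using 3 by (simp add: DERIV_def)
  qed
qed

lemma pos_sq_chain [derivative_intros]:
  "(g has_real_derivative g') (at t) \<Longrightarrow>
   ((\<lambda>t. pos_sq (g t)) has_real_derivative (2 * max 0 (g t) * g')) (at t)"
  using DERIV_chain2[OF pos_sq_has_derivative] by blast

text \<open>A quadratic spline that rises from 0 at \<open>x = 0\<close> to 1 at \<open>x = 1\<close>.\<close>
definition smooth_step :: "real \<Rightarrow> real"
  where "smooth_step x = 2 * pos_sq x - 4 * pos_sq (x - 1/2) + 2 * pos_sq (x - 1)"

definition smooth_step' :: "real \<Rightarrow> real"
  where "smooth_step' x = 4 * max 0 x - 8 * max 0 (x - 1/2) + 4 * max 0 (x - 1)"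

lemma smooth_step_has_derivative: "(smooth_step has_real_derivative smooth_step' x) (at x)"
  unfolding smooth_step_def[abs_def] smooth_step'_def
  by (auto intro!: derivative_eq_intros)

lemma smooth_step_values: "x \<le> 0 \<Longrightarrow> smooth_step x = 0" "x \<ge> 1 \<Longrightarrow> smooth_step x = 1"
  "x \<le> 0 \<Longrightarrow> smooth_step' x = 0" "x \<ge> 1 \<Longrightarrow> smooth_step' x = 0"
  by (auto simp: smooth_step_def smooth_step'_def pos_sq_def power2_eq_square algebra_simps)

lemma smooth_step_range: "0 \<le> smooth_step x" "smooth_step x \<le> 1"
proof -
  consider "x \<le> 0" | "0 \<le> x" "x \<le> 1/2" | "1/2 \<le> x" "x \<le> 1" | "x \<ge> 1" by linarith
  then have "0 \<le> smooth_step x \<and> smooth_step x \<le> 1"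
  proof cases
    case 2
    then have "smooth_step x = 2 * x\<^sup>2" by (simp add: smooth_step_def pos_sq_def)
    moreover have "x\<^sup>2 \<le> (1/2)\<^sup>2" using 2 by (intro power_mono) auto
    ultimately show ?thesis by (simp add: power2_eq_square)
  next
    case 3
    then have "smooth_step x = 1 - 2 * (1 - x)\<^sup>2"
      by (simp add: smooth_step_def pos_sq_def max_def power2_eq_square algebra_simps)
    moreover have "(1 - x)\<^sup>2 \<le> (1/2)\<^sup>2" using 3 by (intro power_mono) auto
    ultimately show ?thesis by (simp add: power2_eq_square)
  qed (auto simp: smooth_step_values)
  then show "0 \<le> smooth_step x" "smooth_step x \<le> 1" by auto
qed

lemma smooth_step'_range: "0 \<le> smooth_step' x" "smooth_step' x \<le> 2"
  by (auto simp: smooth_step'_def max_def)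

text \<open>A difference of two shifted steps, so that sums over integer translates telescope.\<close>
definition bump1 :: "real \<Rightarrow> real" where "bump1 x = smooth_step (x + 1) - smooth_step x"
definition bump1' :: "real \<Rightarrow> real" where "bump1' x = smooth_step' (x + 1) - smooth_step' x"

lemma bump1_has_derivative: "(bump1 has_real_derivative bump1' x) (at x)"
  unfolding bump1_def[abs_def] bump1'_def
  by (auto intro!: derivative_eq_intros DERIV_chain2[OF smooth_step_has_derivative] smooth_step_has_derivative)

lemma bump1_bound: "\<bar>bump1 x\<bar> \<le> 1" "\<bar>bump1' x\<bar> \<le> 2"
  using smooth_step_range[of x] smooth_step_range[of "x + 1"]
    smooth_step'_range[of x] smooth_step'_range[of "x + 1"]
  by (auto simp: bump1_def bump1'_def abs_le_iff)

lemma bump1_eq_0: "\<bar>x\<bar> \<ge> 1 \<Longrightarrow> bump1 x = 0" "\<bar>x\<bar> \<ge> 1 \<Longrightarrow> bump1' x = 0"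
  by (auto simp: bump1_def bump1'_def smooth_step_values abs_le_iff le_max_iff_disj abs_real_def split: if_splits)

lemma continuous_on_bump1: "continuous_on A bump1"
  using bump1_has_derivative by (meson DERIV_isCont continuous_at_imp_continuous_on)

lemma continuous_on_bump1': "continuous_on A bump1'"
  unfolding bump1'_def smooth_step'_def by (intro continuous_intros)

lemma bump1_sum_telescope:
  fixes M :: nat
  assumes "\<bar>x\<bar> \<le> real M"
  shows "(\<Sum>m\<in>{- int M..int M}. bump1 (x - of_int m)) = 1"
    and "(\<Sum>m\<in>{- int M..int M}. bump1' (x - of_int m)) = 0"
proof -
  have tel: "(\<Sum>m\<in>{- int M..int M}. (F (x - of_int m + 1) - F (x - of_int m))) =
      F (x + real M + 1) - F (x - real M)" for F :: "real \<Rightarrow> real"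
  proof (induction M)
    case (Suc M)
    have "{- int (Suc M)..int (Suc M)} = insert (- int (Suc M)) (insert (int (Suc M)) {- int M..int M})"
      by auto
    then show ?case using Suc by (simp add: algebra_simps)
  qed simp
  show "(\<Sum>m\<in>{- int M..int M}. bump1 (x - of_int m)) = 1"
    unfolding bump1_def tel using assms by (simp add: smooth_step_values abs_le_iff)
  show "(\<Sum>m\<in>{- int M..int M}. bump1' (x - of_int m)) = 0"
    unfolding bump1'_def tel using assms by (simp add: smooth_step_values abs_le_iff)
qed

definition bump :: "complex \<Rightarrow> real" where "bump \<zeta> = bump1 (Re \<zeta>) * bump1 (Im \<zeta>)"

definition bump_deriv :: "complex \<Rightarrow> complex \<Rightarrow> real"
  where "bump_deriv \<zeta> v = bump1' (Re \<zeta>) * Re v * bump1 (Im \<zeta>) + bump1 (Re \<zeta>) * (bump1' (Im \<zeta>) * Im v)"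

text \<open>The operator \<open>\<partial>\<^sub>x + \<i> \<partial>\<^sub>y\<close>, twice the usual d-bar operator, applied to \<open>bump\<close>.\<close>
definition dbar_bump :: "complex \<Rightarrow> complex"
  where "dbar_bump \<zeta> = of_real (bump1' (Re \<zeta>) * bump1 (Im \<zeta>)) + \<i> * of_real (bump1 (Re \<zeta>) * bump1' (Im \<zeta>))"

lemma bump_has_derivative: "(bump has_derivative bump_deriv \<zeta>) (at \<zeta>)"
proof -
  have d: "((\<lambda>\<zeta>. bump1 (Re \<zeta>)) has_derivative (\<lambda>v. bump1' (Re \<zeta>) * Re v)) (at \<zeta>)"
    "((\<lambda>\<zeta>. bump1 (Im \<zeta>)) has_derivative (\<lambda>v. bump1' (Im \<zeta>) * Im v)) (at \<zeta>)"
    using has_derivative_compose[OF has_derivative_Re[OF has_derivative_ident]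
        bump1_has_derivative[unfolded has_field_derivative_def]]
      has_derivative_compose[OF has_derivative_Im[OF has_derivative_ident]
        bump1_has_derivative[unfolded has_field_derivative_def]]
    by auto
  show ?thesis unfolding bump_def[abs_def] bump_deriv_def[abs_def]
    by (rule derivative_eq_intros d refl)+ (auto simp: fun_eq_iff)
qed

lemma bump_eq_0:
  assumes "norm \<zeta> \<ge> 2"
  shows "bump \<zeta> = 0" "bump_deriv \<zeta> v = 0" "dbar_bump \<zeta> = 0"
proof -
  have "\<bar>Re \<zeta>\<bar> \<ge> 1 \<or> \<bar>Im \<zeta>\<bar> \<ge> 1" using cmod_le[of \<zeta>] assms by linarith
  then show "bump \<zeta> = 0" "bump_deriv \<zeta> v = 0" "dbar_bump \<zeta> = 0"
    by (auto simp: bump_def bump_deriv_def dbar_bump_def bump1_eq_0)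
qed

lemma bump_bound: "\<bar>bump \<zeta>\<bar> \<le> 1" "norm (dbar_bump \<zeta>) \<le> 4"
proof -
  have "\<bar>bump \<zeta>\<bar> \<le> 1 * 1" unfolding bump_def abs_mult
    by (intro mult_mono bump1_bound) auto
  then show "\<bar>bump \<zeta>\<bar> \<le> 1" by simp
  have "norm (dbar_bump \<zeta>) \<le> \<bar>bump1' (Re \<zeta>)\<bar> * \<bar>bump1 (Im \<zeta>)\<bar> + \<bar>bump1 (Re \<zeta>)\<bar> * \<bar>bump1' (Im \<zeta>)\<bar>"
    unfolding dbar_bump_def by (rule order_trans[OF norm_triangle_ineq]) (simp add: norm_mult abs_mult)
  also have "\<dots> \<le> 2 * 1 + 1 * 2" by (intro add_mono mult_mono bump1_bound) auto
  finally show "norm (dbar_bump \<zeta>) \<le> 4" by simp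
qed

lemma continuous_on_bump: "continuous_on A bump"
  unfolding bump_def[abs_def]
  by (intro continuous_intros continuous_on_compose2[OF continuous_on_bump1[of UNIV]]) auto

lemma continuous_on_bump_deriv: "continuous_on A (\<lambda>\<zeta>. bump_deriv \<zeta> v)"
  unfolding bump_deriv_def[abs_def]
  by (intro continuous_intros continuous_on_compose2[OF continuous_on_bump1[of UNIV]]
    continuous_on_compose2[OF continuous_on_bump1'[of UNIV]]) auto

lemma continuous_on_dbar_bump: "continuous_on A dbar_bump"
  unfolding dbar_bump_def[abs_def]
  by (intro continuous_intros continuous_on_compose2[OF continuous_on_bump1[of UNIV]]
    continuous_on_compose2[OF continuous_on_bump1'[of UNIV]]) auto

lemma dbar_bump_eq: "dbar_bump \<zeta> = of_real (bump_deriv \<zeta> 1) + \<i> * of_real (bump_deriv \<zeta> \<i>)"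
  by (simp add: dbar_bump_def bump_deriv_def)

definition int_grid :: "nat \<Rightarrow> complex set"
  where "int_grid M = (\<lambda>(m, n). Complex (of_int m) (of_int n)) ` ({- int M..int M} \<times> {- int M..int M})"

lemma sum_int_grid:
  "(\<Sum>j\<in>int_grid M. F j) = (\<Sum>m\<in>{- int M..int M}. \<Sum>n\<in>{- int M..int M}. F (Complex (of_int m) (of_int n)))"
  unfolding int_grid_def
  by (subst sum.reindex) (auto simp: inj_on_def sum.cartesian_product case_prod_unfold)

lemma bump_partition:
  assumes "norm \<zeta> \<le> real M"
  shows "(\<Sum>j\<in>int_grid M. bump (\<zeta> - j)) = 1" "(\<Sum>j\<in>int_grid M. dbar_bump (\<zeta> - j)) = 0"
proof -
  have b: "\<bar>Re \<zeta>\<bar> \<le> real M" "\<bar>Im \<zeta>\<bar> \<le> real M"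
    using abs_Re_le_cmod[of \<zeta>] abs_Im_le_cmod[of \<zeta>] assms by linarith+
  note t = bump1_sum_telescope[OF b(1)] bump1_sum_telescope[OF b(2)]
  show "(\<Sum>j\<in>int_grid M. bump (\<zeta> - j)) = 1"
    by (simp add: sum_int_grid bump_def sum_distrib_left[symmetric] sum_distrib_right[symmetric] t)
  show "(\<Sum>j\<in>int_grid M. dbar_bump (\<zeta> - j)) = 0"
    by (simp add: sum_int_grid dbar_bump_def sum.distrib sum_distrib_left[symmetric]
        sum_distrib_right[symmetric] t of_real_sum[symmetric] of_real_mult[symmetric] del: of_real_sum of_real_mult)
qed

text \<open>This is \<open>2 - t\<close> for \<open>t \<le> 1\<close> and \<open>1 / t\<close> for \<open>t \<ge> 1\<close>; value and slope of the two pieces agree at \<open>t = 1\<close>.\<close>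
definition kern_mod :: "real \<Rightarrow> real" where "kern_mod t = 1 / max 1 t + max 0 (1 - t)"
definition kern_mod' :: "real \<Rightarrow> real" where "kern_mod' t = - 1 / (max 1 t)\<^sup>2"

lemma kern_mod_has_derivative: "(kern_mod has_real_derivative kern_mod' t) (at t)"
proof -
  consider "t < 1" | "t > 1" | "t = 1" by linarith
  then show ?thesis
  proof cases
    case 1
    have "((\<lambda>t. 2 - t) has_real_derivative kern_mod' t) (at t)" using 1
      by (auto simp: kern_mod'_def intro!: derivative_eq_intros)
    then show ?thesis
      by (rule has_field_derivative_transform_within_open[of _ _ _ "{..<1}"])
        (use 1 in \<open>auto simp: kern_mod_def\<close>)
  next
    case 2
    have "((\<lambda>t. 1 / t) has_real_derivative kern_mod' t) (at t)" using 2
      by (auto simp: kern_mod'_def power2_eq_square intro!: derivative_eq_intros)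
    then show ?thesis
      by (rule has_field_derivative_transform_within_open[of _ _ _ "{1<..}"])
        (use 2 in \<open>auto simp: kern_mod_def\<close>)
  next
    case 3
    have "(\<lambda>h. (kern_mod (1 + h) - kern_mod 1) / h - (- 1)) \<midarrow>0\<rightarrow> 0"
    proof (rule Lim_null_comparison)
      have "norm ((kern_mod (1 + h) - kern_mod 1) / h - (- 1)) \<le> \<bar>h\<bar>" if "h \<noteq> 0" for h :: real
      proof (cases "h > 0")
        case True
        then have "h + h * h > 0" by (simp add: add_pos_pos)
        then have "(kern_mod (1 + h) - kern_mod 1) / h - (- 1) = h / (1 + h)"
          using True by (simp add: kern_mod_def field_simps)
        also have "norm \<dots> \<le> \<bar>h\<bar>" using True by (simp add: divide_le_eq)
        finally show ?thesis .
      next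
        case False
        then show ?thesis using that by (simp add: kern_mod_def)
      qed
      then show "\<forall>\<^sub>F h in at 0. norm ((kern_mod (1 + h) - kern_mod 1) / h - (- 1)) \<le> \<bar>h\<bar>"
        by (auto simp: eventually_at intro: exI[of _ 1])
      show "(\<lambda>h. \<bar>h\<bar>) \<midarrow>0\<rightarrow> (0::real)" by real_asymp
    qed
    then have "(\<lambda>h. (kern_mod (1 + h) - kern_mod 1) / h) \<midarrow>0\<rightarrow> - 1" by (rule LIM_zero_cancel)
    then show ?thesis using 3 by (simp add: DERIV_def kern_mod'_def)
  qed
qed

text \<open>A \<open>C\<^sup>1\<close> modification of the Cauchy kernel \<open>1 / z\<close> inside the unit disc.\<close>
definition kern :: "complex \<Rightarrow> complex" where "kern z = cnj z * of_real (kern_mod ((norm z)\<^sup>2))"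

definition kern_deriv :: "complex \<Rightarrow> complex \<Rightarrow> complex"
  where "kern_deriv z v = cnj v * of_real (kern_mod ((norm z)\<^sup>2))
    + cnj z * of_real (kern_mod' ((norm z)\<^sup>2) * (2 * (z \<bullet> v)))"

text \<open>The image of \<open>kern\<close> under \<open>\<partial>\<^sub>x + \<i> \<partial>\<^sub>y\<close>: nonnegative and supported in the unit disc, it serves as the
  smoothing kernel.\<close>
definition dbar_kern :: "complex \<Rightarrow> real" where "dbar_kern z = 4 * max 0 (1 - (norm z)\<^sup>2)"

lemma kern_has_derivative: "(kern has_derivative kern_deriv z) (at z)"
proof -
  have "((\<lambda>z. (norm z)\<^sup>2) has_derivative (\<lambda>v. 2 * (z \<bullet> v))) (at z)"
    unfolding power2_norm_eq_inner
    by (rule derivative_eq_intros refl)+ (auto simp: inner_commute)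
  from has_derivative_compose[OF this kern_mod_has_derivative[unfolded has_field_derivative_def]]
  have "((\<lambda>z. kern_mod ((norm z)\<^sup>2)) has_derivative (\<lambda>v. kern_mod' ((norm z)\<^sup>2) * (2 * (z \<bullet> v)))) (at z)" .
  then show ?thesis unfolding kern_def[abs_def] kern_deriv_def[abs_def]
    by - (rule derivative_eq_intros refl | assumption | (simp add: fun_eq_iff add.commute; fail))+
qed

lemma dbar_kern_eq: "of_real (dbar_kern z) = kern_deriv z 1 + \<i> * kern_deriv z \<i>"
proof -
  let ?t = "(norm z)\<^sup>2"
  have t: "cnj z * z = of_real ?t" by (metis complex_norm_square mult.commute of_real_power)
  have "kern_deriv z 1 + \<i> * kern_deriv z \<i> =
      2 * of_real (kern_mod ?t) + cnj z * of_real (2 * kern_mod' ?t) * (of_real (z \<bullet> 1) + \<i> * of_real (z \<bullet> \<i>))"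
    by (simp add: kern_deriv_def algebra_simps)
  also have "of_real (z \<bullet> 1) + \<i> * of_real (z \<bullet> \<i>) = z"
    by (simp add: inner_complex_def complex_eq_iff)
  also have "2 * of_real (kern_mod ?t) + cnj z * of_real (2 * kern_mod' ?t) * z =
      of_real (2 * kern_mod ?t + 2 * kern_mod' ?t * ?t)"
    using t by (simp add: mult.assoc mult.commute mult.left_commute)
  also have "2 * kern_mod ?t + 2 * kern_mod' ?t * ?t = dbar_kern z"
    by (cases "?t \<le> 1") (auto simp: kern_mod_def kern_mod'_def dbar_kern_def max_def power2_eq_square field_simps)
  finally show ?thesis by simp
qed

lemma kern_far: "norm z \<ge> 1 \<Longrightarrow> kern z = 1 / z" "norm z \<ge> 1 \<Longrightarrow> dbar_kern z = 0"
proof -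
  assume z: "norm z \<ge> 1"
  then have z2: "(norm z)\<^sup>2 \<ge> 1" by (simp add: one_le_power)
  then have "kern z = cnj z / (of_real (norm z))\<^sup>2" by (simp add: kern_def kern_mod_def)
  also have "\<dots> = 1 / z" using z complex_norm_square[of z] by (auto simp: divide_simps mult.commute)
  finally show "kern z = 1 / z" .
  show "dbar_kern z = 0" using z2 by (simp add: dbar_kern_def)
qed

lemma kern_bound: "norm (kern z) \<le> 2" "0 \<le> dbar_kern z" "dbar_kern z \<le> 4"
proof -
  show "norm (kern z) \<le> 2"
  proof (cases "norm z \<ge> 1")
    case True
    then have "norm (kern z) \<le> 1" unfolding kern_far(1)[OF True] using True by (simp add: norm_divide inverse_le_1_iff divide_le_eq)
    then show ?thesis by simp
  next
    case False
    then have "(norm z)\<^sup>2 \<le> 1" by (simp add: power_le_one)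
    then have "\<bar>kern_mod ((norm z)\<^sup>2)\<bar> \<le> 2" by (simp add: kern_mod_def)
    then have "norm z * \<bar>kern_mod ((norm z)\<^sup>2)\<bar> \<le> 1 * 2" using False by (intro mult_mono) auto
    then show ?thesis by (simp add: kern_def norm_mult)
  qed
qed (auto simp: dbar_kern_def)

lemma continuous_on_kern: "continuous_on A kern"
  unfolding kern_def[abs_def] kern_mod_def by (intro continuous_intros) auto

lemma continuous_on_kern_deriv: "continuous_on A (\<lambda>z. kern_deriv z v)"
  unfolding kern_deriv_def[abs_def] kern_mod_def kern_mod'_def by (intro continuous_intros) auto

lemma continuous_on_dbar_kern: "continuous_on A dbar_kern"
  unfolding dbar_kern_def[abs_def] by (intro continuous_intros)

section \<open>Integrals of compactly supported functions\<close>

lemma integrable_compact_support: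
  fixes F :: "complex \<Rightarrow> complex"
  assumes "continuous_on UNIV F" "\<And>\<zeta>. norm \<zeta> > R \<Longrightarrow> F \<zeta> = 0"
  shows "integrable lborel F"
proof -
  have "integrable lborel (\<lambda>x. indicator (cball 0 R) x *\<^sub>R F x)"
    by (intro borel_integrable_compact continuous_on_subset[OF assms(1)]) auto
  moreover have "(\<lambda>x. indicator (cball 0 R) x *\<^sub>R F x) = F"
    using assms(2) by (auto simp: indicator_def fun_eq_iff)
  ultimately show ?thesis by simp
qed

lemma norm_integral_compact_support_le:
  fixes F :: "complex \<Rightarrow> complex"
  assumes "continuous_on UNIV F" "R \<ge> 0" "\<And>\<zeta>. norm \<zeta> > R \<Longrightarrow> F \<zeta> = 0"
    and "\<And>\<zeta>. norm \<zeta> \<le> R \<Longrightarrow> norm (F \<zeta>) \<le> B"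
  shows "norm (\<integral>\<zeta>. F \<zeta> \<partial>lborel) \<le> B * (pi * R\<^sup>2)"
proof -
  have m: "measure lborel (cball 0 R :: complex set) = pi * R\<^sup>2"
    using content_cball[OF assms(2), of "0 :: complex"] by (simp add: unit_ball_vol_2)
  have "norm (\<integral>\<zeta>. F \<zeta> \<partial>lborel) \<le> (\<integral>\<zeta>. norm (F \<zeta>) \<partial>lborel)"
    by (rule integral_norm_bound)
  also have "\<dots> \<le> (\<integral>\<zeta>. indicator (cball (0 :: complex) R) \<zeta> * B \<partial>lborel)"
  proof (rule integral_mono)
    show "integrable lborel (\<lambda>\<zeta>. norm (F \<zeta>))"
      using assms by (intro integrable_norm integrable_compact_support)
    show "integrable lborel (\<lambda>\<zeta>::complex. indicator (cball 0 R) \<zeta> * B)"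
      by (intro integrable_mult_left) (auto intro!: emeasure_compact_finite)
    show "norm (F \<zeta>) \<le> indicator (cball 0 R) \<zeta> * B" for \<zeta>
      using assms(3,4)[of \<zeta>] by (cases "norm \<zeta> \<le> R") auto
  qed
  also have "\<dots> = B * (pi * R\<^sup>2)" using m by simp
  finally show ?thesis .
qed

lemma integral_lborel_translate:
  fixes F :: "complex \<Rightarrow> complex"
  assumes "continuous_on UNIV F"
  shows "(\<integral>\<zeta>. F (c + \<zeta>) \<partial>lborel) = (\<integral>\<zeta>. F \<zeta> \<partial>lborel)"
proof -
  have m: "F \<in> borel_measurable borel" using assms by (rule borel_measurable_continuous_onI)
  have "(\<integral>\<zeta>. F \<zeta> \<partial>lborel) = (\<integral>\<zeta>. F \<zeta> \<partial>distr lborel borel ((+) c))" by (simp only: lborel_distr_plus)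
  also have "\<dots> = (\<integral>\<zeta>. F (c + \<zeta>) \<partial>lborel)" by (rule integral_distr) (use m in auto)
  finally show ?thesis by simp
qed

text \<open>By translation invariance the difference quotients \<open>(F (\<zeta> + t v) - F \<zeta>) / t\<close> have integral 0, and
  they converge boundedly, with supports in a fixed disc, to the derivative.\<close>
lemma integral_derivative_compact_support:
  fixes F :: "complex \<Rightarrow> complex"
  assumes der: "\<And>\<zeta>. (F has_derivative D \<zeta>) (at \<zeta>)"
    and cont: "continuous_on UNIV (\<lambda>\<zeta>. D \<zeta> v)"
    and supp: "\<And>\<zeta>. norm \<zeta> > R \<Longrightarrow> F \<zeta> = 0"
  shows "(\<integral>\<zeta>. D \<zeta> v \<partial>lborel) = 0"
proof -
  have contF: "continuous_on UNIV F"
    using der has_derivative_continuous continuous_at_imp_continuous_on by blast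
  have D0: "D \<zeta> v = 0" if "norm \<zeta> > R" for \<zeta>
  proof -
    have "((\<lambda>_. 0) has_derivative D \<zeta>) (at \<zeta>)"
      by (rule has_derivative_transform_within_open[OF der, of "- cball 0 R"]) (use that supp in auto)
    then have "D \<zeta> = (\<lambda>_. 0)" using has_derivative_unique has_derivative_const by blast
    then show ?thesis by simp
  qed
  obtain B where B: "\<And>\<zeta>. norm (D \<zeta> v) \<le> B" "B \<ge> 0"
  proof -
    have "compact ((\<lambda>\<zeta>. D \<zeta> v) ` cball 0 R)"
      by (intro compact_continuous_image continuous_on_subset[OF cont]) auto
    then obtain B where B: "B > 0" "\<And>\<zeta>. \<zeta> \<in> cball 0 R \<Longrightarrow> norm (D \<zeta> v) \<le> B"
      using compact_imp_bounded bounded_pos by (metis imageI)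
    show ?thesis
    proof (rule that)
      show "norm (D \<zeta> v) \<le> B" for \<zeta> using B D0[of \<zeta>] by (cases "norm \<zeta> \<le> R") auto
    qed (use B(1) in simp)
  qed
  have lip: "norm (F (\<zeta> + t *\<^sub>R v) - F \<zeta>) \<le> B * t" if "t \<ge> 0" for t \<zeta>
  proof -
    have "norm (F (\<zeta> + t *\<^sub>R v) - F (\<zeta> + 0 *\<^sub>R v)) \<le> B * norm (t - 0)"
    proof (rule differentiable_bound[of UNIV "\<lambda>x. F (\<zeta> + x *\<^sub>R v)" "\<lambda>x h. h *\<^sub>R D (\<zeta> + x *\<^sub>R v) v"])
      fix x :: real
      have "((\<lambda>x. \<zeta> + x *\<^sub>R v) has_derivative (\<lambda>h. h *\<^sub>R v)) (at x)"
        by (auto intro!: derivative_eq_intros)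
      from has_derivative_compose[OF this der]
      have "((\<lambda>x. F (\<zeta> + x *\<^sub>R v)) has_derivative (\<lambda>h. D (\<zeta> + x *\<^sub>R v) (h *\<^sub>R v))) (at x)" .
      moreover have "D (\<zeta> + x *\<^sub>R v) (h *\<^sub>R v) = h *\<^sub>R D (\<zeta> + x *\<^sub>R v) v" for h
        using der by (intro linear_scale has_derivative_linear)
      ultimately show "((\<lambda>x. F (\<zeta> + x *\<^sub>R v)) has_derivative (\<lambda>h. h *\<^sub>R D (\<zeta> + x *\<^sub>R v) v)) (at x within UNIV)"
        by simp
      show "onorm (\<lambda>h. h *\<^sub>R D (\<zeta> + x *\<^sub>R v) v) \<le> B"
        by (rule onorm_le) (use B in \<open>auto simp: mult.commute[of B] intro!: mult_left_mono\<close>)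
    qed auto
    then show ?thesis using that by simp
  qed
  define t where "t n = 1 / real (Suc n)" for n
  define s where "s n \<zeta> = (1 / t n) *\<^sub>R (F (t n *\<^sub>R v + \<zeta>) - F \<zeta>)" for n \<zeta>
  have t: "t n > 0" "t n \<le> 1" for n by (auto simp: t_def)
  have int0: "(\<integral>\<zeta>. s n \<zeta> \<partial>lborel) = 0" for n
  proof -
    have i1: "integrable lborel F" by (rule integrable_compact_support[OF contF supp])
    have i2: "integrable lborel (\<lambda>\<zeta>. F (t n *\<^sub>R v + \<zeta>))"
    proof (rule integrable_compact_support[where R = "R + norm v"])
      show "continuous_on UNIV (\<lambda>\<zeta>. F (t n *\<^sub>R v + \<zeta>))"
        by (intro continuous_on_compose2[OF contF] continuous_intros) auto
      fix \<zeta> :: complex assume "norm \<zeta> > R + norm v"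
      moreover have "norm (t n *\<^sub>R v) \<le> norm v" using t[of n] by (simp add: mult_left_le_one_le)
      ultimately have "norm (t n *\<^sub>R v + \<zeta>) > R" using norm_triangle_ineq2[of \<zeta> "- (t n *\<^sub>R v)"]
        by (simp add: add.commute)
      then show "F (t n *\<^sub>R v + \<zeta>) = 0" by (rule supp)
    qed
    have "(\<integral>\<zeta>. s n \<zeta> \<partial>lborel) = (1 / t n) *\<^sub>R ((\<integral>\<zeta>. F (t n *\<^sub>R v + \<zeta>) \<partial>lborel) - (\<integral>\<zeta>. F \<zeta> \<partial>lborel))"
      unfolding s_def by (simp add: Bochner_Integration.integral_diff[OF i2 i1])
    then show ?thesis by (simp add: integral_lborel_translate[OF contF])
  qed
  have "(\<lambda>n. \<integral>\<zeta>. s n \<zeta> \<partial>lborel) \<longlonglongrightarrow> (\<integral>\<zeta>. D \<zeta> v \<partial>lborel)"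
  proof (rule integral_dominated_convergence[where w = "\<lambda>\<zeta>. indicator (cball 0 (R + norm v)) \<zeta> * B"])
    show "(\<lambda>\<zeta>. D \<zeta> v) \<in> borel_measurable lborel"
      using borel_measurable_continuous_onI[OF cont] by simp
    show "s n \<in> borel_measurable lborel" for n
    proof -
      have "continuous_on UNIV (s n)" unfolding s_def[abs_def]
        by (intro continuous_on_compose2[OF contF] continuous_intros) auto
      then show ?thesis using borel_measurable_continuous_onI by simp
    qed
    show "integrable lborel (\<lambda>\<zeta>::complex. indicator (cball 0 (R + norm v)) \<zeta> * B)"
      by (intro integrable_mult_left) (auto intro!: emeasure_compact_finite)
    show "AE \<zeta> in lborel. (\<lambda>n. s n \<zeta>) \<longlonglongrightarrow> D \<zeta> v"
    proof (rule AE_I2)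
      fix \<zeta> :: complex
      have "((\<lambda>x. \<zeta> + x *\<^sub>R v) has_derivative (\<lambda>h. h *\<^sub>R v)) (at 0)"
        by (auto intro!: derivative_eq_intros)
      from has_derivative_compose[OF this der]
      have "((\<lambda>x. F (\<zeta> + x *\<^sub>R v)) has_derivative (\<lambda>h. D \<zeta> (h *\<^sub>R v))) (at 0)" by simp
      moreover have "D \<zeta> (h *\<^sub>R v) = h *\<^sub>R D \<zeta> v" for h
        using der by (intro linear_scale has_derivative_linear)
      ultimately have "((\<lambda>x. F (\<zeta> + x *\<^sub>R v)) has_derivative (\<lambda>h. h *\<^sub>R D \<zeta> v)) (at 0)"
        by simp
      then have "((\<lambda>h. norm (F (\<zeta> + h *\<^sub>R v) - F \<zeta> - h *\<^sub>R D \<zeta> v) / norm h) \<longlongrightarrow> 0) (at 0)"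
        by (simp add: has_derivative_at)
      moreover have "\<forall>\<^sub>F h in at (0::real). norm (F (\<zeta> + h *\<^sub>R v) - F \<zeta> - h *\<^sub>R D \<zeta> v) / norm h =
          norm ((1 / h) *\<^sub>R (F (\<zeta> + h *\<^sub>R v) - F \<zeta>) - D \<zeta> v)"
      proof -
        have "norm (F (\<zeta> + h *\<^sub>R v) - F \<zeta> - h *\<^sub>R D \<zeta> v) / norm h =
          norm ((1 / h) *\<^sub>R (F (\<zeta> + h *\<^sub>R v) - F \<zeta>) - D \<zeta> v)" if "h \<noteq> 0" for h
        proof -
          have "(1 / h) *\<^sub>R (F (\<zeta> + h *\<^sub>R v) - F \<zeta>) - D \<zeta> v =
              (1 / h) *\<^sub>R (F (\<zeta> + h *\<^sub>R v) - F \<zeta> - h *\<^sub>R D \<zeta> v)"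
            using that by (simp add: scaleR_diff_right)
          then show ?thesis by (simp only: norm_scaleR) (simp add: divide_inverse)
        qed
        then show ?thesis by (auto simp: eventually_at intro: exI[of _ 1])
      qed
      ultimately have "((\<lambda>h. norm ((1 / h) *\<^sub>R (F (\<zeta> + h *\<^sub>R v) - F \<zeta>) - D \<zeta> v)) \<longlongrightarrow> 0) (at 0)"
        by (rule Lim_transform_eventually)
      then have quot: "((\<lambda>h. (1 / h) *\<^sub>R (F (\<zeta> + h *\<^sub>R v) - F \<zeta>)) \<longlongrightarrow> D \<zeta> v) (at 0)"
        by (rule LIM_zero_cancel[OF tendsto_norm_zero_cancel])
      have "t \<longlonglongrightarrow> 0" unfolding t_def[abs_def] using LIMSEQ_Suc[OF lim_1_over_n] by simp
      then have "filterlim t (at 0) sequentially"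
        unfolding filterlim_at using t(1) by (auto intro!: always_eventually simp: less_imp_neq[symmetric])
      from filterlim_compose[OF quot this] show "(\<lambda>n. s n \<zeta>) \<longlonglongrightarrow> D \<zeta> v"
        unfolding s_def by (simp add: add.commute)
    qed
    show "AE \<zeta> in lborel. norm (s n \<zeta>) \<le> indicator (cball 0 (R + norm v)) \<zeta> * B" for n
    proof (rule AE_I2)
      fix \<zeta> :: complex
      show "norm (s n \<zeta>) \<le> indicator (cball 0 (R + norm v)) \<zeta> * B"
      proof (cases "norm \<zeta> \<le> R + norm v")
        case True
        have "norm (F (t n *\<^sub>R v + \<zeta>) - F \<zeta>) \<le> B * t n"
          using lip[of "t n" \<zeta>] t[of n] by (simp add: add.commute)
        then show ?thesis using True t(1)[of n] by (simp add: s_def divide_le_eq)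
      next
        case False
        have "norm (t n *\<^sub>R v) \<le> norm v" using t[of n] by (simp add: mult_left_le_one_le)
        then have "norm (t n *\<^sub>R v + \<zeta>) > R"
          using norm_triangle_ineq2[of \<zeta> "- (t n *\<^sub>R v)"] False by (simp add: add.commute)
        moreover have "norm \<zeta> > R" using False norm_ge_zero[of v] by linarith
        ultimately show ?thesis using False by (simp add: s_def supp)
      qed
    qed
  qed
  then show ?thesis by (simp add: int0 LIMSEQ_const_iff)
qed


section \<open>Localization\<close>

text \<open>Wherever \<open>f\<close> is holomorphic this is the image of \<open>- f \<zeta> * bump \<zeta> * kern (z - \<zeta>)\<close> under \<open>\<partial>\<^sub>x + \<i> \<partial>\<^sub>y\<close> in
  the variable \<open>\<zeta>\<close>. It contains no derivative of \<open>f\<close>, so it makes sense for continuous \<open>f\<close>.\<close>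
definition localization_integrand :: "(complex \<Rightarrow> complex) \<Rightarrow> complex \<Rightarrow> complex \<Rightarrow> complex"
  where "localization_integrand f z \<zeta> =
    f \<zeta> * (of_real (bump \<zeta> * dbar_kern (z - \<zeta>)) - dbar_bump \<zeta> * kern (z - \<zeta>))"

text \<open>A smoothed form of Vitushkin's localization operator for the cell at the origin: the part of \<open>f\<close>
  whose d-bar derivative is supported near the cell. Other cells are reached by translating \<open>f\<close>.\<close>
definition localization :: "(complex \<Rightarrow> complex) \<Rightarrow> complex \<Rightarrow> complex"
  where "localization f z = (\<integral>\<zeta>. localization_integrand f z \<zeta> \<partial>lborel)"

lemma continuous_on_compose_UNIV:
  "continuous_on UNIV F \<Longrightarrow> continuous_on A g \<Longrightarrow> continuous_on A (\<lambda>x. F (g x))"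
  by (rule continuous_on_compose2) auto

lemma continuous_on_localization_integrand:
  assumes "continuous_on UNIV f" shows "continuous_on UNIV (localization_integrand f z)"
  unfolding localization_integrand_def[abs_def]
  by (intro continuous_intros assms continuous_on_bump continuous_on_dbar_bump
      continuous_on_compose_UNIV[OF continuous_on_kern] continuous_on_compose_UNIV[OF continuous_on_dbar_kern])

lemma localization_integrand_support: "norm \<zeta> \<ge> 2 \<Longrightarrow> localization_integrand f z \<zeta> = 0"
  by (simp add: localization_integrand_def bump_eq_0)

lemma integrable_localization_integrand:
  "continuous_on UNIV f \<Longrightarrow> integrable lborel (localization_integrand f z)"
  by (rule integrable_compact_support[where R = 2])
    (auto intro: continuous_on_localization_integrand localization_integrand_support)

lemma localization_diff:
  assumes "continuous_on UNIV f" "continuous_on UNIV g"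
  shows "localization (\<lambda>\<zeta>. f \<zeta> - g \<zeta>) z = localization f z - localization g z"
proof -
  have "localization_integrand (\<lambda>\<zeta>. f \<zeta> - g \<zeta>) z \<zeta> = localization_integrand f z \<zeta> - localization_integrand g z \<zeta>" for \<zeta>
    by (simp add: localization_integrand_def left_diff_distrib)
  then have "localization_integrand (\<lambda>\<zeta>. f \<zeta> - g \<zeta>) z =
      (\<lambda>\<zeta>. localization_integrand f z \<zeta> - localization_integrand g z \<zeta>)" by (rule ext)
  then show ?thesis unfolding localization_def
    by (simp add: Bochner_Integration.integral_diff integrable_localization_integrand assms)
qed

text \<open>Near the cell the integrand is the image of a compactly supported \<open>C\<^sup>1\<close> function under \<open>\<partial>\<^sub>x + \<i> \<partial>\<^sub>y\<close>,
  since that operator kills \<open>f\<close>; so its integral is 0.\<close>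
lemma localization_holomorphic:
  assumes U: "open U" "cball 0 2 \<subseteq> U" and f: "f holomorphic_on U"
  shows "localization f z = 0"
proof -
  define f0 where "f0 \<zeta> = (if \<zeta> \<in> U then f \<zeta> else 0)" for \<zeta>
  define f1 where "f1 \<zeta> = (if \<zeta> \<in> U then deriv f \<zeta> else 0)" for \<zeta>
  define F where "F \<zeta> = f0 \<zeta> * (of_real (bump \<zeta>) * kern (z - \<zeta>))" for \<zeta>
  define D where "D \<zeta> v = f1 \<zeta> * v * (of_real (bump \<zeta>) * kern (z - \<zeta>)) +
     f0 \<zeta> * (of_real (bump_deriv \<zeta> v) * kern (z - \<zeta>) - of_real (bump \<zeta>) * kern_deriv (z - \<zeta>) v)" for \<zeta> v
  have out: "2 \<le> norm \<zeta>" if "\<zeta> \<notin> U" for \<zeta> using that U(2) by force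
  have F_supp: "F \<zeta> = 0" if "norm \<zeta> \<ge> 2" for \<zeta> using that by (simp add: F_def bump_eq_0)
  have D_supp: "D \<zeta> v = 0" if "norm \<zeta> \<ge> 2" for \<zeta> v using that by (simp add: D_def bump_eq_0)
  have lin: "bounded_linear (kern_deriv w)" for w using kern_has_derivative by (rule has_derivative_bounded_linear)
  have der: "(F has_derivative D \<zeta>) (at \<zeta>)" for \<zeta>
  proof (cases "\<zeta> \<in> U")
    case True
    have "(f has_derivative (\<lambda>v. deriv f \<zeta> * v)) (at \<zeta>)"
      using holomorphic_derivI[OF f U(1) True] by (simp add: has_field_derivative_def)
    moreover have "((\<lambda>\<zeta>. of_real (bump \<zeta>) :: complex) has_derivative (\<lambda>v. of_real (bump_deriv \<zeta> v))) (at \<zeta>)"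
      by (rule has_derivative_of_real[OF bump_has_derivative])
    moreover have "((\<lambda>\<zeta>. kern (z - \<zeta>)) has_derivative (\<lambda>v. kern_deriv (z - \<zeta>) (- v))) (at \<zeta>)"
    proof -
      have "((\<lambda>\<zeta>. z - \<zeta>) has_derivative (\<lambda>v. - v)) (at \<zeta>)" by (auto intro!: derivative_eq_intros)
      from has_derivative_compose[OF this kern_has_derivative] show ?thesis .
    qed
    ultimately have "((\<lambda>\<zeta>. f \<zeta> * (of_real (bump \<zeta>) * kern (z - \<zeta>))) has_derivative
      (\<lambda>v. f \<zeta> * (of_real (bump \<zeta>) * kern_deriv (z - \<zeta>) (- v) + of_real (bump_deriv \<zeta> v) * kern (z - \<zeta>))
        + deriv f \<zeta> * v * (of_real (bump \<zeta>) * kern (z - \<zeta>)))) (at \<zeta>)"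
      by (intro has_derivative_mult)
    moreover have "(\<lambda>v. f \<zeta> * (of_real (bump \<zeta>) * kern_deriv (z - \<zeta>) (- v) + of_real (bump_deriv \<zeta> v) * kern (z - \<zeta>))
        + deriv f \<zeta> * v * (of_real (bump \<zeta>) * kern (z - \<zeta>))) = D \<zeta>"
      using True by (simp add: D_def f0_def f1_def fun_eq_iff linear_simps(4)[OF lin] algebra_simps)
    ultimately have "((\<lambda>\<zeta>. f \<zeta> * (of_real (bump \<zeta>) * kern (z - \<zeta>))) has_derivative D \<zeta>) (at \<zeta>)" by simp
    then show ?thesis
      by (rule has_derivative_transform_within_open[OF _ U(1) True]) (simp add: F_def f0_def)
  next
    case False
    have "D \<zeta> = (\<lambda>_. 0)" using D_supp[OF out[OF False]] by (simp add: fun_eq_iff)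
    moreover have "(F has_derivative (\<lambda>_. 0)) (at \<zeta>)"
    proof (rule has_derivative_transform_within_open[OF has_derivative_const])
      show "open (- cball 0 2 :: complex set)" by auto
      show "\<zeta> \<in> - cball 0 2" using False U(2) by blast
      show "0 = F x" if "x \<in> - cball 0 2" for x using F_supp[of x] that by simp
    qed
    ultimately show ?thesis by simp
  qed
  have cont: "continuous_on UNIV (\<lambda>\<zeta>. D \<zeta> v)" for v
  proof -
    \<comment> \<open>The set \<open>U\<close> and the complement of the closed disc of radius 2, where \<open>D\<close> vanishes, cover the plane.\<close>
    have "continuous_on U (\<lambda>\<zeta>. D \<zeta> v)"
    proof -
      have "continuous_on U f" "continuous_on U (deriv f)"
        using f U(1) by (auto intro: holomorphic_on_imp_continuous_on holomorphic_deriv)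
      then have "continuous_on U (\<lambda>\<zeta>. deriv f \<zeta> * v * (of_real (bump \<zeta>) * kern (z - \<zeta>)) +
         f \<zeta> * (of_real (bump_deriv \<zeta> v) * kern (z - \<zeta>) - of_real (bump \<zeta>) * kern_deriv (z - \<zeta>) v))"
        by (intro continuous_intros continuous_on_bump continuous_on_bump_deriv
          continuous_on_compose_UNIV[OF continuous_on_kern] continuous_on_compose_UNIV[OF continuous_on_kern_deriv])
      then show ?thesis by (rule continuous_on_eq) (simp add: D_def f0_def f1_def)
    qed
    moreover have "continuous_on (- cball 0 2) (\<lambda>\<zeta>. D \<zeta> v)"
      by (rule continuous_on_eq[OF continuous_on_const[of _ 0]]) (simp add: D_supp)
    moreover have "U \<union> - cball 0 2 = UNIV" using U(2) by auto
    ultimately show ?thesis using continuous_on_open_Un[OF U(1), of "- cball 0 2"] by auto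
  qed
  have int: "(\<integral>\<zeta>. D \<zeta> v \<partial>lborel) = 0" "integrable lborel (\<lambda>\<zeta>. D \<zeta> v)" for v
    using integral_derivative_compact_support[OF der cont, of 2 v] F_supp
      integrable_compact_support[OF cont, of 2 v] D_supp by auto
  have "localization_integrand f z \<zeta> = - (D \<zeta> 1 + \<i> * D \<zeta> \<i>)" for \<zeta>
  proof (cases "\<zeta> \<in> U")
    case True
    have "D \<zeta> 1 + \<i> * D \<zeta> \<i> = f \<zeta> * ((of_real (bump_deriv \<zeta> 1) + \<i> * of_real (bump_deriv \<zeta> \<i>)) * kern (z - \<zeta>)
      - of_real (bump \<zeta>) * (kern_deriv (z - \<zeta>) 1 + \<i> * kern_deriv (z - \<zeta>) \<i>))"
      using True by (simp add: D_def f0_def f1_def algebra_simps)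
    then show ?thesis
      by (simp add: localization_integrand_def dbar_bump_eq[symmetric] dbar_kern_eq[symmetric] algebra_simps)
  next
    case False
    then show ?thesis using out[OF False] by (simp add: localization_integrand_support D_supp)
  qed
  then have "localization_integrand f z = (\<lambda>\<zeta>. - (D \<zeta> 1 + \<i> * D \<zeta> \<i>))" by (rule ext)
  then have "localization f z = - ((\<integral>\<zeta>. D \<zeta> 1 \<partial>lborel) + \<i> * (\<integral>\<zeta>. D \<zeta> \<i> \<partial>lborel))"
    unfolding localization_def using int(2) by simp
  then show ?thesis by (simp add: int)
qed

text \<open>Constants are holomorphic. Therefore only the oscillation of \<open>f\<close> on the cell matters.\<close>
lemma localization_minus_const:
  assumes "continuous_on UNIV f"
  shows "localization (\<lambda>\<zeta>. f \<zeta> - c) z = localization f z"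
  using localization_diff[OF assms continuous_on_const[of UNIV c], of z]
    localization_holomorphic[of UNIV "\<lambda>_. c" z] by simp

lemma localization_bound:
  assumes f: "continuous_on UNIV f" and \<omega>: "\<And>\<zeta>. norm \<zeta> \<le> 2 \<Longrightarrow> norm (f \<zeta> - f 0) \<le> \<omega>"
  shows "norm (localization f z) \<le> 12 * \<omega> * (pi * 2\<^sup>2)"
proof -
  have \<omega>0: "\<omega> \<ge> 0" using \<omega>[of 0] by simp
  have "norm (localization (\<lambda>\<zeta>. f \<zeta> - f 0) z) \<le> 12 * \<omega> * (pi * 2\<^sup>2)"
    unfolding localization_def
  proof (rule norm_integral_compact_support_le)
    show "continuous_on UNIV (localization_integrand (\<lambda>\<zeta>. f \<zeta> - f 0) z)"
      by (intro continuous_on_localization_integrand continuous_intros f)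
    fix \<zeta> :: complex assume "norm \<zeta> \<le> 2"
    have "norm (of_real (bump \<zeta> * dbar_kern (z - \<zeta>)) - dbar_bump \<zeta> * kern (z - \<zeta>))
        \<le> \<bar>bump \<zeta>\<bar> * dbar_kern (z - \<zeta>) + norm (dbar_bump \<zeta>) * norm (kern (z - \<zeta>))"
      by (rule order_trans[OF norm_triangle_ineq4])
        (use kern_bound(2)[of "z - \<zeta>"] in \<open>simp add: norm_mult abs_mult\<close>)
    also have "\<dots> \<le> 1 * 4 + 4 * 2"
      by (intro add_mono mult_mono bump_bound kern_bound) auto
    finally have "norm (f \<zeta> - f 0) * norm (of_real (bump \<zeta> * dbar_kern (z - \<zeta>)) - dbar_bump \<zeta> * kern (z - \<zeta>)) \<le> \<omega> * 12"
      using \<omega>[OF \<open>norm \<zeta> \<le> 2\<close>] \<omega>0 by (intro mult_mono) auto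
    then show "norm (localization_integrand (\<lambda>\<zeta>. f \<zeta> - f 0) z \<zeta>) \<le> 12 * \<omega>"
      by (simp add: localization_integrand_def norm_mult)
  qed (auto simp: localization_integrand_support)
  then show ?thesis using localization_minus_const[OF f] by simp
qed

lemma cauchy_kernel_remainder:
  fixes z :: complex
  assumes "z \<noteq> b" "z \<noteq> \<zeta>"
  shows "1 / (z - \<zeta>) = (1 / (z - b) + (\<zeta> - b) * (1 / (z - b))\<^sup>2) + (\<zeta> - b)\<^sup>2 * (1 / (z - b))\<^sup>2 * (1 / (z - \<zeta>))"
proof -
  have "X + d * X\<^sup>2 + d\<^sup>2 * X\<^sup>2 * Y = Y" if "X * x = 1" "Y * (x - d) = 1" for X Y x d :: complex
  proof -
    have "Y = Y * (X * x)\<^sup>2" by (simp add: that)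
    also have "\<dots> = X\<^sup>2 * (Y * (x - d) * (x + d)) + d\<^sup>2 * X\<^sup>2 * Y"
      by (simp add: algebra_simps power2_eq_square)
    also have "X\<^sup>2 * (Y * (x - d) * (x + d)) = X * (X * x) + d * X\<^sup>2" 
      unfolding that(2) by (simp add: algebra_simps power2_eq_square)
    finally show ?thesis by (simp add: that)
  qed
  from this[of "1 / (z - b)" "z - b" "1 / (z - \<zeta>)" "\<zeta> - b"] show ?thesis using assms by simp
qed

text \<open>For \<open>\<bar>z\<bar> \<ge> 3\<close> the smoothing term vanishes on the cell and the kernel is the true Cauchy kernel, so
  the localization is the Cauchy transform of \<open>\<psi> = - (f - f 0) * dbar_bump\<close>, and \<open>m0\<close>, \<open>m1\<close> are its
  first two moments about \<open>b\<close>. Centring the expansion at \<open>b\<close> instead of the origin prepares the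
  comparison with the functions of the path ending in \<open>b\<close>.\<close>
lemma localization_far:
  assumes f: "continuous_on UNIV f" and \<omega>: "\<And>\<zeta>. norm \<zeta> \<le> 2 \<Longrightarrow> norm (f \<zeta> - f 0) \<le> \<omega>"
    and b: "norm b \<le> 3"
  shows "\<exists>m0 m1. norm m0 \<le> 4 * \<omega> * (pi * 2\<^sup>2) \<and> norm m1 \<le> 20 * \<omega> * (pi * 2\<^sup>2) \<and>
    (\<forall>z. norm z \<ge> 8 \<longrightarrow> norm (localization f z - (m0 * (1 / (z - b)) + m1 * (1 / (z - b))\<^sup>2))
      \<le> 200 * \<omega> * (1 / norm (z - b)) ^ 3 * (pi * 2\<^sup>2))"
proof -
  have \<omega>0: "\<omega> \<ge> 0" using \<omega>[of 0] by simp
  define \<psi> where "\<psi> \<zeta> = - ((f \<zeta> - f 0) * dbar_bump \<zeta>)" for \<zeta>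
  have \<psi>_cont: "continuous_on UNIV \<psi>" unfolding \<psi>_def[abs_def]
    by (intro continuous_intros f continuous_on_dbar_bump)
  have \<psi>_supp: "\<psi> \<zeta> = 0" if "norm \<zeta> \<ge> 2" for \<zeta> using that by (simp add: \<psi>_def bump_eq_0)
  have \<psi>_bound: "norm (\<psi> \<zeta>) \<le> 4 * \<omega>" if "norm \<zeta> \<le> 2" for \<zeta>
  proof -
    have "norm (f \<zeta> - f 0) * norm (dbar_bump \<zeta>) \<le> \<omega> * 4"
      using \<omega>[OF that] \<omega>0 by (intro mult_mono bump_bound) auto
    then show ?thesis by (simp add: \<psi>_def norm_mult)
  qed
  have d: "norm (\<zeta> - b) \<le> 5" if "norm \<zeta> \<le> 2" for \<zeta> using norm_triangle_ineq4[of \<zeta> b] that b by linarith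
  define m0 where "m0 = (\<integral>\<zeta>. \<psi> \<zeta> \<partial>lborel)"
  define m1 where "m1 = (\<integral>\<zeta>. \<psi> \<zeta> * (\<zeta> - b) \<partial>lborel)"
  have c1: "continuous_on UNIV (\<lambda>\<zeta>. \<psi> \<zeta> * (\<zeta> - b))" by (intro continuous_intros \<psi>_cont)
  have i0: "integrable lborel \<psi>" "integrable lborel (\<lambda>\<zeta>. \<psi> \<zeta> * (\<zeta> - b))"
    by (rule integrable_compact_support[of _ 2]; use \<psi>_cont c1 \<psi>_supp in auto)+
  have "norm m0 \<le> 4 * \<omega> * (pi * 2\<^sup>2)" unfolding m0_def
    by (rule norm_integral_compact_support_le[OF \<psi>_cont]) (use \<psi>_supp \<psi>_bound in auto)
  moreover have "norm m1 \<le> 20 * \<omega> * (pi * 2\<^sup>2)" unfolding m1_def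
  proof (rule norm_integral_compact_support_le[OF c1])
    fix \<zeta> :: complex assume \<zeta>: "norm \<zeta> \<le> 2"
    have "norm (\<psi> \<zeta>) * norm (\<zeta> - b) \<le> (4 * \<omega>) * 5"
      using \<psi>_bound[OF \<zeta>] d[OF \<zeta>] \<omega>0 by (intro mult_mono) auto
    then show "norm (\<psi> \<zeta> * (\<zeta> - b)) \<le> 20 * \<omega>" by (simp add: norm_mult)
  qed (use \<psi>_supp in auto)
  moreover have "norm (localization f z - (m0 * (1 / (z - b)) + m1 * (1 / (z - b))\<^sup>2))
      \<le> 200 * \<omega> * (1 / norm (z - b)) ^ 3 * (pi * 2\<^sup>2)" if z: "norm z \<ge> 8" for z
  proof -
    define X where "X = 1 / (z - b)"
    have zb: "norm (z - b) \<ge> 5" "norm (z - b) \<le> norm z + 3"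
      using norm_triangle_ineq2[of z b] norm_triangle_ineq4[of z b] b z by linarith+
    have z\<zeta>: "norm (z - \<zeta>) \<ge> norm (z - b) / 2" "norm (z - \<zeta>) \<ge> 6" if "norm \<zeta> \<le> 2" for \<zeta>
      using norm_triangle_ineq2[of z \<zeta>] that zb z by linarith+
    have ne: "z \<noteq> b" using zb by auto
    let ?L = "localization_integrand (\<lambda>\<zeta>. f \<zeta> - f 0) z"
    have L: "?L \<zeta> = \<psi> \<zeta> * (1 / (z - \<zeta>))" if "norm \<zeta> \<le> 2" for \<zeta>
    proof -
      have "norm (z - \<zeta>) \<ge> 1" using z\<zeta>(2)[OF that] by simp
      then show ?thesis by (simp add: localization_integrand_def \<psi>_def kern_far)
    qed
    have Lc: "continuous_on UNIV ?L" by (intro continuous_on_localization_integrand continuous_intros f)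
    have Li: "integrable lborel ?L" by (intro integrable_localization_integrand continuous_intros f)
    define E where "E \<zeta> = ?L \<zeta> - (X * \<psi> \<zeta> + X\<^sup>2 * (\<psi> \<zeta> * (\<zeta> - b)))" for \<zeta>
    have "localization f z - (m0 * X + m1 * X\<^sup>2) = (\<integral>\<zeta>. E \<zeta> \<partial>lborel)"
    proof -
      have "localization f z = (\<integral>\<zeta>. ?L \<zeta> \<partial>lborel)"
        using localization_minus_const[OF f, of "f 0" z] by (simp add: localization_def)
      moreover have "m0 * X + m1 * X\<^sup>2 = (\<integral>\<zeta>. X * \<psi> \<zeta> + X\<^sup>2 * (\<psi> \<zeta> * (\<zeta> - b)) \<partial>lborel)"
        using i0 by (simp add: m0_def m1_def mult.commute)
      ultimately show ?thesis unfolding E_def using i0 Li by (simp add: Bochner_Integration.integral_diff)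
    qed
    moreover have "norm (\<integral>\<zeta>. E \<zeta> \<partial>lborel) \<le> 200 * \<omega> * (1 / norm (z - b)) ^ 3 * (pi * 2\<^sup>2)"
    proof (rule norm_integral_compact_support_le)
      show "continuous_on UNIV E" unfolding E_def[abs_def] by (intro continuous_intros Lc \<psi>_cont)
      show "E \<zeta> = 0" if "norm \<zeta> > 2" for \<zeta>
        using that by (simp add: E_def \<psi>_supp localization_integrand_support)
      fix \<zeta> :: complex assume \<zeta>: "norm \<zeta> \<le> 2"
      have "z \<noteq> \<zeta>" using z\<zeta>(2)[OF \<zeta>] by auto
      have "E \<zeta> = \<psi> \<zeta> * (1 / (z - \<zeta>) - (X + (\<zeta> - b) * X\<^sup>2))"
        unfolding E_def L[OF \<zeta>] by (simp only: algebra_simps)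
      also have "\<dots> = \<psi> \<zeta> * ((\<zeta> - b)\<^sup>2 * X\<^sup>2 * (1 / (z - \<zeta>)))"
        using cauchy_kernel_remainder[OF ne \<open>z \<noteq> \<zeta>\<close>] unfolding X_def by (metis add_diff_cancel_left')
      also have "norm \<dots> = norm (\<psi> \<zeta>) * (norm (\<zeta> - b) ^ 2 * norm X ^ 2 * (1 / norm (z - \<zeta>)))"
        by (simp add: norm_mult norm_power norm_divide)
      also have "\<dots> \<le> (4 * \<omega>) * (5 ^ 2 * norm X ^ 2 * (2 * norm X))"
      proof (intro mult_mono power_mono)
        have "1 / norm (z - \<zeta>) \<le> 1 / (norm (z - b) / 2)"
          using z\<zeta>(1)[OF \<zeta>] zb by (intro divide_left_mono mult_pos_pos) auto
        then show "1 / norm (z - \<zeta>) \<le> 2 * norm X" by (simp add: X_def norm_divide)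
      qed (use \<psi>_bound[OF \<zeta>] d[OF \<zeta>] \<omega>0 in auto)
      also have "\<dots> = 200 * \<omega> * (1 / norm (z - b)) ^ 3"
        by (simp add: X_def norm_divide power3_eq_cube power2_eq_square)
      finally show "norm (E \<zeta>) \<le> 200 * \<omega> * (1 / norm (z - b)) ^ 3" .
    qed simp
    ultimately show ?thesis by (simp add: X_def)
  qed
  ultimately show ?thesis by blast
qed

text \<open>Here \<open>Q\<close> stands for the value at \<open>z\<close> of the bounded function attached to the path. As
  \<open>Q = X - (b - a) / 2 * X\<^sup>2 + O(X\<^sup>3)\<close> and \<open>Q\<^sup>2 = X\<^sup>2 + O(X\<^sup>3)\<close> for \<open>X = 1 / (z - b)\<close>, the choice \<open>\<alpha> = m0\<close> and
  \<open>\<beta> = m1 + m0 * (b - a) / 2\<close> cancels the terms in \<open>X\<close> and \<open>X\<^sup>2\<close>. For \<open>\<bar>z\<bar> < 8\<close> the claim only needs the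
  boundedness of all quantities.\<close>
lemma localization_matching:
  assumes f: "continuous_on UNIV f" and \<omega>: "\<And>\<zeta>. norm \<zeta> \<le> 2 \<Longrightarrow> norm (f \<zeta> - f 0) \<le> \<omega>"
    and b: "norm b \<le> 3" and ab: "norm (b - a) = 1"
  shows "\<exists>\<alpha> \<beta>. \<forall>z Q. norm Q \<le> 52 \<longrightarrow>
      norm (Q - (1 / (z - b) - (b - a) / 2 * (1 / (z - b)) ^ 2)) \<le> 1600 * (1 / norm (z - b)) ^ 3 \<longrightarrow>
      norm (localization f z - (\<alpha> * Q + \<beta> * Q\<^sup>2)) \<le> 10 ^ 10 * \<omega> / (1 + norm z) ^ 3"
proof -
  have \<omega>0: "\<omega> \<ge> 0" using \<omega>[of 0] by simp
  obtain m0 m1 where m: "norm m0 \<le> 4 * \<omega> * (pi * 2\<^sup>2)" "norm m1 \<le> 20 * \<omega> * (pi * 2\<^sup>2)"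
    and far: "\<And>z. norm z \<ge> 8 \<Longrightarrow> norm (localization f z - (m0 * (1 / (z - b)) + m1 * (1 / (z - b))\<^sup>2))
      \<le> 200 * \<omega> * (1 / norm (z - b)) ^ 3 * (pi * 2\<^sup>2)"
    using localization_far[OF f \<omega> b] by blast
  define c where "c = (b - a) / 2"
  define V where "V = \<omega> * (pi * 2\<^sup>2)"
  have V: "V \<ge> 0" "V \<le> 16 * \<omega>"
    using \<omega>0 pi_less_4 by (auto simp: V_def mult.commute[of \<omega>] intro!: mult_right_mono)
  have nc: "norm c = 1 / 2" using ab by (simp add: c_def norm_divide)
  define \<beta> where "\<beta> = m1 + m0 * c"
  have n0: "norm m0 \<le> 4 * V" "norm m1 \<le> 20 * V" using m by (simp_all add: V_def mult.assoc)
  have "norm \<beta> \<le> norm m1 + norm m0 * (1 / 2)"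
    unfolding \<beta>_def nc[symmetric] norm_mult[symmetric] by (rule norm_triangle_ineq)
  then have n\<beta>: "norm \<beta> \<le> 22 * V" using n0 by linarith
  have "norm (localization f z - (m0 * Q + \<beta> * Q\<^sup>2)) \<le> 10 ^ 10 * \<omega> / (1 + norm z) ^ 3"
    if Q: "norm Q \<le> 52" "norm (Q - (1 / (z - b) - c * (1 / (z - b)) ^ 2)) \<le> 1600 * (1 / norm (z - b)) ^ 3" for z Q
  proof (cases "norm z \<ge> 8")
    case True
    define X where "X = 1 / (z - b)"
    define x where "x = norm X"
    have "norm (z - b) \<ge> norm z - 3" using norm_triangle_ineq2[of z b] b by linarith
    then have zb: "norm (z - b) \<ge> (1 + norm z) / 2" using True by (simp add: field_simps)
    have zb5: "norm (z - b) > 4" using zb True by (simp add: field_simps)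
    have x: "x = 1 / norm (z - b)" by (simp add: x_def X_def norm_divide)
    have x_le: "x \<le> 2 / (1 + norm z)"
    proof -
      have "1 / norm (z - b) \<le> 1 / ((1 + norm z) / 2)"
        using zb zb5 by (intro divide_left_mono mult_pos_pos) (auto simp: add_pos_nonneg)
      then show ?thesis by (simp add: x)
    qed
    have x1: "x \<le> 1" "x \<ge> 0" using zb5 by (auto simp: x divide_le_eq)
    have e1: "norm (Q - (X - c * X\<^sup>2)) \<le> 1600 * x ^ 3" using Q(2) by (simp add: X_def x)
    have "norm (Q - X) \<le> norm (Q - (X - c * X\<^sup>2)) + norm (c * X\<^sup>2)"
      using norm_triangle_ineq4[of "Q - (X - c * X\<^sup>2)" "c * X\<^sup>2"] by (simp add: algebra_simps)
    also have "norm (c * X\<^sup>2) = 1 / 2 * x\<^sup>2" by (simp add: norm_mult nc norm_power x_def)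
    finally have "norm (Q - X) \<le> norm (Q - (X - c * X\<^sup>2)) + 1 / 2 * x\<^sup>2" .
    moreover have "x ^ 3 \<le> x ^ 2" using x1 by (intro power_decreasing) auto
    moreover have "x\<^sup>2 \<ge> 0" by simp
    ultimately have e2: "norm (Q - X) \<le> 1601 * x\<^sup>2" using e1 by linarith
    have "x\<^sup>2 \<le> x ^ 1" using x1 by (intro power_decreasing) auto
    then have "norm (Q + X) \<le> 1603 * x"
      using norm_triangle_ineq[of "Q - X" "2 * X"] e2 by (simp add: norm_mult x_def add.commute[of Q X])
    then have "norm (Q - X) * norm (Q + X) \<le> (1601 * x\<^sup>2) * (1603 * x)"
      using e2 x1 by (intro mult_mono) auto
    then have e3: "norm (Q\<^sup>2 - X\<^sup>2) \<le> 2566403 * x ^ 3"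
      by (simp add: norm_mult[symmetric] power2_eq_square power3_eq_cube algebra_simps)
    have e4: "norm (localization f z - (m0 * X + m1 * X\<^sup>2)) \<le> 200 * V * x ^ 3"
      using far[OF True] by (simp add: X_def x V_def mult_ac)
    have "localization f z - (m0 * Q + \<beta> * Q\<^sup>2) = (localization f z - (m0 * X + m1 * X\<^sup>2))
        - m0 * (Q - (X - c * X\<^sup>2)) - \<beta> * (Q\<^sup>2 - X\<^sup>2)"
      by (simp add: \<beta>_def algebra_simps)
    also have "norm \<dots> \<le> norm (localization f z - (m0 * X + m1 * X\<^sup>2))
        + norm m0 * norm (Q - (X - c * X\<^sup>2)) + norm \<beta> * norm (Q\<^sup>2 - X\<^sup>2)"
      unfolding norm_mult[symmetric]
      by (rule order_trans[OF norm_triangle_ineq4]) (intro add_right_mono norm_triangle_ineq4)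
    also have "\<dots> \<le> 200 * V * x ^ 3 + (4 * V) * (1600 * x ^ 3) + (22 * V) * (2566403 * x ^ 3)"
      using V x1 by (intro add_mono mult_mono e4 e1 e3 n0 n\<beta>) auto
    also have "\<dots> \<le> (6 * 10 ^ 7 * V) * x ^ 3" using V x1 by (simp add: algebra_simps)
    also have "\<dots> \<le> (6 * 10 ^ 7 * (16 * \<omega>)) * (2 / (1 + norm z)) ^ 3"
      using V x1 x_le \<omega>0 by (intro mult_mono power_mono) auto
    also have "\<dots> = (768 * 10 ^ 7 * \<omega>) / (1 + norm z) ^ 3" by (simp add: power_divide)
    also have "\<dots> \<le> 10 ^ 10 * \<omega> / (1 + norm z) ^ 3" using \<omega>0 by (intro divide_right_mono mult_right_mono) auto
    finally show ?thesis .
  next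
    case False
    have "norm (localization f z) \<le> 12 * V" using localization_bound[OF f \<omega>] by (simp add: V_def mult.assoc)
    moreover have "norm m0 * norm Q \<le> (4 * V) * 52" using n0 Q(1) V by (intro mult_mono) auto
    moreover have "norm \<beta> * norm Q ^ 2 \<le> (22 * V) * 52 ^ 2"
      using n\<beta> Q(1) V by (intro mult_mono power_mono) auto
    moreover have "norm (localization f z - (m0 * Q + \<beta> * Q\<^sup>2)) \<le> norm (localization f z) + (norm m0 * norm Q + norm \<beta> * norm Q ^ 2)"
      unfolding norm_mult[symmetric] norm_power[symmetric]
      by (rule order_trans[OF norm_triangle_ineq4]) (intro add_left_mono norm_triangle_ineq)
    ultimately have "norm (localization f z - (m0 * Q + \<beta> * Q\<^sup>2)) \<le> 10 ^ 5 * V" using V by simp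
    also have "\<dots> \<le> 10 ^ 5 * (16 * \<omega>)" using V by simp
    finally have le: "norm (localization f z - (m0 * Q + \<beta> * Q\<^sup>2)) \<le> 16 * 10 ^ 5 * \<omega>" by simp
    have "(1 + norm z) ^ 3 \<le> 9 ^ 3" using False by (intro power_mono) auto
    then have "16 * 10 ^ 5 * \<omega> * (1 + norm z) ^ 3 \<le> 16 * 10 ^ 5 * \<omega> * 9 ^ 3"
      using \<omega>0 by (intro mult_left_mono) auto
    also have "\<dots> \<le> 10 ^ 10 * \<omega>" using \<omega>0 by simp
    finally have "16 * 10 ^ 5 * \<omega> \<le> 10 ^ 10 * \<omega> / (1 + norm z) ^ 3"
      by (simp add: pos_le_divide_eq add_pos_nonneg)
    then show ?thesis using le by linarith
  qed
  then show ?thesis unfolding c_def by blast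
qed


section \<open>Mergelyan's theorem\<close>

text \<open>On either side of \<open>x\<close> the distances from \<open>x\<close> to the integers are at least \<open>0, 1, 2, \<dots>\<close>.\<close>
lemma inverse_power_sum_over_integers_bounded:
  "\<exists>C>0. \<forall>x A. finite A \<longrightarrow> (\<Sum>m\<in>A. (1 + \<bar>x - real_of_int m\<bar>) powr (- 3 / 2)) \<le> C"
proof -
  define s where "s k = (1 + real k) powr (- 3 / 2)" for k
  have summable: "summable s"
  proof -
    have "summable (\<lambda>n. real n powr (- 3 / 2))" by (simp add: summable_real_powr_iff)
    then have "summable (\<lambda>n. real (Suc n) powr (- 3 / 2))" by (subst summable_Suc_iff)
    then show ?thesis by (simp add: s_def[abs_def] add.commute)
  qed
  have s0: "s k \<ge> 0" for k by (simp add: s_def)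
  have "(\<Sum>m\<in>A. (1 + \<bar>x - real_of_int m\<bar>) powr (- 3 / 2)) \<le> 2 * suminf s" if A: "finite A" for x A
  proof -
    have half: "(\<Sum>m\<in>B. (1 + \<bar>x - real_of_int m\<bar>) powr (- 3 / 2)) \<le> suminf s"
      if B: "finite B" and k: "inj_on k B" "\<And>m. m \<in> B \<Longrightarrow> real (k m) \<le> \<bar>x - real_of_int m\<bar>" for B and k :: "int \<Rightarrow> nat"
    proof -
      have "(\<Sum>m\<in>B. (1 + \<bar>x - real_of_int m\<bar>) powr (- 3 / 2)) \<le> (\<Sum>m\<in>B. s (k m))"
        using k(2) by (intro sum_mono) (auto simp: s_def intro!: powr_mono2')
      also have "\<dots> = (\<Sum>i\<in>k ` B. s i)" using k(1) by (simp add: sum.reindex)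
      also have "\<dots> \<le> suminf s" using B by (intro sum_le_suminf summable s0) auto
      finally show ?thesis .
    qed
    have split: "A = {m\<in>A. m \<le> \<lfloor>x\<rfloor>} \<union> {m\<in>A. m > \<lfloor>x\<rfloor>}" by auto
    have "(\<Sum>m\<in>A. (1 + \<bar>x - real_of_int m\<bar>) powr (- 3 / 2)) =
      (\<Sum>m\<in>{m\<in>A. m \<le> \<lfloor>x\<rfloor>}. (1 + \<bar>x - real_of_int m\<bar>) powr (- 3 / 2)) +
      (\<Sum>m\<in>{m\<in>A. m > \<lfloor>x\<rfloor>}. (1 + \<bar>x - real_of_int m\<bar>) powr (- 3 / 2))"
      by (subst split, rule sum.union_disjoint) (use A in auto)
    also have "\<dots> \<le> suminf s + suminf s"
    proof (rule add_mono)
      show "(\<Sum>m\<in>{m\<in>A. m \<le> \<lfloor>x\<rfloor>}. (1 + \<bar>x - real_of_int m\<bar>) powr (- 3 / 2)) \<le> suminf s"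
      proof (rule half[where k = "\<lambda>m. nat (\<lfloor>x\<rfloor> - m)"])
        fix m assume "m \<in> {m\<in>A. m \<le> \<lfloor>x\<rfloor>}"
        then have "real (nat (\<lfloor>x\<rfloor> - m)) = real_of_int \<lfloor>x\<rfloor> - real_of_int m" by simp
        moreover have "real_of_int \<lfloor>x\<rfloor> \<le> x" by simp
        ultimately show "real (nat (\<lfloor>x\<rfloor> - m)) \<le> \<bar>x - real_of_int m\<bar>" by linarith
      qed (use A in \<open>auto simp: inj_on_def\<close>)
      show "(\<Sum>m\<in>{m\<in>A. m > \<lfloor>x\<rfloor>}. (1 + \<bar>x - real_of_int m\<bar>) powr (- 3 / 2)) \<le> suminf s"
      proof (rule half[where k = "\<lambda>m. nat (m - \<lfloor>x\<rfloor> - 1)"])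
        fix m assume "m \<in> {m\<in>A. m > \<lfloor>x\<rfloor>}"
        then have m: "m > \<lfloor>x\<rfloor>" by simp
        moreover have "x < real_of_int \<lfloor>x\<rfloor> + 1" by simp
        moreover have "real (nat (m - \<lfloor>x\<rfloor> - 1)) = real_of_int m - real_of_int \<lfloor>x\<rfloor> - 1"
          using m by simp
        ultimately show "real (nat (m - \<lfloor>x\<rfloor> - 1)) \<le> \<bar>x - real_of_int m\<bar>" by linarith
      qed (use A in \<open>auto simp: inj_on_def\<close>)
    qed
    finally show ?thesis by simp
  qed
  moreover have "2 * suminf s > 0"
  proof -
    have "s 0 \<le> suminf s" using sum_le_suminf[OF summable, of "{0}"] s0 by simp
    then show ?thesis by (simp add: s_def)
  qed
  ultimately show ?thesis by blast
qed

text \<open>The third power splits as \<open>(1 + \<bar>w\<bar>)\<^sup>3 \<ge> (1 + \<bar>Re w\<bar>)\<^sup>3\<^sup>/\<^sup>2 (1 + \<bar>Im w\<bar>)\<^sup>3\<^sup>/\<^sup>2\<close>, which reduces the bound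
  to two sums over integers. This is why two Laurent coefficients must be matched: a square in
  place of the cube would not be summable.\<close>
lemma lattice_sum_bounded:
  "\<exists>C>0. \<forall>z M. (\<Sum>j\<in>int_grid M. 1 / (1 + norm (z - j)) ^ 3) \<le> C"
proof -
  obtain C where C: "C > 0" "\<And>x A. finite A \<Longrightarrow> (\<Sum>m\<in>A. (1 + \<bar>x - real_of_int m\<bar>) powr (- 3 / 2)) \<le> C"
    using inverse_power_sum_over_integers_bounded by blast
  have term_le: "1 / (1 + norm w) ^ 3 \<le> (1 + \<bar>Re w\<bar>) powr (- 3 / 2) * (1 + \<bar>Im w\<bar>) powr (- 3 / 2)" for w
  proof -
    have "1 / (1 + norm w) ^ 3 = (1 + norm w) powr (- 3)"
      using powr_realpow[of "1 + norm w" 3] by (simp add: powr_minus_divide add_pos_nonneg)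
    also have "\<dots> = (1 + norm w) powr (- 3 / 2) * (1 + norm w) powr (- 3 / 2)"
      by (simp add: powr_add[symmetric])
    also have "\<dots> \<le> (1 + \<bar>Re w\<bar>) powr (- 3 / 2) * (1 + \<bar>Im w\<bar>) powr (- 3 / 2)"
      using abs_Re_le_cmod[of w] abs_Im_le_cmod[of w] by (intro mult_mono powr_mono2') auto
    finally show ?thesis .
  qed
  have "(\<Sum>j\<in>int_grid M. 1 / (1 + norm (z - j)) ^ 3) \<le> C * C" for z M
  proof -
    let ?I = "{- int M..int M}"
    let ?p = "\<lambda>x m. (1 + \<bar>x - real_of_int m\<bar>) powr (- 3 / 2)"
    have "(\<Sum>j\<in>int_grid M. 1 / (1 + norm (z - j)) ^ 3) \<le> (\<Sum>m\<in>?I. \<Sum>n\<in>?I. ?p (Re z) m * ?p (Im z) n)"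
      unfolding sum_int_grid by (intro sum_mono order_trans[OF term_le]) simp
    also have "\<dots> = (\<Sum>m\<in>?I. ?p (Re z) m) * (\<Sum>n\<in>?I. ?p (Im z) n)" by (simp add: sum_product)
    also have "\<dots> \<le> C * C" using C by (intro mult_mono C(2) sum_nonneg) auto
    finally show ?thesis .
  qed
  then show ?thesis using C(1) by (intro exI[of _ "C * C"]) auto
qed

text \<open>On the disc of radius 1/2 the kernel is at least 3, so the normalizing constant of the smoothing
  is bounded below.\<close>
lemma dbar_kern_integral:
  obtains c where "c \<ge> 3 * pi / 4" "(\<integral>\<zeta>. complex_of_real (dbar_kern \<zeta>) \<partial>lborel) = of_real c"
proof (rule that)
  have int: "integrable lborel (\<lambda>\<zeta>. complex_of_real (dbar_kern \<zeta>))"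
    by (rule integrable_compact_support[where R = 1])
      (auto intro!: continuous_intros continuous_on_dbar_kern simp: kern_far(2))
  then have int': "integrable lborel dbar_kern" using integrable_Re[OF int] by simp
  show "(\<integral>\<zeta>. complex_of_real (dbar_kern \<zeta>) \<partial>lborel) = of_real (\<integral>\<zeta>. dbar_kern \<zeta> \<partial>lborel)"
    by simp
  have "measure lborel (cball 0 (1/2) :: complex set) = pi / 4"
    using content_cball[of "1/2" "0 :: complex"] by (simp add: unit_ball_vol_2 power2_eq_square)
  then have "3 * pi / 4 = (\<integral>\<zeta>. indicator (cball (0 :: complex) (1/2)) \<zeta> * 3 \<partial>lborel)" by simp
  also have "\<dots> \<le> (\<integral>\<zeta>. dbar_kern \<zeta> \<partial>lborel)"
  proof (rule integral_mono[OF _ int'])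
    show "integrable lborel (\<lambda>\<zeta>::complex. indicator (cball 0 (1/2)) \<zeta> * (3 :: real))"
      by (intro integrable_mult_left) (auto intro!: emeasure_compact_finite)
    fix \<zeta> :: complex
    show "indicator (cball 0 (1/2)) \<zeta> * 3 \<le> dbar_kern \<zeta>"
    proof (cases "norm \<zeta> \<le> 1/2")
      case True
      then have "(norm \<zeta>)\<^sup>2 \<le> (1/2)\<^sup>2" by (intro power_mono) auto
      then show ?thesis using True by (simp add: dbar_kern_def power2_eq_square)
    qed (simp add: kern_bound)
  qed
  finally show "(\<integral>\<zeta>. dbar_kern \<zeta> \<partial>lborel) \<ge> 3 * pi / 4" .
qed

text \<open>The bumps add up to 1 and their d-bar derivatives to 0 on the support of \<open>f\<close>, so only the
  smoothing term survives in the sum of the integrands.\<close>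
lemma sum_localizations:
  assumes f: "continuous_on UNIV f" "\<And>\<zeta>. norm \<zeta> > real M \<Longrightarrow> f \<zeta> = 0"
  shows "(\<Sum>j\<in>int_grid M. localization (\<lambda>\<zeta>. f (\<zeta> + j)) (z - j)) = (\<integral>\<zeta>. f (z + \<zeta>) * of_real (dbar_kern \<zeta>) \<partial>lborel)"
proof -
  define G where "G j \<eta> = f \<eta> * (of_real (bump (\<eta> - j) * dbar_kern (z - \<eta>)) - dbar_bump (\<eta> - j) * kern (z - \<eta>))" for j \<eta>
  have G_cont: "continuous_on UNIV (G j)" for j unfolding G_def[abs_def]
    by (intro continuous_intros f continuous_on_compose_UNIV[OF continuous_on_bump] continuous_on_compose_UNIV[OF continuous_on_dbar_bump]
      continuous_on_compose_UNIV[OF continuous_on_kern] continuous_on_compose_UNIV[OF continuous_on_dbar_kern])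
  have G_int: "integrable lborel (G j)" for j
    by (rule integrable_compact_support[OF G_cont, of "real M"]) (simp add: G_def f(2))
  have "localization (\<lambda>\<zeta>. f (\<zeta> + j)) (z - j) = (\<integral>\<eta>. G j \<eta> \<partial>lborel)" for j
  proof -
    have "localization_integrand (\<lambda>\<zeta>. f (\<zeta> + j)) (z - j) = (\<lambda>\<zeta>. G j (j + \<zeta>))"
      by (simp add: localization_integrand_def G_def fun_eq_iff add.commute diff_diff_eq)
    then show ?thesis unfolding localization_def by (simp add: integral_lborel_translate[OF G_cont])
  qed
  then have "(\<Sum>j\<in>int_grid M. localization (\<lambda>\<zeta>. f (\<zeta> + j)) (z - j)) = (\<integral>\<eta>. (\<Sum>j\<in>int_grid M. G j \<eta>) \<partial>lborel)"
    by (simp add: Bochner_Integration.integral_sum G_int)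
  also have "(\<lambda>\<eta>. \<Sum>j\<in>int_grid M. G j \<eta>) = (\<lambda>\<eta>. f \<eta> * of_real (dbar_kern (z - \<eta>)))"
  proof
    fix \<eta>
    show "(\<Sum>j\<in>int_grid M. G j \<eta>) = f \<eta> * of_real (dbar_kern (z - \<eta>))"
    proof (cases "norm \<eta> \<le> real M")
      case True
      have "(\<Sum>j\<in>int_grid M. G j \<eta>) = f \<eta> * (of_real ((\<Sum>j\<in>int_grid M. bump (\<eta> - j)) * dbar_kern (z - \<eta>))
          - (\<Sum>j\<in>int_grid M. dbar_bump (\<eta> - j)) * kern (z - \<eta>))"
        by (simp add: G_def sum_distrib_left[symmetric] sum_distrib_right[symmetric] sum_subtractf)
      then show ?thesis by (simp add: bump_partition[OF True])
    qed (simp add: G_def f(2))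
  qed
  also have "(\<integral>\<eta>. f \<eta> * of_real (dbar_kern (z - \<eta>)) \<partial>lborel) = (\<integral>\<zeta>. f (z + \<zeta>) * of_real (dbar_kern (z - (z + \<zeta>))) \<partial>lborel)"
    by (rule integral_lborel_translate[symmetric])
      (intro continuous_intros f continuous_on_compose_UNIV[OF continuous_on_dbar_kern])
  finally show ?thesis by (simp add: dbar_kern_def)
qed

lemma smoothing_error:
  fixes f :: "complex \<Rightarrow> complex"
  assumes f: "continuous_on UNIV f" "\<And>x y. dist x y \<le> 2 \<Longrightarrow> norm (f x - f y) \<le> \<omega>"
    and c: "(\<integral>\<zeta>. complex_of_real (dbar_kern \<zeta>) \<partial>lborel) = of_real c"
  shows "norm ((\<integral>\<zeta>. f (z + \<zeta>) * of_real (dbar_kern \<zeta>) \<partial>lborel) - of_real c * f z) \<le> 4 * \<omega> * pi"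
proof -
  have \<omega>0: "\<omega> \<ge> 0" using f(2)[of 0 0] by simp
  have c0: "continuous_on UNIV (\<lambda>\<zeta>. complex_of_real (dbar_kern \<zeta>))"
    by (intro continuous_intros continuous_on_dbar_kern)
  have c1: "continuous_on UNIV (\<lambda>\<zeta>. f (z + \<zeta>) * of_real (dbar_kern \<zeta>))"
    by (intro continuous_intros continuous_on_compose_UNIV[OF f(1)] continuous_on_dbar_kern)
  have i: "integrable lborel (\<lambda>\<zeta>. complex_of_real (dbar_kern \<zeta>))" "integrable lborel (\<lambda>\<zeta>. f (z + \<zeta>) * of_real (dbar_kern \<zeta>))"
    by (rule integrable_compact_support[of _ 1]; use c0 c1 in \<open>simp add: kern_far(2)\<close>)+
  have "(\<integral>\<zeta>. f (z + \<zeta>) * of_real (dbar_kern \<zeta>) \<partial>lborel) - of_real c * f z =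
      (\<integral>\<zeta>. (f (z + \<zeta>) - f z) * of_real (dbar_kern \<zeta>) \<partial>lborel)"
  proof -
    have "(\<integral>\<zeta>. (f (z + \<zeta>) - f z) * of_real (dbar_kern \<zeta>) \<partial>lborel) =
        (\<integral>\<zeta>. f (z + \<zeta>) * of_real (dbar_kern \<zeta>) - f z * of_real (dbar_kern \<zeta>) \<partial>lborel)"
      by (simp only: left_diff_distrib)
    also have "\<dots> = (\<integral>\<zeta>. f (z + \<zeta>) * of_real (dbar_kern \<zeta>) \<partial>lborel) - (\<integral>\<zeta>. f z * of_real (dbar_kern \<zeta>) \<partial>lborel)"
      by (intro Bochner_Integration.integral_diff i integrable_mult_right)
    also have "(\<integral>\<zeta>. f z * of_real (dbar_kern \<zeta>) \<partial>lborel) = of_real c * f z"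
      by (subst integral_mult_right_zero) (simp only: c mult.commute)
    finally show ?thesis by simp
  qed
  also have "norm \<dots> \<le> (4 * \<omega>) * (pi * 1\<^sup>2)"
  proof (rule norm_integral_compact_support_le)
    show "continuous_on UNIV (\<lambda>\<zeta>. (f (z + \<zeta>) - f z) * of_real (dbar_kern \<zeta>))"
      by (intro continuous_intros continuous_on_compose_UNIV[OF f(1)] continuous_on_dbar_kern)
    fix \<zeta> :: complex assume "norm \<zeta> \<le> 1"
    then have "norm (f (z + \<zeta>) - f z) \<le> \<omega>" by (intro f(2)) (simp add: dist_norm)
    then have "norm (f (z + \<zeta>) - f z) * dbar_kern \<zeta> \<le> \<omega> * 4"
      using \<omega>0 kern_bound[of \<zeta>] by (intro mult_mono) auto
    then show "norm ((f (z + \<zeta>) - f z) * of_real (dbar_kern \<zeta>)) \<le> 4 * \<omega>"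
      using kern_bound(2)[of \<zeta>] by (simp add: norm_mult)
  qed (auto simp: kern_far(2))
  finally show ?thesis by simp
qed

text \<open>If the cell lies in the interior of \<open>K\<close> the localization is 0. Otherwise there is a point \<open>b\<close> of the
  complement at distance at most 3 from \<open>j\<close>, and the component of \<open>b\<close> is large enough to contain a
  path of unit size.\<close>
lemma localization_approx_rational:
  assumes K: "compact K" and f: "continuous_on UNIV f" "\<And>x y. dist x y \<le> 2 \<Longrightarrow> norm (f x - f y) \<le> \<omega>"
    and hol: "f holomorphic_on interior K"
    and comp: "\<And>b. b \<notin> K \<Longrightarrow> \<exists>d. connected_component (- K) b d \<and> dist b d \<ge> 1"
  shows "\<exists>h\<in>rational_closure K (- K). \<forall>z\<in>K.
    norm (localization (\<lambda>\<zeta>. f (\<zeta> + j)) (z - j) - h z) \<le> 10 ^ 10 * \<omega> * (1 / (1 + norm (z - j)) ^ 3)"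
proof -
  have \<omega>0: "\<omega> \<ge> 0" using f(2)[of 0 0] by simp
  have cf: "continuous_on UNIV (\<lambda>\<zeta>. f (\<zeta> + j))"
    by (intro continuous_on_compose_UNIV[OF f(1)] continuous_intros)
  show ?thesis
  proof (cases "cball j 2 \<subseteq> interior K")
    case True
    have "localization (\<lambda>\<zeta>. f (\<zeta> + j)) (z - j) = 0" for z
    proof (rule localization_holomorphic)
      let ?U = "(\<lambda>\<zeta>. \<zeta> + j) -` interior K"
      show "open ?U" by (intro open_vimage continuous_intros) auto
      show "cball 0 2 \<subseteq> ?U" using True by (force simp: dist_norm)
      have "(f \<circ> (\<lambda>\<zeta>. \<zeta> + j)) holomorphic_on ?U"
        by (rule holomorphic_on_compose_gen[OF _ hol]) (auto intro!: holomorphic_intros)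
      then show "(\<lambda>\<zeta>. f (\<zeta> + j)) holomorphic_on ?U" by (simp add: o_def)
    qed
    then show ?thesis using \<omega>0 by (intro bexI[of _ "\<lambda>z. 0"] rational_closure_const) auto
  next
    case False
    then obtain x where x: "x \<in> cball j 2" "x \<notin> interior K" by blast
    then have "x \<in> closure (- K)" by (simp add: closure_complement)
    then obtain b where b: "b \<notin> K" "dist b x < 1"
      unfolding closure_approachable by (metis ComplD zero_less_one)
    have "norm (b - j) \<le> norm (b - x) + norm (x - j)"
      using norm_triangle_ineq[of "b - x" "x - j"] by simp
    then have bj: "norm (b - j) \<le> 3" using b(2) x(1) by (simp add: dist_norm norm_minus_commute)
    obtain d where d: "connected_component (- K) b d" "dist b d \<ge> 1" using comp[OF b(1)] by blast
    obtain g where g: "path g" "pathfinish g = b" "path_image g \<inter> K = {}" "path_image g \<subseteq> cball b 1"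
      "norm (b - pathstart g) = 1"
      using unit_arc_in_component[OF K b(1) d] by blast
    define a where "a = pathstart g"
    obtain q where q: "q \<in> rational_closure K (- K)" "\<And>z. z \<in> K \<Longrightarrow> norm (q z) \<le> 52"
      "\<And>z. z \<in> K \<Longrightarrow> norm (q z - (1 / (z - b) - (b - a) / 2 * (1 / (z - b)) ^ 2)) \<le> 1600 * (1 / norm (z - b)) ^ 3"
      using arc_avoiding_functions[OF K g(1) a_def[symmetric] g(2,3,4)] g(5) unfolding a_def by blast
    have ba: "norm ((b - j) - (a - j)) = 1" using g(5) by (simp add: a_def)
    have "\<exists>\<alpha> \<beta>. \<forall>z Q. norm Q \<le> 52 \<longrightarrow>
      norm (Q - (1 / (z - (b - j)) - ((b - j) - (a - j)) / 2 * (1 / (z - (b - j))) ^ 2)) \<le> 1600 * (1 / norm (z - (b - j))) ^ 3 \<longrightarrow>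
      norm (localization (\<lambda>\<zeta>. f (\<zeta> + j)) z - (\<alpha> * Q + \<beta> * Q\<^sup>2)) \<le> 10 ^ 10 * \<omega> / (1 + norm z) ^ 3"
      by (rule localization_matching[OF cf _ bj ba]) (auto intro!: f(2) simp: dist_norm)
    then obtain \<alpha> \<beta> where m: "\<And>z Q. norm Q \<le> 52 \<Longrightarrow>
      norm (Q - (1 / (z - (b - j)) - ((b - j) - (a - j)) / 2 * (1 / (z - (b - j))) ^ 2)) \<le> 1600 * (1 / norm (z - (b - j))) ^ 3 \<Longrightarrow>
      norm (localization (\<lambda>\<zeta>. f (\<zeta> + j)) z - (\<alpha> * Q + \<beta> * Q\<^sup>2)) \<le> 10 ^ 10 * \<omega> / (1 + norm z) ^ 3"
      by blast
    show ?thesis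
    proof (rule bexI[of _ "\<lambda>z. \<alpha> * q z + \<beta> * (q z)\<^sup>2"])
      show "(\<lambda>z. \<alpha> * q z + \<beta> * (q z)\<^sup>2) \<in> rational_closure K (- K)"
        using K by (intro rational_closure_add rational_closure_cmult rational_closure_power q(1)) auto
      show "\<forall>z\<in>K. norm (localization (\<lambda>\<zeta>. f (\<zeta> + j)) (z - j) - (\<alpha> * q z + \<beta> * (q z)\<^sup>2))
          \<le> 10 ^ 10 * \<omega> * (1 / (1 + norm (z - j)) ^ 3)"
        using m[of "q z" "z - j" for z] q(2,3) by simp
    qed
  qed
qed

text \<open>The constant is absolute: it depends neither on \<open>K\<close> nor on \<open>f\<close>, which is what allows rescaling
  afterwards.\<close>
lemma mergelyan_unit_scale:
  "\<exists>C>0. \<forall>K f \<omega> R. compact K \<longrightarrow> continuous_on UNIV f \<longrightarrow> (\<forall>\<zeta>. norm \<zeta> > R \<longrightarrow> f \<zeta> = 0) \<longrightarrow>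
     (\<forall>x y. dist x y \<le> 2 \<longrightarrow> norm (f x - f y) \<le> \<omega>) \<longrightarrow> f holomorphic_on interior K \<longrightarrow>
     (\<forall>b. b \<notin> K \<longrightarrow> (\<exists>d. connected_component (- K) b d \<and> dist b d \<ge> 1)) \<longrightarrow>
     (\<exists>F\<in>rational_closure K (- K). \<forall>z\<in>K. norm (f z - F z) \<le> C * \<omega>)"
proof -
  obtain C where C: "C > 0" "\<And>z M. (\<Sum>j\<in>int_grid M. 1 / (1 + norm (z - j)) ^ 3) \<le> C"
    using lattice_sum_bounded by blast
  obtain c where c: "c \<ge> 3 * pi / 4" "(\<integral>\<zeta>. complex_of_real (dbar_kern \<zeta>) \<partial>lborel) = of_real c"
    by (rule dbar_kern_integral)
  have c0: "c > 0" using c(1) pi_gt_zero by linarith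
  define C' where "C' = (10 ^ 10 * C + 4 * pi) / c"
  have "\<exists>F\<in>rational_closure K (- K). \<forall>z\<in>K. norm (f z - F z) \<le> C' * \<omega>"
    if K: "compact K" and f: "continuous_on UNIV f" "\<And>\<zeta>. norm \<zeta> > R \<Longrightarrow> f \<zeta> = 0"
      "\<And>x y. dist x y \<le> 2 \<Longrightarrow> norm (f x - f y) \<le> \<omega>" "f holomorphic_on interior K"
      and comp: "\<And>b. b \<notin> K \<Longrightarrow> \<exists>d. connected_component (- K) b d \<and> dist b d \<ge> 1"
    for K f \<omega> R
  proof -
    have \<omega>0: "\<omega> \<ge> 0" using f(3)[of 0 0] by simp
    obtain M :: nat where "R \<le> real M" using real_arch_simple by blast
    then have fM: "f \<zeta> = 0" if "norm \<zeta> > real M" for \<zeta> using f(2) that by auto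
    let ?L = "\<lambda>j z. localization (\<lambda>\<zeta>. f (\<zeta> + j)) (z - j)"
    have "\<forall>j. \<exists>h\<in>rational_closure K (- K). \<forall>z\<in>K.
        norm (?L j z - h z) \<le> 10 ^ 10 * \<omega> * (1 / (1 + norm (z - j)) ^ 3)"
      using localization_approx_rational[OF K f(1,3,4) comp] by blast
    then obtain h where h: "\<And>j. h j \<in> rational_closure K (- K)"
      "\<And>j z. z \<in> K \<Longrightarrow> norm (?L j z - h j z) \<le> 10 ^ 10 * \<omega> * (1 / (1 + norm (z - j)) ^ 3)"
      by metis
    define F where "F z = 1 / of_real c * (\<Sum>j\<in>int_grid M. h j z)" for z
    have "F \<in> rational_closure K (- K)" unfolding F_def
      by (intro rational_closure_cmult rational_closure_sum h(1))
    moreover have "norm (f z - F z) \<le> C' * \<omega>" if z: "z \<in> K" for z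
    proof -
      let ?S = "\<Sum>j\<in>int_grid M. ?L j z"
      have "?S = (\<integral>\<zeta>. f (z + \<zeta>) * of_real (dbar_kern \<zeta>) \<partial>lborel)"
        by (rule sum_localizations[OF f(1)]) (rule fM)
      then have "norm (?S - of_real c * f z) \<le> 4 * \<omega> * pi"
        using smoothing_error[OF f(1,3) c(2), of z] by simp
      moreover have "norm (?S - (\<Sum>j\<in>int_grid M. h j z)) \<le> 10 ^ 10 * \<omega> * C"
      proof -
        have "norm (?S - (\<Sum>j\<in>int_grid M. h j z)) \<le> (\<Sum>j\<in>int_grid M. 10 ^ 10 * \<omega> * (1 / (1 + norm (z - j)) ^ 3))"
          unfolding sum_subtractf[symmetric] by (intro sum_norm_le h(2) z)
        also have "\<dots> = 10 ^ 10 * \<omega> * (\<Sum>j\<in>int_grid M. 1 / (1 + norm (z - j)) ^ 3)"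
          by (simp add: sum_distrib_left)
        also have "\<dots> \<le> 10 ^ 10 * \<omega> * C" using \<omega>0 by (intro mult_left_mono C) auto
        finally show ?thesis .
      qed
      moreover have eq: "of_real c * (f z - F z) = (?S - (\<Sum>j\<in>int_grid M. h j z)) - (?S - of_real c * f z)"
        using c0 by (simp add: F_def algebra_simps)
      moreover have "norm ((?S - (\<Sum>j\<in>int_grid M. h j z)) - (?S - of_real c * f z))
          \<le> norm (?S - (\<Sum>j\<in>int_grid M. h j z)) + norm (?S - of_real c * f z)"
        by (rule norm_triangle_ineq4)
      ultimately have "norm (of_real c * (f z - F z)) \<le> 10 ^ 10 * \<omega> * C + 4 * \<omega> * pi"
        unfolding eq by linarith
      then have "c * norm (f z - F z) \<le> (10 ^ 10 * C + 4 * pi) * \<omega>"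
        unfolding norm_mult using c0 by (simp add: distrib_left distrib_right mult_ac)
      then show ?thesis using c0 by (simp add: C'_def pos_le_divide_eq mult.commute)
    qed
    ultimately show ?thesis by blast
  qed
  moreover have "C' > 0" using C(1) c0 pi_gt_zero by (simp add: C'_def add_pos_pos)
  ultimately show ?thesis by blast
qed

text \<open>Substituting \<open>z / r\<close> moves a pole \<open>w\<close> to \<open>r * w\<close>.\<close>
lemma rational_closure_rescale:
  assumes r: "r \<noteq> 0" and L: "\<And>w. r * w \<in> K \<Longrightarrow> w \<in> L" and L': "\<And>z. z \<in> K \<Longrightarrow> z / r \<in> L"
    and F: "F \<in> rational_closure L (- L)"
  shows "(\<lambda>z. F (z / r)) \<in> rational_closure K (- K)"
proof -
  have *: "(\<lambda>z. g (z / r)) \<in> rational_with_poles (- K)" if "g \<in> rational_with_poles (- L)" for g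
    using that
  proof induction
    case ident
    show ?case using rational_with_poles.mult[OF rational_with_poles.const[of "1 / r"] rational_with_poles.ident]
      by simp
  next
    case (pole w)
    then have "r * w \<in> - K" using L by auto
    moreover have "(\<lambda>z. 1 / (z / r - w)) = (\<lambda>z. r * (1 / (z - r * w)))" using r by (auto simp: fun_eq_iff divide_simps)
    \<comment> \<open>The two functions also agree at the pole, where both have the value 0.\<close>
    ultimately show ?case using rational_with_poles.mult[OF rational_with_poles.const[of r] rational_with_poles.pole]
      by simp
  qed (auto intro: rational_with_poles.intros)
  show ?thesis unfolding rational_closure_def
  proof (rule uniform_closure_onI)
    fix e :: real assume "e > 0"
    then obtain g where g: "g \<in> rational_with_poles (- L)" "\<And>z. z \<in> L \<Longrightarrow> norm (F z - g z) < e"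
      using uniform_closure_onD[OF F[unfolded rational_closure_def]] by metis
    then show "\<exists>g\<in>rational_with_poles (- K). \<forall>z\<in>K. norm (F (z / r) - g z) < e"
      using L' by (intro bexI[OF _ *[OF g(1)]]) auto
  qed
qed

text \<open>Tietze's theorem, followed by a cutoff.\<close>
lemma continuous_extension_compact_support:
  fixes f :: "complex \<Rightarrow> complex"
  assumes K: "compact K" and f: "continuous_on K f"
  obtains g R where "continuous_on UNIV g" "\<And>z. z \<in> K \<Longrightarrow> g z = f z" "\<And>z. norm z > R \<Longrightarrow> g z = 0"
proof -
  obtain h where h: "continuous_on UNIV h" "\<And>z. z \<in> K \<Longrightarrow> h z = f z"
    using Tietze_unbounded[OF f, of UNIV] K compact_imp_closed by auto
  obtain B where B: "\<And>z. z \<in> K \<Longrightarrow> norm z \<le> B"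
    using K compact_imp_bounded bounded_iff by metis
  define cut where "cut z = max 0 (min 1 (B + 1 - norm z))" for z :: complex
  show ?thesis
  proof
    show "continuous_on UNIV (\<lambda>z. of_real (cut z) * h z)"
      unfolding cut_def by (intro continuous_intros h)
    show "of_real (cut z) * h z = f z" if "z \<in> K" for z using B[OF that] h(2)[OF that] by (simp add: cut_def)
    show "of_real (cut z) * h z = 0" if "norm z > B + 1" for z using that by (simp add: cut_def)
  qed
qed

lemma compact_support_uniformly_continuous:
  fixes g :: "complex \<Rightarrow> complex"
  assumes g: "continuous_on UNIV g" "\<And>z. norm z > R \<Longrightarrow> g z = 0" and e: "e > 0"
  obtains d where "d > 0" "\<And>x y. dist x y < d \<Longrightarrow> norm (g x - g y) < e"
proof -
  have "uniformly_continuous_on (cball 0 (R + 1)) g"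
    by (intro compact_uniformly_continuous continuous_on_subset[OF g(1)]) auto
  then obtain d where d: "d > 0" "\<And>x y. x \<in> cball 0 (R + 1) \<Longrightarrow> y \<in> cball 0 (R + 1) \<Longrightarrow> dist y x < d \<Longrightarrow> dist (g y) (g x) < e"
    using e unfolding uniformly_continuous_on_def by metis
  have "norm (g x - g y) < e" if xy: "dist x y < min d 1" for x y
  proof (cases "norm x \<le> R + 1 \<and> norm y \<le> R + 1")
    case True
    then show ?thesis using d(2)[of y x] xy by (simp add: dist_norm)
  next
    case False
    have "norm x \<le> norm y + 1" "norm y \<le> norm x + 1"
      using xy norm_triangle_ineq2[of x y] norm_triangle_ineq2[of y x] by (auto simp: dist_norm norm_minus_commute)
    then have "norm x > R" "norm y > R" using False by auto
    then show ?thesis using g(2) e by simp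
  qed
  then show ?thesis using that[of "min d 1"] d(1) by auto
qed

text \<open>Shrink the scale until the oscillation of the extended function over distances up to 2 is small
  and every component of the complement leaves the unit disc about each of its points; then apply
  the estimate at unit scale.\<close>
theorem mergelyan:
  assumes K: "compact K" and f: "continuous_on K f" "f holomorphic_on interior K"
    and r0: "r0 > 0" and comp: "\<And>b. b \<notin> K \<Longrightarrow> \<exists>d. connected_component (- K) b d \<and> dist b d \<ge> r0"
  shows "f \<in> rational_closure K (- K)"
proof (rule rational_closure_uniform_limit)
  fix e :: real assume e: "e > 0"
  obtain C where C: "C > 0" and unit: "\<And>K f \<omega> R. compact K \<Longrightarrow> continuous_on UNIV f \<Longrightarrow> (\<forall>\<zeta>. norm \<zeta> > R \<longrightarrow> f \<zeta> = 0) \<Longrightarrow>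
     (\<forall>x y. dist x y \<le> 2 \<longrightarrow> norm (f x - f y) \<le> \<omega>) \<Longrightarrow> f holomorphic_on interior K \<Longrightarrow>
     (\<forall>b. b \<notin> K \<longrightarrow> (\<exists>d. connected_component (- K) b d \<and> dist b d \<ge> 1)) \<Longrightarrow>
     (\<exists>F\<in>rational_closure K (- K). \<forall>z\<in>K. norm (f z - F z) \<le> C * \<omega>)"
    using mergelyan_unit_scale by blast
  obtain g R where g: "continuous_on UNIV g" "\<And>z. z \<in> K \<Longrightarrow> g z = f z" "\<And>z. norm z > R \<Longrightarrow> g z = 0"
    using continuous_extension_compact_support[OF K f(1)] by metis
  define \<omega> where "\<omega> = e / (2 * C)"
  have \<omega>: "\<omega> > 0" "C * \<omega> < e" using e C by (auto simp: \<omega>_def)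
  obtain d where d: "d > 0" "\<And>x y. dist x y < d \<Longrightarrow> norm (g x - g y) < \<omega>"
    using compact_support_uniformly_continuous[OF g(1,3) \<omega>(1)] by metis
  define r where "r = min r0 (d / 3)"
  have r: "r > 0" "r \<le> r0" "2 * r < d" using r0 d(1) by (auto simp: r_def)
  define c where "c = complex_of_real r"
  have c: "c \<noteq> 0" "norm c = r" using r by (auto simp: c_def)
  define L where "L = (\<lambda>z. z / c) ` K"
  have L_iff: "z \<in> L \<longleftrightarrow> c * z \<in> K" for z
    using c by (force simp: L_def image_iff field_simps)
  define G where "G z = g (c * z)" for z
  have "\<exists>F\<in>rational_closure L (- L). \<forall>z\<in>L. norm (G z - F z) \<le> C * \<omega>"
  proof (rule unit)
    show "compact L" unfolding L_def using c by (intro compact_continuous_image continuous_intros K) auto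
    show "continuous_on UNIV G" unfolding G_def by (intro continuous_on_compose_UNIV[OF g(1)] continuous_intros)
    show "\<forall>\<zeta>. norm \<zeta> > R / r \<longrightarrow> G \<zeta> = 0"
      using r c by (auto simp: G_def norm_mult divide_less_eq mult.commute intro!: g(3))
    show "\<forall>x y. dist x y \<le> 2 \<longrightarrow> norm (G x - G y) \<le> \<omega>"
    proof (intro allI impI)
      fix x y :: complex assume "dist x y \<le> 2"
      then have "dist (c * x) (c * y) \<le> r * 2"
        using r c by (simp add: dist_norm norm_mult flip: right_diff_distrib)
      then have "norm (g (c * x) - g (c * y)) < \<omega>" using r by (intro d(2)) auto
      then show "norm (G x - G y) \<le> \<omega>" by (simp add: G_def)
    qed
    have int: "c * z \<in> interior K" if "z \<in> interior L" for z
    proof -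
      have "open ((\<lambda>w. w / c) -` interior L)" using c by (intro open_vimage continuous_intros) auto
      moreover have "(\<lambda>w. w / c) -` interior L \<subseteq> K"
      proof
        fix w assume "w \<in> (\<lambda>w. w / c) -` interior L"
        then have "w / c \<in> L" using interior_subset by blast
        then show "w \<in> K" using c by (simp add: L_iff)
      qed
      moreover have "c * z \<in> (\<lambda>w. w / c) -` interior L" using that c by simp
      ultimately show ?thesis using interior_maximal by blast
    qed
    have "(f \<circ> (\<lambda>z. c * z)) holomorphic_on interior L"
      by (rule holomorphic_on_compose_gen[OF _ f(2)]) (auto intro!: holomorphic_intros int)
    then show "G holomorphic_on interior L"
      by (rule holomorphic_transform) (use int interior_subset g(2) in \<open>force simp: G_def\<close>)
    show "\<forall>b. b \<notin> L \<longrightarrow> (\<exists>d. connected_component (- L) b d \<and> dist b d \<ge> 1)"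
    proof (intro allI impI)
      fix b assume "b \<notin> L"
      then obtain y where y: "connected_component (- K) (c * b) y" "dist (c * b) y \<ge> r0"
        using comp[of "c * b"] by (auto simp: L_iff)
      obtain T where T: "connected T" "T \<subseteq> - K" "c * b \<in> T" "y \<in> T"
        using y(1) unfolding connected_component_def by blast
      have "connected_component (- L) b (y / c)" unfolding connected_component_def
      proof (intro exI[of _ "(\<lambda>z. z / c) ` T"] conjI)
        show "connected ((\<lambda>z. z / c) ` T)" using c by (intro connected_continuous_image T continuous_intros) auto
        show "(\<lambda>z. z / c) ` T \<subseteq> - L" using T(2) c by (auto simp: L_iff)
        show "b \<in> (\<lambda>z. z / c) ` T" using T(3) c by (intro image_eqI[of _ _ "c * b"]) auto
        show "y / c \<in> (\<lambda>z. z / c) ` T" using T(4) by blast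
      qed
      moreover have "dist b (y / c) \<ge> 1"
      proof -
        have "c * (b - y / c) = c * b - y" using c by (simp add: right_diff_distrib)
        then have "r * norm (b - y / c) = norm (c * b - y)" using c by (metis norm_mult)
        then have "r * norm (b - y / c) \<ge> r * 1" using y(2) r by (simp add: dist_norm)
        then show ?thesis using r(1) by (simp add: dist_norm)
      qed
      ultimately show "\<exists>d. connected_component (- L) b d \<and> dist b d \<ge> 1" by blast
    qed
  qed
  then obtain F where F: "F \<in> rational_closure L (- L)" "\<And>z. z \<in> L \<Longrightarrow> norm (G z - F z) \<le> C * \<omega>" by blast
  have "(\<lambda>z. F (z / c)) \<in> rational_closure K (- K)"
    by (rule rational_closure_rescale[OF c(1) _ _ F(1)]) (use c in \<open>auto simp: L_iff\<close>)
  moreover have "norm (f z - F (z / c)) < e" if "z \<in> K" for z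
  proof -
    have "z / c \<in> L" using that c by (simp add: L_iff)
    from F(2)[OF this] have "norm (f z - F (z / c)) \<le> C * \<omega>" using c g(2)[OF that] by (simp add: G_def)
    then show ?thesis using \<omega>(2) by linarith
  qed
  ultimately show "\<exists>g\<in>rational_closure K (- K). \<forall>z\<in>K. norm (f z - g z) < e"
    by (intro bexI[of _ "\<lambda>z. F (z / c)"] ballI)
qed


section \<open>Domains bounded by Jordan curves\<close>

text \<open>Near a point of one boundary curve the other curves are absent, and by the Jordan curve theorem
  that point is a limit of points on the side of the curve that does not contain \<open>\<Omega>\<close>; these points
  are outside \<open>closure \<Omega>\<close>.\<close>
lemma jordan_domain_regular:
  assumes \<Omega>: "open \<Omega>" "connected \<Omega>"
    and \<J>: "finite \<J>" "\<And>J. J \<in> \<J> \<Longrightarrow> jordan_curve J" "pairwise disjnt \<J>" "frontier \<Omega> = \<Union>\<J>"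
  shows "interior (closure \<Omega>) = \<Omega>"
proof
  show "\<Omega> \<subseteq> interior (closure \<Omega>)" using \<Omega>(1) by (simp add: closure_subset interior_maximal)
  show "interior (closure \<Omega>) \<subseteq> \<Omega>"
  proof
    fix p assume p: "p \<in> interior (closure \<Omega>)"
    show "p \<in> \<Omega>"
    proof (rule ccontr)
      assume "p \<notin> \<Omega>"
      then have "p \<in> frontier \<Omega>" using p interior_subset \<Omega>(1) by (auto simp: frontier_def interior_open)
      then obtain J where J: "J \<in> \<J>" "p \<in> J" using \<J>(4) by auto
      obtain \<gamma> where \<gamma>: "simple_path \<gamma>" "pathfinish \<gamma> = pathstart \<gamma>" "path_image \<gamma> = J"
        using \<J>(2)[OF J(1)] unfolding jordan_curve_def by blast
      note jc = Jordan_inside_outside[OF \<gamma>(1,2), unfolded \<gamma>(3)]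
      have disj: "\<Omega> \<inter> J = {}"
        using J(1) \<J>(4) \<Omega>(1) by (auto simp: frontier_def interior_open)
      have J_closed: "closed J'" if J': "J' \<in> \<J>" for J'
      proof -
        obtain \<delta> where "simple_path \<delta>" "path_image \<delta> = J'" using \<J>(2)[OF J'] unfolding jordan_curve_def by blast
        then show ?thesis using closed_simple_path_image by blast
      qed
      \<comment> \<open>A neighbourhood of \<open>p\<close> in \<open>closure \<Omega>\<close> that misses the other curves.\<close>
      define N where "N = interior (closure \<Omega>) - \<Union>(\<J> - {J})"
      have "closed (\<Union>(\<J> - {J}))" using \<J>(1) J_closed by (intro closed_Union) auto
      then have N_open: "open N" unfolding N_def by (intro open_Diff) auto
      have "p \<notin> J'" if "J' \<in> \<J> - {J}" for J'
        using \<J>(3) J that unfolding pairwise_def disjnt_def by blast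
      then have pN: "p \<in> N" using p by (auto simp: N_def)
      \<comment> \<open>The domain lies on one side of the curve, while the point is in the closure of both sides.\<close>
      have "\<Omega> \<inter> inside J = {} \<or> \<Omega> \<inter> outside J = {}"
      proof (rule ccontr)
        assume *: "\<not> ?thesis"
        have "\<Omega> \<subseteq> inside J \<union> outside J" using disj jc by blast
        then show False using connectedD[OF \<Omega>(2), of "inside J" "outside J"] * jc by blast
      qed
      then obtain S where S: "\<Omega> \<inter> S = {}" "frontier S = J" "S \<inter> J = {}"
        using jc by (metis Int_commute inside_no_overlap outside_no_overlap)
      have "p \<in> closure S" using S(2) J(2) by (auto simp: frontier_def)
      then obtain q where q: "q \<in> S" "q \<in> N" using N_open pN closure_iff_nhds_not_empty by (metis disjoint_iff order_refl)
      have "q \<notin> \<Omega>" using S(1) q(1) by blast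
      moreover have "q \<notin> frontier \<Omega>" using \<J>(4) q S(3) by (auto simp: N_def)
      moreover have "q \<in> closure \<Omega>" using q(2) interior_subset by (auto simp: N_def)
      ultimately show False using \<Omega>(1) by (auto simp: frontier_def interior_open)
    qed
  qed
qed

text \<open>Two points of \<open>C\<close> at distance \<open>e / 2\<close> cannot both be closer than \<open>e / 4\<close> to \<open>b\<close>.\<close>
lemma open_contains_distant_points:
  fixes C :: "complex set"
  assumes "open C" "C \<noteq> {}"
  obtains r where "r > 0" "\<And>b. \<exists>d\<in>C. dist b d \<ge> r"
proof -
  obtain w e where w: "e > 0" "ball w e \<subseteq> C" using assms open_contains_ball by blast
  show ?thesis
  proof
    show "e / 4 > 0" using w by simp
    fix b
    define w' where "w' = w + of_real (e / 2)"
    have d: "dist w w' = e / 2" using w(1) by (simp add: w'_def dist_norm)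
    have "w \<in> C" "w' \<in> C" using w d by auto
    moreover have "dist b w \<ge> e / 4 \<or> dist b w' \<ge> e / 4"
      using dist_triangle3[of w w' b] d by linarith
    ultimately show "\<exists>d\<in>C. dist b d \<ge> e / 4" by blast
  qed
qed

text \<open>Each bounded component contributes a positive bound; finitely many of them have a positive
  minimum, and unbounded components contain arbitrarily distant points.\<close>
lemma complement_components_large:
  fixes K :: "complex set"
  assumes K: "compact K" and fin: "finite {C \<in> components (- K). bounded C}"
  obtains r where "r > 0" "\<And>b. b \<notin> K \<Longrightarrow> \<exists>d. connected_component (- K) b d \<and> dist b d \<ge> r"
proof -
  let ?B = "{C \<in> components (- K). bounded C}"
  have op: "open (- K)" using K compact_imp_closed by auto
  have "\<exists>r>0. \<forall>b. \<exists>d\<in>C. dist b d \<ge> r" if "C \<in> ?B" for C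
  proof -
    have "open C" "C \<noteq> {}" using that open_components[OF op] in_components_nonempty by blast+
    from open_contains_distant_points[OF this] show ?thesis by metis
  qed
  then obtain r where r: "\<And>C. C \<in> ?B \<Longrightarrow> r C > 0" "\<And>C b. C \<in> ?B \<Longrightarrow> \<exists>d\<in>C. dist b d \<ge> r C"
    by metis
  define m where "m = Min (insert 1 (r ` ?B))"
  have "m > 0" unfolding m_def using fin r(1) by (subst Min_gr_iff) auto
  moreover have "\<exists>d. connected_component (- K) b d \<and> dist b d \<ge> m" if b: "b \<notin> K" for b
  proof (cases "bounded (connected_component_set (- K) b)")
    case True
    then have C: "connected_component_set (- K) b \<in> ?B" using b by (auto simp: components_def)
    then obtain d where "connected_component (- K) b d" "dist b d \<ge> r (connected_component_set (- K) b)"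
      using r(2)[OF C, of b] by auto
    moreover have "m \<le> r (connected_component_set (- K) b)"
      unfolding m_def using fin C by (intro Min_le) auto
    ultimately show ?thesis by (meson order_trans)
  next
    case False
    then obtain d where "connected_component (- K) b d" "\<not> dist b d \<le> m"
      unfolding bounded_def by (metis mem_Collect_eq)
    then show ?thesis by (meson linear)
  qed
  ultimately show ?thesis using that by blast
qed

section \<open>Rational Dirichlet functions\<close>

definition dirichlet_rational_on :: "complex set \<Rightarrow> (nat \<Rightarrow> complex) \<Rightarrow> nat \<Rightarrow> (complex \<Rightarrow> complex) set"
  where "dirichlet_rational_on K z N = {R. \<exists>P. (\<forall>j\<in>{0..N}. dirichlet_polynomial (P j)) \<and>
      (\<forall>s\<in>K. R s = P 0 s + (\<Sum>j=1..N. P j (1 / (s - z j))))}"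

lemma dirichlet_rational_on_add:
  assumes "f \<in> dirichlet_rational_on K z N" "g \<in> dirichlet_rational_on K z N"
  shows "(\<lambda>s. f s + g s) \<in> dirichlet_rational_on K z N"
proof -
  obtain P where P: "\<And>j. j \<in> {0..N} \<Longrightarrow> dirichlet_polynomial (P j)"
      "\<And>s. s \<in> K \<Longrightarrow> f s = P 0 s + (\<Sum>j=1..N. P j (1 / (s - z j)))"
    using assms(1) unfolding dirichlet_rational_on_def by blast
  obtain Q where Q: "\<And>j. j \<in> {0..N} \<Longrightarrow> dirichlet_polynomial (Q j)"
      "\<And>s. s \<in> K \<Longrightarrow> g s = Q 0 s + (\<Sum>j=1..N. Q j (1 / (s - z j)))"
    using assms(2) unfolding dirichlet_rational_on_def by blast
  show ?thesis unfolding dirichlet_rational_on_def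
  proof (intro CollectI exI[of _ "\<lambda>j s. P j s + Q j s"] conjI ballI)
    show "dirichlet_polynomial (\<lambda>s. P j s + Q j s)" if "j \<in> {0..N}" for j
      by (rule dirichlet_polynomial_add[OF P(1)[OF that] Q(1)[OF that]])
  qed (simp add: P(2) Q(2) sum.distrib)
qed

lemma dirichlet_rational_on_cmult:
  assumes "f \<in> dirichlet_rational_on K z N"
  shows "(\<lambda>s. c * f s) \<in> dirichlet_rational_on K z N"
proof -
  obtain P where P: "\<And>j. j \<in> {0..N} \<Longrightarrow> dirichlet_polynomial (P j)"
      "\<And>s. s \<in> K \<Longrightarrow> f s = P 0 s + (\<Sum>j=1..N. P j (1 / (s - z j)))"
    using assms(1) unfolding dirichlet_rational_on_def by blast
  show ?thesis unfolding dirichlet_rational_on_def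
  proof (intro CollectI exI[of _ "\<lambda>j s. c * P j s"] conjI ballI)
    show "dirichlet_polynomial (\<lambda>s. c * P j s)" if "j \<in> {0..N}" for j
      by (rule dirichlet_polynomial_cmult[OF P(1)[OF that]])
  qed (simp add: P(2) sum_distrib_left distrib_left)
qed

lemma dirichlet_rational_on_single:
  assumes "dirichlet_polynomial P"
  shows "P \<in> dirichlet_rational_on K z N"
    and "i \<in> {1..N} \<Longrightarrow> (\<lambda>s. P (1 / (s - z i))) \<in> dirichlet_rational_on K z N"
proof -
  have P: "dirichlet_polynomial (\<lambda>s. if j = i then P s else 0)" for i j :: nat
    by (cases "j = i") (auto simp: assms dirichlet_polynomial_0)
  show "P \<in> dirichlet_rational_on K z N" unfolding dirichlet_rational_on_def
    by (intro CollectI exI[of _ "\<lambda>j s. if j = 0 then P s else 0"] conjI ballI P) simp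
  assume i: "i \<in> {1..N}"
  show "(\<lambda>s. P (1 / (s - z i))) \<in> dirichlet_rational_on K z N" unfolding dirichlet_rational_on_def
    by (intro CollectI exI[of _ "\<lambda>j s. if j = i then P s else 0"] conjI ballI P) (use i in auto)
qed

text \<open>Both \<open>s\<close> and \<open>1 / (s - w)\<close> are bounded on \<open>K\<close>, so that approximating the power functions uniformly on
  a large disc approximates every term.\<close>
lemma partial_fractions_in_dirichlet_closure:
  assumes K: "compact K" and zK: "z ` {1..N} \<inter> K = {}" and f: "f \<in> partial_fractions (z ` {1..N})"
  shows "f \<in> uniform_closure_on K (dirichlet_rational_on K z N)"
proof -
  let ?D = "uniform_closure_on K (dirichlet_rational_on K z N)"
  have add: "(\<lambda>s. g s + h s) \<in> ?D" if "g \<in> ?D" "h \<in> ?D" for g h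
    using dirichlet_rational_on_add that by (rule uniform_closure_on_add)
  have cmult: "(\<lambda>s. c * g s) \<in> ?D" if "g \<in> ?D" for g c
    using dirichlet_rational_on_cmult that by (rule uniform_closure_on_cmult)
  have bounded: "\<exists>r>0. \<forall>s\<in>K. norm (h s) \<le> r" if "continuous_on K h" for h :: "complex \<Rightarrow> complex"
    using compact_imp_bounded[OF compact_continuous_image[OF that K]] by (auto simp: bounded_pos)
  have monom: "(\<lambda>s. s ^ k) \<in> ?D" for k
  proof (rule uniform_closure_onI)
    fix e :: real assume e: "e > 0"
    obtain r where r: "r > 0" "\<And>s. s \<in> K \<Longrightarrow> norm s \<le> r" using bounded[of "\<lambda>s. s"] by auto
    obtain P where P: "dirichlet_polynomial P" "\<And>s. norm s \<le> r \<Longrightarrow> norm (s ^ k - P s) < e"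
      using monomial_approx_by_dirichlet[OF r(1) e] by metis
    show "\<exists>g\<in>dirichlet_rational_on K z N. \<forall>s\<in>K. norm (s ^ k - g s) < e"
      using P(2) r(2) by (intro bexI[OF _ dirichlet_rational_on_single(1)[OF P(1)]]) auto
  qed
  have pole: "(\<lambda>s. (1 / (s - w)) ^ k) \<in> ?D" if w: "w \<in> z ` {1..N}" for w k
  proof (rule uniform_closure_onI)
    fix e :: real assume e: "e > 0"
    obtain i where i: "i \<in> {1..N}" "w = z i" using w by blast
    have "continuous_on K (\<lambda>s. 1 / (s - w))" using w zK by (intro continuous_intros) auto
    from bounded[OF this] obtain r where r: "r > 0" "\<And>s. s \<in> K \<Longrightarrow> norm (1 / (s - w)) \<le> r" by auto
    obtain P where P: "dirichlet_polynomial P" "\<And>s. norm s \<le> r \<Longrightarrow> norm (s ^ k - P s) < e"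
      using monomial_approx_by_dirichlet[OF r(1) e] by metis
    show "\<exists>g\<in>dirichlet_rational_on K z N. \<forall>s\<in>K. norm ((1 / (s - w)) ^ k - g s) < e"
      using P(2)[OF r(2)] i(2) by (intro bexI[OF _ dirichlet_rational_on_single(2)[OF P(1) i(1)]]) auto
  qed
  show ?thesis using f
  proof induction
    case zero
    show ?case using cmult[OF monom, of 0 0] by simp
  next
    case (monom f c k)
    then show ?case by (intro add cmult \<open>\<And>k. (\<lambda>s. s ^ k) \<in> ?D\<close>)
  next
    case (pole_power f w c k)
    then show ?case by (intro add cmult pole)
  qed
qed

theorem theorem4p3:
  fixes \<Omega> :: "complex set" and z :: "nat \<Rightarrow> complex" and N :: nat
    and f :: "complex \<Rightarrow> complex" and \<epsilon> :: real
  assumes domain: "open \<Omega>" "connected \<Omega>" "\<Omega> \<noteq> {}" "bounded \<Omega>"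
    and boundary: "\<exists>\<J>. finite \<J> \<and> (\<forall>J\<in>\<J>. jordan_curve J) \<and> pairwise disjnt \<J> \<and> frontier \<Omega> = \<Union>\<J>"
    and z_in: "z ` {1..N} \<subseteq> \<Union>(bounded_complement_components \<Omega>)"
    and z_unique: "\<forall>C\<in>bounded_complement_components \<Omega>. \<exists>!w. w \<in> z ` {1..N} \<and> w \<in> C"
    and f: "f \<in> A_space \<Omega>"
    and eps: "\<epsilon> > 0"
  shows "\<exists>P :: nat \<Rightarrow> complex \<Rightarrow> complex.
           (\<forall>j\<in>{0..N}. dirichlet_polynomial (P j)) \<and>
           sup_norm_on (closure \<Omega>)
             (\<lambda>s. f s - (P 0 s + (\<Sum>j=1..N. P j (1 / (s - z j))))) < \<epsilon>"
proof -
  define K where "K = closure \<Omega>"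
  let ?B = "{C \<in> components (- K). bounded C}" and ?Z = "z ` {1..N}"
  have B: "bounded_complement_components \<Omega> = ?B"
    by (simp add: bounded_complement_components_def K_def)
  have K: "compact K" "K \<noteq> {}" using domain by (auto simp: K_def compact_eq_bounded_closed)
  have Z_K: "?Z \<inter> K = {}"
    using z_in unfolding B using in_components_subset[of _ "- K"] by blast
  have "interior K = \<Omega>"
    using boundary jordan_domain_regular[OF domain(1,2)] unfolding K_def by blast
  then have f': "continuous_on K f" "f holomorphic_on interior K"
    using f by (auto simp: A_space_def K_def)
  \<comment> \<open>Distinct bounded components contain distinct points among the finitely many \<open>z j\<close>.\<close>
  have "finite ?B"
  proof (rule inj_on_finite[of "\<lambda>C. SOME w. w \<in> ?Z \<inter> C"])
    have w: "(SOME w. w \<in> ?Z \<inter> C) \<in> ?Z \<inter> C" if "C \<in> ?B" for C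
      using z_unique that unfolding B by (intro someI_ex[of "\<lambda>w. w \<in> ?Z \<inter> C"]) blast
    then show "(\<lambda>C. SOME w. w \<in> ?Z \<inter> C) ` ?B \<subseteq> ?Z" by blast
    show "inj_on (\<lambda>C. SOME w. w \<in> ?Z \<inter> C) ?B"
    proof (rule inj_onI)
      fix C C' assume C: "C \<in> ?B" "C' \<in> ?B" "(SOME w. w \<in> ?Z \<inter> C) = (SOME w. w \<in> ?Z \<inter> C')"
      then have "C \<inter> C' \<noteq> {}" using w[OF C(1)] w[OF C(2)] by auto
      then show "C = C'" using C components_eq by blast
    qed
  qed auto
  then obtain r where "r > 0" "\<And>b. b \<notin> K \<Longrightarrow> \<exists>d. connected_component (- K) b d \<and> dist b d \<ge> r"
    using complement_components_large[OF K(1)] by metis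
  then have "f \<in> rational_closure K (- K)" by (intro mergelyan[OF K(1) f'])
  also have "rational_closure K (- K) = rational_closure K ?Z"
  proof (rule rational_closure_pole_shift[OF K(1) Z_K])
    fix w assume w: "w \<notin> K" "bounded (connected_component_set (- K) w)"
    then have "connected_component_set (- K) w \<in> ?B" by (auto simp: components_def)
    from ex1_implies_ex[OF z_unique[unfolded B, rule_format, OF this]]
    obtain w' where "w' \<in> ?Z" "w' \<in> connected_component_set (- K) w" by (elim exE conjE)
    then show "\<exists>w'\<in>?Z. connected_component (- K) w w'" by auto
  qed
  also have "\<dots> \<subseteq> uniform_closure_on K (uniform_closure_on K (dirichlet_rational_on K z N))"
    unfolding rational_closure_def
  proof (rule uniform_closure_on_mono, rule subsetI)
    fix g assume "g \<in> rational_with_poles ?Z"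
    then obtain h where h: "h \<in> partial_fractions ?Z" "\<And>s. s \<notin> ?Z \<Longrightarrow> g s = h s"
      using rational_with_poles_partial_fractions unfolding partial_fractions_off_def by blast
    show "g \<in> uniform_closure_on K (dirichlet_rational_on K z N)"
      by (rule uniform_closure_on_cong[OF partial_fractions_in_dirichlet_closure[OF K(1) Z_K h(1)] h(2)])
        (use Z_K in auto)
  qed
  finally have f_cl: "f \<in> uniform_closure_on K (dirichlet_rational_on K z N)"
    by (simp only: uniform_closure_on_idem)
  have "\<epsilon> / 2 > 0" using eps by simp
  then obtain R where "R \<in> dirichlet_rational_on K z N" and fR: "\<And>s. s \<in> K \<Longrightarrow> norm (f s - R s) < \<epsilon> / 2"
    using uniform_closure_onD[OF f_cl] by metis
  then obtain P where P: "\<forall>j\<in>{0..N}. dirichlet_polynomial (P j)"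
    "\<And>s. s \<in> K \<Longrightarrow> R s = P 0 s + (\<Sum>j=1..N. P j (1 / (s - z j)))"
    unfolding dirichlet_rational_on_def by blast
  have "sup_norm_on K (\<lambda>s. f s - (P 0 s + (\<Sum>j=1..N. P j (1 / (s - z j))))) \<le> \<epsilon> / 2"
    unfolding sup_norm_on_def using K(2) fR P(2) by (intro cSUP_least) (auto intro: less_imp_le)
  then have "sup_norm_on K (\<lambda>s. f s - (P 0 s + (\<Sum>j=1..N. P j (1 / (s - z j))))) < \<epsilon>"
    using eps by simp
  then show ?thesis using P(1) unfolding K_def by blast
qed

end
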